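(* Let $m=(m_1,\dots,m_n)$ be a multi-index of positive integers and let $\rho\in\Pi_n$ be a set partition of $\{1,\dots,n\}$. Then $$\left\langle\,\big|_\rho\,p_m\right\rangle_h=h^{-\operatorname{wt}(m)+\ell(\rho)-1}\sum_{\alpha\,\top\,\rho}\ \prod_{k=1}^{\ell(\alpha)}\langle\!\langle m_{\alpha_k}\rangle\!\rangle+\dots,$$ where the sum is over all $\alpha\in\Pi_n$ complementary to $\rho$, $m_{\alpha_k}=\{m_i\}_{i\in\alpha_k}$, $\operatorname{wt}(m)=\sum_i(m_i+1)$, and the dots stand for terms of lower degree in $h^{-1}$.
   Context: For a partition $\lambda=(\lambda_1\ge\lambda_2\ge\dots)$ and $k\ge1$ put $p_k(\lambda)=\sum_{i=1}^\infty[(\lambda_i-i+\frac12)^k-(-i+\frac12)^k]+(1-2^{-k})\zeta(-k)$. $\Lambda^*$ is the algebra of functions on partitions generated by $p_1,p_2,\dots$. $\Pi_s$ is the set of set partitions of $\{1,\dots,s\}$; $\ell(\alpha)$ is the number of blocks $\alpha_1,\dots,\alpha_{\ell(\alpha)}$ of $\alpha$. For $F,F_1,\dots,F_s\in\Lambda^*$ and $|q|<1$, $$\langle F\rangle_q=\prod_{n\ge1}(1-q^n)\sum_\lambda q^{|\lambda|}F(\lambda),\qquad \langle F_1|\cdots|F_s\rangle_q=\sum_{\alpha\in\Pi_s}(-1)^{\ell(\alpha)-1}(\ell(\alpha)-1)!\prod_{k=1}^{\ell(\alpha)}\Big\langle\prod_{i\in\alpha_k}F_i\Big\rangle_q,$$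 the first sum being over all partitions $\lambda$. Setting $q=e^{-h}$, as $h\to+0$ these quantities equal a polynomial in $h^{-1}$ plus an exponentially small error $O(e^{-\mathrm{const}/h}/h^{\mathrm{const}})$; $\langle F_1|\cdots|F_s\rangle_h$ denotes that polynomial in $h^{-1}$. For $\rho\in\Pi_n$ with blocks $\rho_1,\dots,\rho_{\ell(\rho)}$, $$\left\langle\,\big|_\rho\,p_m\right\rangle_h=\Big\langle\prod_{i\in\rho_1}p_{m_i}\,\Big|\cdots\Big|\prod_{i\in\rho_{\ell(\rho)}}p_{m_i}\Big\rangle_h.$$ Elementary cumulants: $\langle\!\langle m_1,\dots,m_n\rangle\!\rangle$ is defined as the coefficient in $\langle p_{m_1}|\cdots|p_{m_n}\rangle_h=\langle\!\langle m\rangle\!\rangle\,h^{-|m|-1}+\dots$, where $|m|=\sum m_i$ and the dots stand for terms of lower degree in $h^{-1}$. For $\alpha,\beta\in\Pi_n$, $\alpha\wedge\beta$ denotes the finest set partition each of whose blocks is a union of blocks of $\alpha$ and also a union of blocks of $\beta$. $\alpha$ and $\beta$ are complementary, $\alpha\,\top\,\beta$, if $\alpha\wedge\beta$ is the one-block partition and $\ell(\alpha)+\ell(\beta)-\ell(\alpha\wedge\beta)=n$. *)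

theory Defs
  imports
    "HOL-Complex_Analysis.Complex_Analysis"
    "HOL-Library.Disjoint_Sets"
    "HOL-Library.Landau_Symbols"
    "HOL-Computational_Algebra.Polynomial"
begin

(* The Riemann zeta function as the analytic continuation of its Dirichlet series;
   by the identity theorem the holomorphic extension to the punctured plane is unique. *)
definition riemann_zeta :: "complex \<Rightarrow> complex" where
  "riemann_zeta s = (THE w. \<exists>f. f holomorphic_on (- {1}) \<and>
      (\<forall>z. Re z > 1 \<longrightarrow> (\<lambda>n. of_nat (Suc n) powr (- z)) sums f z) \<and> w = f s)"

(* A partition is a weakly decreasing sequence of naturals with finitely many nonzero entries.
   Sequences are indexed from 0, so the part written lambda_i in the usual 1-based
   notation is lam (i - 1). *)
definition int_partitions :: "(nat \<Rightarrow> nat) set" where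
  "int_partitions = {lam. antimono lam \<and> finite {i. lam i \<noteq> 0}}"

definition psize :: "(nat \<Rightarrow> nat) \<Rightarrow> nat" where
  "psize lam = (\<Sum>i | lam i \<noteq> 0. lam i)"

(* The summation index i is the usual 1-based index minus 1. Only finitely many terms
   of the series are nonzero when lam is a partition. *)
definition psum :: "nat \<Rightarrow> (nat \<Rightarrow> nat) \<Rightarrow> real" where
  "psum k lam =
     (\<Sum>i. (real (lam i) - real (Suc i) + 1/2) ^ k - (- real (Suc i) + 1/2) ^ k)
     + (1 - 1 / 2 ^ k) * Re (riemann_zeta (- of_nat k))"

definition qbracket :: "((nat \<Rightarrow> nat) \<Rightarrow> real) \<Rightarrow> real \<Rightarrow> real" where
  "qbracket F q =
     (\<Prod>n. 1 - q ^ Suc n) * (\<Sum>\<^sub>\<infinity>lam\<in>int_partitions. q ^ psize lam * F lam)"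

(* The connected bracket of a family F over a nonempty finite index set I. It does not depend
   on an ordering of the family; I = {1..s} gives the bracket of the tuple F 1, ..., F s. *)
definition connected_qbracket :: "'i set \<Rightarrow> ('i \<Rightarrow> (nat \<Rightarrow> nat) \<Rightarrow> real) \<Rightarrow> real \<Rightarrow> real" where
  "connected_qbracket I F q =
     (\<Sum>\<alpha> | partition_on I \<alpha>. (-1) ^ (card \<alpha> - 1) * fact (card \<alpha> - 1) *
        (\<Prod>B\<in>\<alpha>. qbracket (\<lambda>lam. \<Prod>i\<in>B. F i lam) q))"

(* P, evaluated at 1/h, is the polynomial part of f as h tends to 0 from the right. At most
   one P qualifies, because a nonzero polynomial in 1/h is not exponentially small. *)
definition is_h_expansion :: "(real \<Rightarrow> real) \<Rightarrow> real poly \<Rightarrow> bool" where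
  "is_h_expansion f P \<longleftrightarrow>
     (\<exists>c>0. \<exists>C. (\<lambda>h. f h - poly P (1 / h)) \<in> O[at_right 0](\<lambda>h. exp (- c / h) / h powr C))"

(* A polynomial whose indeterminate stands for 1/h. *)
definition connected_hbracket :: "'i set \<Rightarrow> ('i \<Rightarrow> (nat \<Rightarrow> nat) \<Rightarrow> real) \<Rightarrow> real poly" where
  "connected_hbracket I F =
     (THE P. is_h_expansion (\<lambda>h. connected_qbracket I F (exp (- h))) P)"

(* The entries of the connected bracket are indexed by the blocks of rho themselves. *)
definition block_hbracket :: "nat set set \<Rightarrow> (nat \<Rightarrow> nat) \<Rightarrow> real poly" where
  "block_hbracket \<rho> m = connected_hbracket \<rho> (\<lambda>B lam. \<Prod>i\<in>B. psum (m i) lam)"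

(* The elementary cumulant of the subfamily of m indexed by I. *)
definition elem_cumulant :: "nat set \<Rightarrow> (nat \<Rightarrow> nat) \<Rightarrow> real" where
  "elem_cumulant I m =
     coeff (connected_hbracket I (\<lambda>i. psum (m i))) ((\<Sum>i\<in>I. m i) + 1)"

definition set_partitions :: "nat \<Rightarrow> nat set set set" where
  "set_partitions n = {\<alpha>. partition_on {1..n} \<alpha>}"

definition common_coarsenings ::
    "nat \<Rightarrow> nat set set \<Rightarrow> nat set set \<Rightarrow> nat set set set" where
  "common_coarsenings n \<alpha> \<beta> =
     {\<gamma> \<in> set_partitions n. \<forall>B\<in>\<gamma>. (\<exists>S\<subseteq>\<alpha>. B = \<Union>S) \<and> (\<exists>S\<subseteq>\<beta>. B = \<Union>S)}"

(* Despite the name, this is the join for the ordering by refinement: coarser than both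
   arguments, and finest with that property. *)
definition wedge :: "nat \<Rightarrow> nat set set \<Rightarrow> nat set set \<Rightarrow> nat set set" where
  "wedge n \<alpha> \<beta> = (THE \<gamma>. \<gamma> \<in> common_coarsenings n \<alpha> \<beta> \<and>
     (\<forall>\<delta> \<in> common_coarsenings n \<alpha> \<beta>. refines {1..n} \<gamma> \<delta>))"

definition complementary :: "nat \<Rightarrow> nat set set \<Rightarrow> nat set set \<Rightarrow> bool" where
  "complementary n \<alpha> \<beta> \<longleftrightarrow> wedge n \<alpha> \<beta> = {{1..n}} \<and>
     int (card \<alpha>) + int (card \<beta>) - int (card (wedge n \<alpha> \<beta>)) = int n"

definition wt :: "nat \<Rightarrow> (nat \<Rightarrow> nat) \<Rightarrow> nat" where
  "wt n m = (\<Sum>i=1..n. m i + 1)"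

end

theory Submission
  imports Defs "HOL-Real_Asymp.Real_Asymp"
begin

text \<open>
  A partition together with an integer charge \<open>c\<close> is a finite set \<open>D\<close> of half-integers, the
  positions where its Maya diagram differs from the vacuum. The energy \<open>\<Sum>\<bar>a\<bar>\<close> of \<open>D\<close> is the size of
  the partition plus \<open>c\<^sup>2/2\<close>, so under the product measure with weight \<open>exp (- h * energy)\<close> the
  partition and the charge are independent, and the \<open>q\<close>-bracket is an expectation under that measure.
  There the charge moments \<open>P\<^sub>k = \<Sum> sgn a * a^k\<close> are sums over independent sites. Their joint cumulants
  are therefore sums of \<open>a^K\<close> (with \<open>K\<close> the sum of the indices) times a function of the Fermi
  distribution; moving the contour shows that such a sum is a multiple of \<open>h^(-K-1)\<close> (plus a
  constant in the case of a mean), up to an exponentially small error. The functions \<open>p\<^sub>k\<close> of the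
  partition are polynomials in the \<open>P\<^sub>j\<close> of weight at most \<open>k + 1\<close>, where \<open>P\<^sub>j\<close> has weight \<open>j + 1\<close> and
  \<open>P\<^sub>0\<close> is the charge. The formula of Leonov and Shiryaev turns this into the existence of the
  expansions, with degree at most \<open>m\<^sub>1 + \<dots> + m\<^sub>n + 1\<close> for the cumulant of
  \<open>p\<^sub>m\<^sub>1, \<dots>, p\<^sub>m\<^sub>n\<close>, whatever the zeta constants are. Applied once more to
  the blocks of \<open>\<rho>\<close> it writes the bracket as a sum over the \<open>\<alpha>\<close> that are connected relative to
  \<open>\<rho>\<close>; as a connected graph has at most one more vertex than edges, exactly the complementary
  \<open>\<alpha>\<close> reach the top degree.
\<close>

section \<open>Cumulants over set partitions\<close>


text \<open>At fixed charge the sites of a Maya diagram are not independent; letting the charge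
  fluctuate restores a product measure, at the price that each power sum becomes a polynomial in the
  charge and the other moments. This costs nothing in degree. A product of generators with indices
  j_1, ..., j_r has as weight the sum of the j_l + 1; a block of a partition of all the factors
  contributes 1 plus the sum of its indices; and if r factors in all are grouped into s products, a
  partition linking the groups has at most r + 1 - s blocks. The total is at most 1 plus the sum
  over the products of weight minus 1. The poles of the Fermi function start at height pi, which
  leaves room for the strip of half-width 3/2 < pi/2 around contours at height 1, where the error of
  the half-integer kernel is of size exp (- 2 pi / h). A single Fermi factor does not decay towards
  minus infinity, so a mean is recovered from its derivative in \<open>h\<close>; that is where the
  additive constant comes from. No elementary cumulant is ever evaluated: only its position as the
  coefficient at the degree bound matters.\<close>

lemma partition_on_remove_block:
  assumes "partition_on A P" "B \<in> P"
  shows "partition_on (A - B) (P - {B})"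
proof -
  have "disjnt B (\<Union>(P - {B}))"
    using assms by (force simp: partition_on_def disjoint_def disjnt_def)
  moreover have "insert B (P - {B}) = P" using assms by blast
  ultimately show ?thesis using partition_on_insert[of B "P - {B}" A] assms by simp
qed

lemma partition_on_insert_block:
  assumes "partition_on (A - B) P" "B \<subseteq> A" "B \<noteq> {}"
  shows "partition_on A (insert B P)" "B \<notin> P"
proof -
  have "\<Union>P = A - B" using assms by (simp add: partition_on_def)
  then have "disjnt B (\<Union>P)" by (auto simp: disjnt_def)
  then show "partition_on A (insert B P)" using partition_on_insert[of B P A] assms by simp
  show "B \<notin> P" using \<open>\<Union>P = A - B\<close> assms by blast
qed

lemma finite_partitions: "finite A \<Longrightarrow> finite {P. partition_on A P}"
  using finitely_many_partition_on by blast

text \<open>Double counting of partitions with one marked block: deleting the marked block and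
  inserting it again are mutually inverse, so the mark may be chosen before the rest of the
  partition.\<close>

lemma sum_partition_on_marked:
  fixes F :: "'a set \<Rightarrow> 'a set set \<Rightarrow> 'b::comm_monoid_add"
  assumes "finite A"
  shows "(\<Sum>P | partition_on A P. \<Sum>B\<in>P. F B (P - {B})) =
    (\<Sum>B\<in>Pow A - {{}}. \<Sum>P | partition_on (A - B) P. F B P)"
proof -
  have fin: "\<forall>P\<in>{P. partition_on A P}. finite P"
    using assms finite_elements by blast
  have fin': "\<forall>B\<in>Pow A - {{}}. finite {P. partition_on (A - B) P}"
    using assms by (simp add: finite_partitions)
  show ?thesis
    unfolding sum.Sigma[OF finite_partitions[OF assms] fin]
      sum.Sigma[OF finite_Diff[OF finite_Pow_iff[THEN iffD2, OF assms]] fin']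
  proof (rule sum.reindex_bij_witness[of _ "\<lambda>(B, P). (insert B P, B)" "\<lambda>(P, B). (B, P - {B})"],
      goal_cases)
    case (1 a) then show ?case by auto
  next
    case (2 a)
    then show ?case
      using partition_on_remove_block[of A "fst a" "snd a"] by (auto simp: partition_on_def)
  next
    case (3 b)
    then obtain B P where b: "b = (B, P)" "B \<subseteq> A" "B \<noteq> {}" "partition_on (A - B) P" by auto
    then have "B \<notin> P" using partition_on_insert_block(2) by metis
    then show ?case using b by auto
  next
    case (4 b)
    then obtain B P where b: "b = (B, P)" "B \<subseteq> A" "B \<noteq> {}" "partition_on (A - B) P" by auto
    then have "partition_on A (insert B P)" using partition_on_insert_block(1) by metis
    then show ?case using b by auto
  qed auto
qed

lemma sum_Pow_insert:
  fixes F :: "'a set \<Rightarrow> 'b::comm_monoid_add"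
  assumes "finite A" "x \<notin> A"
  shows "(\<Sum>S\<in>Pow (insert x A). F S) = (\<Sum>S\<in>Pow A. F S) + (\<Sum>S\<in>Pow A. F (insert x S))"
proof -
  have "inj_on (insert x) (Pow A)" using assms(2) by (auto simp: inj_on_def)
  then show ?thesis
    using assms by (subst Pow_insert, subst sum.union_disjoint) (auto simp: sum.reindex)
qed

text \<open>A partition is determined by the block of \<open>x\<close> and a partition of what
  remains. It follows from the marked sum with a weight \<open>?G\<close> that vanishes unless the
  marked block contains \<open>x\<close>, so that exactly one mark per partition survives.\<close>

lemma sum_partition_on_insert:
  fixes F :: "'a set set \<Rightarrow> 'b::comm_monoid_add"
  assumes "finite A" "x \<notin> A"
  shows "(\<Sum>P | partition_on (insert x A) P. F P) =
    (\<Sum>S\<in>Pow A. \<Sum>P | partition_on (A - S) P. F (insert (insert x S) P))"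
proof -
  let ?G = "\<lambda>B P. if x \<in> B then F (insert B P) else 0"
  have one: "F P = (\<Sum>B\<in>P. ?G B (P - {B}))" if P: "partition_on (insert x A) P" for P
  proof -
    obtain B where B: "B \<in> P" "x \<in> B" using P by (auto simp: partition_on_def)
    have "x \<notin> C" if "C \<in> P" "C \<noteq> B" for C
      using P B that by (auto simp: partition_on_def disjoint_def)
    then have "(\<Sum>C\<in>P. ?G C (P - {C})) = (\<Sum>C\<in>{B}. ?G C (P - {C}))"
      using B finite_elements[OF _ P] assms by (intro sum.mono_neutral_right) auto
    then show ?thesis using B by (simp add: insert_absorb)
  qed
  have "(\<Sum>P | partition_on (insert x A) P. F P) =
      (\<Sum>B\<in>Pow (insert x A) - {{}}. \<Sum>P | partition_on (insert x A - B) P. ?G B P)"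
    using one assms by (subst sum_partition_on_marked[symmetric]) (auto intro!: sum.cong)
  also have "\<dots> = (\<Sum>B\<in>Pow (insert x A). if B = {} then 0 else \<Sum>P | partition_on (insert x A - B) P. ?G B P)"
    using assms by (intro sum.mono_neutral_cong_left) auto
  also have "\<dots> = (\<Sum>S\<in>Pow A. if S = {} then 0 else \<Sum>P | partition_on (insert x A - S) P. ?G S P)
      + (\<Sum>S\<in>Pow A. \<Sum>P | partition_on (A - S) P. F (insert (insert x S) P))"
    using assms by (subst sum_Pow_insert) (auto intro!: sum.cong arg_cong2[where f="(+)"])
  also have "(\<Sum>S\<in>Pow A. if S = {} then 0 else \<Sum>P | partition_on (insert x A - S) P. ?G S P) = 0"
  proof (intro sum.neutral ballI)
    fix S assume "S \<in> Pow A"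
    then have "x \<notin> S" using assms by auto
    then show "(if S = {} then 0 else \<Sum>P | partition_on (insert x A - S) P. ?G S P) = 0" by simp
  qed
  finally show ?thesis by simp
qed

text \<open>A chain of \<open>R\<close> inside \<open>S\<close> inside \<open>A\<close> is an
  ordered splitting of \<open>A\<close> into three pieces. This is associativity of the convolution
  of set functions, in which all moment identities below are phrased.\<close>

lemma sum_Pow_Pow:
  fixes F :: "'a set \<Rightarrow> 'a set \<Rightarrow> 'a set \<Rightarrow> 'b::comm_monoid_add"
  assumes "finite A"
  shows "(\<Sum>S\<in>Pow A. \<Sum>R\<in>Pow S. F R (S - R) (A - S)) =
    (\<Sum>R\<in>Pow A. \<Sum>T\<in>Pow (A - R). F R T (A - R - T))"
proof -
  have 1: "\<forall>S\<in>Pow A. finite (Pow S)" "\<forall>R\<in>Pow A. finite (Pow (A - R))"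
    using assms by (auto intro: finite_subset)
  have 2: "finite (Pow A)" using assms by simp
  show ?thesis
    unfolding sum.Sigma[OF 2 1(1)] sum.Sigma[OF 2 1(2)]
  proof (rule sum.reindex_bij_witness[of _ "\<lambda>(R, T). (R \<union> T, R)" "\<lambda>(S, R). (R, S - R)"])
    fix a assume "a \<in> (SIGMA x:Pow A. Pow x)"
    then have "A - snd a - (fst a - snd a) = A - fst a" by auto
    then show "(case case a of (S, R) \<Rightarrow> (R, S - R) of (x, y) \<Rightarrow> F x y (A - x - y)) =
         (case a of (x, y) \<Rightarrow> F y (x - y) (A - x))"
      by (simp add: case_prod_beta)
  qed auto
qed

lemma sum_Pow_compl:
  "(\<Sum>S\<in>Pow A. F S (A - S)) = (\<Sum>S\<in>Pow A. F (A - S) S)"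
  by (rule sum.reindex_bij_witness[of _ "\<lambda>S. A - S" "\<lambda>S. A - S"]) (auto simp: double_diff)

text \<open>\<open>M\<close> stands for the function sending a set of indices to the moment of the
  corresponding product. Keeping it abstract lets one calculus serve q-brackets, grand canonical
  means and their finite truncations. On the empty index set the value is 1, by truncated
  subtraction.\<close>

definition cumulant :: "('i set \<Rightarrow> real) \<Rightarrow> 'i set \<Rightarrow> real" where
  "cumulant M I = (\<Sum>P | partition_on I P.
     (-1) ^ (card P - 1) * fact (card P - 1) * (\<Prod>B\<in>P. M B))"

text \<open>The exponential for the convolution of set functions; it inverts the passage from
  moments to cumulants.\<close>

definition partition_exp :: "('i set \<Rightarrow> real) \<Rightarrow> 'i set \<Rightarrow> real" where
  "partition_exp K I = (\<Sum>P | partition_on I P. \<Prod>B\<in>P. K B)"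

lemma prod_insert_partition:
  assumes "finite A" "x \<notin> A" "S \<in> Pow A" "partition_on (A - S) P"
  shows "finite P" "insert x S \<notin> P"
  using assms finite_elements[of "A - S" P] by (auto simp: partition_on_def)

lemma partition_exp_empty [simp]: "partition_exp K {} = 1"
  by (simp add: partition_exp_def partition_on_empty)

lemma partition_exp_insert:
  assumes "finite A" "x \<notin> A"
  shows "partition_exp K (insert x A) = (\<Sum>S\<in>Pow A. K (insert x S) * partition_exp K (A - S))"
  unfolding partition_exp_def sum_partition_on_insert[OF assms] sum_distrib_left
  using prod_insert_partition[OF assms] by (intro sum.cong refl) simp

text \<open>The alternating sum is the geometric series for the convolution inverse of
  \<open>M\<close>. Splitting off a nonempty factor marks a block; a partition with k + 1 blocks
  arises from k + 1 marks, which turns the k! into (k + 1)! with the opposite sign and cancels the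
  term of the empty factor.\<close>

lemma convolution_inverse:
  assumes "finite A" "M {} = (1::real)"
  shows "(\<Sum>J\<in>Pow A. (\<Sum>P | partition_on J P. (-1) ^ card P * fact (card P) * (\<Prod>B\<in>P. M B)) * M (A - J))
    = (if A = {} then 1 else 0)"
proof (cases "A = {}")
  case True
  then show ?thesis using assms by (simp add: partition_on_empty)
next
  case False
  define G where "G A = (\<Sum>P | partition_on A P. (-1) ^ card P * fact (card P) * (\<Prod>B\<in>P. M B))" for A
  have "(\<Sum>J\<in>Pow A. G J * M (A - J)) = (\<Sum>J\<in>Pow A. M J * G (A - J))"
    by (subst sum_Pow_compl[where F = "\<lambda>S T. G S * M T"]) (simp add: mult.commute)
  also have "\<dots> = G A + (\<Sum>J\<in>Pow A - {{}}. M J * G (A - J))"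
    using assms by (subst sum.remove[of "Pow A" "{}"]) auto
  also have "(\<Sum>J\<in>Pow A - {{}}. M J * G (A - J)) =
      (\<Sum>P | partition_on A P. \<Sum>B\<in>P. M B * ((-1) ^ card (P - {B}) * fact (card (P - {B})) * (\<Prod>C\<in>P - {B}. M C)))"
    unfolding G_def sum_distrib_left by (subst sum_partition_on_marked[OF assms(1)]) simp
  also have "\<dots> = (\<Sum>P | partition_on A P. - ((-1) ^ card P * fact (card P) * (\<Prod>B\<in>P. M B)))"
  proof (intro sum.cong refl)
    fix P assume "P \<in> {P. partition_on A P}"
    then have P: "partition_on A P" "finite P" using assms finite_elements by auto
    then have "P \<noteq> {}" using False by (auto simp: partition_on_def)
    then obtain k where k: "card P = Suc k" using P by (cases "card P") auto
    have "M B * ((-1) ^ card (P - {B}) * fact (card (P - {B})) * (\<Prod>C\<in>P - {B}. M C)) =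
        (-1) ^ k * fact k * (\<Prod>C\<in>P. M C)" if "B \<in> P" for B
      using P that k by (simp add: prod.remove[of P B M])
    then have "(\<Sum>B\<in>P. M B * ((-1) ^ card (P - {B}) * fact (card (P - {B})) * (\<Prod>C\<in>P - {B}. M C))) =
        (\<Sum>B\<in>P. (-1) ^ k * fact k * (\<Prod>C\<in>P. M C))"
      by (intro sum.cong refl)
    then show "(\<Sum>B\<in>P. M B * ((-1) ^ card (P - {B}) * fact (card (P - {B})) * (\<Prod>C\<in>P - {B}. M C)))
       = - ((-1) ^ card P * fact (card P) * (\<Prod>B\<in>P. M B))"
      using k by (simp add: algebra_simps)
  qed
  also have "G A + \<dots> = 0" unfolding G_def by (simp add: sum_negf)
  finally show ?thesis using False unfolding G_def by simp
qed

text \<open>In the cumulant, \<open>card P - 1\<close> counts the blocks that avoid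
  \<open>x\<close>; so the cumulant is \<open>M (insert x R)\<close> convolved with the convolution
  inverse of \<open>M\<close>, and convolving with \<open>M\<close> undoes this.\<close>

lemma cumulant_recursion:
  assumes "finite A" "x \<notin> A" "M {} = 1"
  shows "M (insert x A) = (\<Sum>S\<in>Pow A. cumulant M (insert x S) * M (A - S))"
proof -
  define G where "G A = (\<Sum>P | partition_on A P. (-1) ^ card P * fact (card P) * (\<Prod>B\<in>P. M B))" for A
  have K: "cumulant M (insert x S) = (\<Sum>R\<in>Pow S. M (insert x R) * G (S - R))" if "S \<in> Pow A" for S
  proof -
    have S: "finite S" "x \<notin> S" using that assms by (auto intro: finite_subset)
    show ?thesis
      unfolding cumulant_def sum_partition_on_insert[OF S] G_def sum_distrib_left
      using prod_insert_partition[OF S] by (intro sum.cong refl) (simp add: algebra_simps)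
  qed
  have "(\<Sum>S\<in>Pow A. cumulant M (insert x S) * M (A - S)) =
      (\<Sum>S\<in>Pow A. \<Sum>R\<in>Pow S. M (insert x R) * (G (S - R) * M (A - S)))"
    using K by (intro sum.cong refl) (simp add: sum_distrib_right mult.assoc)
  also have "\<dots> = (\<Sum>R\<in>Pow A. \<Sum>T\<in>Pow (A - R). M (insert x R) * (G T * M (A - R - T)))"
    by (rule sum_Pow_Pow[OF assms(1), of "\<lambda>R T Q. M (insert x R) * (G T * M Q)"])
  also have "\<dots> = (\<Sum>R\<in>Pow A. M (insert x R) * (if A - R = {} then 1 else 0))"
    unfolding sum_distrib_left[symmetric] G_def
    using assms by (intro sum.cong refl) (simp add: convolution_inverse)
  also have "\<dots> = (\<Sum>R\<in>{A}. M (insert x R))"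
    using assms by (intro sum.mono_neutral_cong_right) auto
  finally show ?thesis by simp
qed

text \<open>The recursion is triangular: the term \<open>S = A\<close> carries the factor
  \<open>M {} = 1\<close>, so the value on \<open>insert x A\<close> is determined by smaller sets.
  Identities between cumulants are proved below by checking the recursion for the candidate.\<close>

lemma cumulant_unique:
  assumes "finite U" "M {} = 1"
    and rec: "\<And>x A. x \<notin> A \<Longrightarrow> insert x A \<subseteq> U \<Longrightarrow>
      M (insert x A) = (\<Sum>S\<in>Pow A. K (insert x S) * M (A - S))"
  shows "I \<subseteq> U \<Longrightarrow> I \<noteq> {} \<Longrightarrow> cumulant M I = K I"
proof (induction "card I" arbitrary: I rule: less_induct)
  case less
  obtain x A where I: "I = insert x A" "x \<notin> A" using less.prems by (meson ex_in_conv mk_disjoint_insert)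
  have fin: "finite A" using I less.prems assms by (auto intro: finite_subset)
  have IH: "cumulant M (insert x S) = K (insert x S)" if "S \<in> Pow A - {A}" for S
  proof (rule less.hyps)
    have "S \<subset> A" using that by auto
    then have "card S < card A" using fin by (simp add: psubset_card_mono)
    then show "card (insert x S) < card I"
      using I fin that by (simp add: finite_subset[of S A] subset_iff card_insert_if)
  qed (use that I less.prems in auto)
  have "(\<Sum>S\<in>Pow A. cumulant M (insert x S) * M (A - S)) = (\<Sum>S\<in>Pow A. K (insert x S) * M (A - S))"
    using cumulant_recursion[OF fin I(2), of M] rec[OF I(2)] I less.prems assms by simp
  then have "cumulant M (insert x A) * M (A - A) + (\<Sum>S\<in>Pow A - {A}. cumulant M (insert x S) * M (A - S)) =
     K (insert x A) * M (A - A) + (\<Sum>S\<in>Pow A - {A}. K (insert x S) * M (A - S))"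
    using fin by (subst (asm) (1 2) sum.remove[of "Pow A" A]) auto
  moreover have "(\<Sum>S\<in>Pow A - {A}. cumulant M (insert x S) * M (A - S)) = (\<Sum>S\<in>Pow A - {A}. K (insert x S) * M (A - S))"
    using IH by (intro sum.cong) auto
  ultimately show ?case using assms I by simp
qed

text \<open>Moments and \<open>partition_exp\<close> of the cumulants obey the same recursion along
  the block of a chosen element.\<close>

lemma partition_exp_cumulant:
  assumes "M {} = 1"
  shows "finite A \<Longrightarrow> partition_exp (cumulant M) A = M A"
proof (induction "card A" arbitrary: A rule: less_induct)
  case less
  show ?case
  proof (cases "A = {}")
    case False
    then obtain x B where A: "A = insert x B" "x \<notin> B" by (meson ex_in_conv mk_disjoint_insert)
    have fin: "finite B" using A less.prems by simp
    have "partition_exp (cumulant M) (B - S) = M (B - S)" if "S \<in> Pow B" for S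
      using fin A that card_mono[of B "B - S"] by (intro less.hyps) auto
    then show ?thesis
      unfolding A(1) partition_exp_insert[OF fin A(2)] cumulant_recursion[where M = M, OF fin A(2) assms]
      by (intro sum.cong) auto
  qed (simp add: assms)
qed

lemma cumulant_cong:
  assumes "\<And>B. B \<subseteq> I \<Longrightarrow> B \<noteq> {} \<Longrightarrow> M B = M' B"
  shows "cumulant M I = cumulant M' I"
  unfolding cumulant_def
  using assms by (intro sum.cong refl arg_cong2[where f="(*)"] prod.cong) (auto simp: partition_on_def)

lemma prod_prod_partition:
  fixes x :: "'a \<Rightarrow> 'b::comm_monoid_mult"
  assumes "finite A" "partition_on A P"
  shows "(\<Prod>B\<in>P. \<Prod>i\<in>B. x i) = (\<Prod>i\<in>A. x i)"
  by (rule prod.partition[OF assms, symmetric])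

lemma sum_sum_partition:
  fixes x :: "'a \<Rightarrow> 'b::comm_monoid_add"
  assumes "finite A" "partition_on A P"
  shows "(\<Sum>B\<in>P. \<Sum>i\<in>B. x i) = (\<Sum>i\<in>A. x i)"
  by (rule sum.partition[OF assms, symmetric])

section \<open>Cumulants of scaled, independent and deterministic families\<close>

lemma cumulant_scale:
  assumes "finite I"
  shows "cumulant (\<lambda>A. M A * (\<Prod>i\<in>A. x i)) I = cumulant M I * (\<Prod>i\<in>I. x i)"
  unfolding cumulant_def sum_distrib_right
  using prod_prod_partition[OF assms, of _ x]
  by (intro sum.cong refl) (simp add: prod.distrib mult.assoc)

text \<open>The convolved moments are those of a sum of two independent families, expanded by
  choosing one summand for each index. For the recursion, the terms are sorted by which of the two
  families receives \<open>x\<close>.\<close>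

lemma cumulant_convolution:
  assumes "finite I" "I \<noteq> {}" "M {} = 1" "M' {} = 1"
  shows "cumulant (\<lambda>A. \<Sum>J\<in>Pow A. M J * M' (A - J)) I = cumulant M I + cumulant M' I"
proof (rule cumulant_unique[OF assms(1)])
  let ?C = "\<lambda>A. \<Sum>J\<in>Pow A. M J * M' (A - J)"
  fix x A assume x: "x \<notin> A" and "insert x A \<subseteq> I"
  then have A: "finite A" using assms finite_subset by auto
  have step: "(\<Sum>J\<in>Pow A. N (insert x J) * N' (A - J)) =
      (\<Sum>S\<in>Pow A. cumulant N (insert x S) * (\<Sum>T\<in>Pow (A - S). N T * N' (A - S - T)))"
    if "N {} = 1" for N N' :: "'a set \<Rightarrow> real"
  proof -
    have "N (insert x J) = (\<Sum>S\<in>Pow J. cumulant N (insert x S) * N (J - S))" if "J \<in> Pow A" for J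
      using that A x \<open>N {} = 1\<close> by (intro cumulant_recursion) (auto intro: finite_subset)
    then have "(\<Sum>J\<in>Pow A. N (insert x J) * N' (A - J)) =
        (\<Sum>J\<in>Pow A. \<Sum>S\<in>Pow J. cumulant N (insert x S) * (N (J - S) * N' (A - J)))"
      by (intro sum.cong refl) (simp add: sum_distrib_right mult.assoc)
    also have "\<dots> = (\<Sum>S\<in>Pow A. \<Sum>T\<in>Pow (A - S). cumulant N (insert x S) * (N T * N' (A - S - T)))"
      by (rule sum_Pow_Pow[OF A, of "\<lambda>R T Q. cumulant N (insert x R) * (N T * N' Q)"])
    finally show ?thesis by (simp add: sum_distrib_left)
  qed
  have comm: "?C B = (\<Sum>J\<in>Pow B. M' J * M (B - J))" for B
    by (subst sum_Pow_compl[where F = "\<lambda>S T. M S * M' T"]) (simp add: mult.commute)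
  have ins: "insert x A - J = insert x (A - J)" if "J \<in> Pow A" for J using that x by auto
  have "?C (insert x A) = (\<Sum>J\<in>Pow A. M (insert x J) * M' (A - J)) + (\<Sum>J\<in>Pow A. M' (insert x (A - J)) * M J)"
    using x ins by (simp add: sum_Pow_insert[OF A x] add.commute mult.commute)
  also have "(\<Sum>J\<in>Pow A. M' (insert x (A - J)) * M J) = (\<Sum>J\<in>Pow A. M' (insert x J) * M (A - J))"
    by (rule sum_Pow_compl[symmetric, where F = "\<lambda>S T. M' (insert x S) * M T"])
  also have "\<dots> = (\<Sum>S\<in>Pow A. cumulant M' (insert x S) * ?C (A - S))"
    unfolding step[where N = M', OF assms(4)] comm ..
  finally show "?C (insert x A) = (\<Sum>S\<in>Pow A. (cumulant M (insert x S) + cumulant M' (insert x S)) * ?C (A - S))"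
    unfolding step[where N = M, OF assms(3)] by (simp add: sum.distrib algebra_simps)
qed (use assms in auto)

lemma cumulant_one:
  assumes "finite I" "I \<noteq> {}"
  shows "cumulant (\<lambda>_. 1) I = (if card I = 1 then 1 else 0)"
proof (rule cumulant_unique[OF assms(1)])
  fix x A assume x: "x \<notin> A" "insert x A \<subseteq> I"
  then have A: "finite A" using assms finite_subset by auto
  have "(\<Sum>S\<in>Pow A. (if card (insert x S) = 1 then 1 else 0) * (1::real)) = (\<Sum>S\<in>{{}::'a set}. 1)"
  proof (rule sum.mono_neutral_cong_right)
    show "\<forall>S\<in>Pow A - {{}}. (if card (insert x S) = 1 then 1 else 0) * (1::real) = 0"
    proof
      fix S assume S: "S \<in> Pow A - {{}}"
      then have "finite S" "x \<notin> S" "card S \<noteq> 0" using A x finite_subset[of S A] by auto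
      then show "(if card (insert x S) = 1 then 1 else 0) * (1::real) = 0" by simp
    qed
  qed (use A in auto)
  then show "1 = (\<Sum>S\<in>Pow A. (if card (insert x S) = 1 then 1 else 0) * (1::real))" by simp
qed (use assms in auto)

lemma cumulant_deterministic:
  assumes "finite I" "I \<noteq> {}"
  shows "cumulant (\<lambda>A. \<Prod>i\<in>A. c i) I = (if card I = 1 then \<Prod>i\<in>I. c i else 0)"
  using cumulant_scale[OF assms(1), of "\<lambda>_. 1" c] by (simp add: cumulant_one[OF assms])

text \<open>The constant moment \<open>p\<close> belongs to a Bernoulli variable X, since X equals
  its own powers. The variable X - 1 has moments \<open>1 - p\<close> times a sign, and the shift by
  -1 is deterministic, so it affects first cumulants only; \<open>?M\<close> and \<open>?N\<close>
  are the moments of X and of the shift.\<close>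

lemma cumulant_const_reflect:
  assumes "finite I" "card I \<ge> 2"
  shows "cumulant (\<lambda>_. 1 - p) I = (-1) ^ card I * cumulant (\<lambda>_. p) I"
proof -
  have I: "I \<noteq> {}" using assms by auto
  let ?M = "\<lambda>A::'a set. if A = {} then 1 else p" and ?N = "\<lambda>A::'a set. \<Prod>i\<in>A. (-1::real)"
  have conv: "(\<Sum>J\<in>Pow A. ?M J * ?N (A - J)) = (1 - p) * ?N A" if A: "A \<subseteq> I" "A \<noteq> {}" for A
  proof -
    have fin: "finite A" using A assms finite_subset by auto
    have "(\<Sum>J\<in>Pow A. ?N (A - J)) = (\<Prod>x\<in>A. 1 + (-1))"
      using fin by (subst prod_add) auto
    also have "\<dots> = 0" using A fin by (simp add: card_gt_0_iff)
    finally have 0: "(\<Sum>J\<in>Pow A. ?N (A - J)) = 0" .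
    have "(\<Sum>J\<in>Pow A. ?M J * ?N (A - J)) =
        (\<Sum>J\<in>Pow A. p * ?N (A - J) + (if J = {} then (1 - p) * ?N A else 0))"
      by (intro sum.cong refl) (auto simp: algebra_simps)
    also have "\<dots> = p * (\<Sum>J\<in>Pow A. ?N (A - J)) + (1 - p) * ?N A"
      using fin unfolding sum_distrib_left sum.distrib by (subst sum.delta) auto
    finally show ?thesis using 0 by simp
  qed
  have "cumulant (\<lambda>A. (1 - p) * ?N A) I = cumulant (\<lambda>A. \<Sum>J\<in>Pow A. ?M J * ?N (A - J)) I"
    using conv by (intro cumulant_cong) simp
  also have "\<dots> = cumulant ?M I + cumulant ?N I"
    using assms I by (intro cumulant_convolution) auto
  also have "cumulant ?N I = 0"
    using assms I by (subst cumulant_deterministic) auto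
  also have "cumulant ?M I = cumulant (\<lambda>_. p) I" by (intro cumulant_cong) auto
  also have "cumulant (\<lambda>A. (1 - p) * ?N A) I = cumulant (\<lambda>_. 1 - p) I * (-1) ^ card I"
    using cumulant_scale[OF assms(1), of "\<lambda>_. 1 - p" "\<lambda>_. -1"] by simp
  finally show ?thesis by (cases "even (card I)") auto
qed

section \<open>Cumulants of products\<close>


text \<open>Connectedness of the bipartite graph between indices and blocks, stated without paths:
  no proper nonempty set of indices is left uncut by all blocks. In this form minimal closed sets
  can replace walks.\<close>

definition linked :: "('u \<Rightarrow> 'i) \<Rightarrow> 'i set \<Rightarrow> 'u set set \<Rightarrow> bool" where
  "linked f I P \<longleftrightarrow>
     (\<forall>J\<subseteq>I. J \<noteq> {} \<longrightarrow> J \<noteq> I \<longrightarrow> (\<exists>B\<in>P. f ` B \<inter> J \<noteq> {} \<and> \<not> f ` B \<subseteq> J))"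

abbreviation saturated :: "('u \<Rightarrow> 'i) \<Rightarrow> 'u set set \<Rightarrow> 'i set \<Rightarrow> bool" where
  "saturated f P J \<equiv> (\<forall>B\<in>P. f ` B \<inter> J \<noteq> {} \<longrightarrow> f ` B \<subseteq> J)"

text \<open>The connected component of \<open>x\<close>, as the smallest set of indices containing
  \<open>x\<close> that no block cuts.\<close>

definition component :: "('u \<Rightarrow> 'i) \<Rightarrow> 'i set \<Rightarrow> 'i \<Rightarrow> 'u set set \<Rightarrow> 'i set" where
  "component f V x P = \<Inter>{J. J \<subseteq> V \<and> x \<in> J \<and> saturated f P J}"

lemma linked_iff: "linked f I P \<longleftrightarrow> (\<forall>J\<subseteq>I. J \<noteq> {} \<longrightarrow> J \<noteq> I \<longrightarrow> \<not> saturated f P J)"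
  by (auto simp: linked_def)

lemma saturated_component:
  assumes "\<Union>P = {u \<in> U. f u \<in> V}" "x \<in> V"
  shows "saturated f P (component f V x P)" "x \<in> component f V x P" "component f V x P \<subseteq> V"
proof -
  show "x \<in> component f V x P" by (auto simp: component_def)
  have "saturated f P V" using assms(1) by blast
  then show "component f V x P \<subseteq> V" using assms(2) unfolding component_def by blast
  show "saturated f P (component f V x P)"
  proof (intro ballI impI)
    fix B assume "B \<in> P" and ne: "f ` B \<inter> component f V x P \<noteq> {}"
    have "f ` B \<subseteq> J" if "J \<subseteq> V" "x \<in> J" "saturated f P J" for J
    proof -
      have "component f V x P \<subseteq> J" using that by (auto simp: component_def)
      then have "f ` B \<inter> J \<noteq> {}" using ne by blast
      then show ?thesis using that \<open>B \<in> P\<close> by blast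
    qed
    then show "f ` B \<subseteq> component f V x P" by (auto simp: component_def)
  qed
qed

lemma component_minimal: "J \<subseteq> V \<Longrightarrow> x \<in> J \<Longrightarrow> saturated f P J \<Longrightarrow> component f V x P \<subseteq> J"
  by (auto simp: component_def)

text \<open>That \<open>Q\<close> links \<open>C\<close> uses minimality twice: an uncut part of
  \<open>C\<close> containing \<open>x\<close> would be a smaller candidate for the component, and
  for a part missing \<open>x\<close> the complement in \<open>C\<close> would be one.\<close>

lemma component_split:
  fixes f :: "'u \<Rightarrow> 'i" and U :: "'u set"
  defines "fib \<equiv> \<lambda>S. {u \<in> U. f u \<in> S}"
  assumes P: "partition_on (fib V) P" and x: "x \<in> V"
  defines "C \<equiv> component f V x P"
  defines "Q \<equiv> {B\<in>P. f ` B \<subseteq> C}"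
  shows "partition_on (fib C) Q" "linked f C Q" "partition_on (fib (V - C)) (P - Q)"
proof -
  have U: "\<Union>P = {u \<in> U. f u \<in> V}" using P by (simp add: partition_on_def fib_def)
  note C = saturated_component[OF U x, folded C_def]
  have ne: "{} \<notin> P" and dis: "disjoint P" using P by (auto simp: partition_on_def)
  have block: "\<exists>B\<in>P. u \<in> B \<and> (f u \<in> C \<longrightarrow> B \<in> Q) \<and> (f u \<notin> C \<longrightarrow> B \<notin> Q)" if "u \<in> fib V" for u
  proof -
    have "u \<in> \<Union>P" unfolding U using that by (simp add: fib_def)
    then obtain B where B: "B \<in> P" "u \<in> B" by blast
    then have "f u \<in> C \<longrightarrow> f ` B \<subseteq> C" using C(1) by blast
    then show ?thesis using B by (auto simp: Q_def)
  qed
  have outside: "f ` B \<inter> C = {}" if "B \<in> P - Q" for B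
    using that C(1) by (auto simp: Q_def)
  have "\<Union>Q = fib C"
  proof
    show "\<Union>Q \<subseteq> fib C" using U C(3) by (auto simp: Q_def fib_def)
    show "fib C \<subseteq> \<Union>Q" using block C(3) by (fastforce simp: fib_def)
  qed
  then show Q: "partition_on (fib C) Q"
    using ne dis by (auto simp: partition_on_def Q_def disjoint_def)
  have "\<Union>(P - Q) = fib (V - C)"
  proof
    show "\<Union>(P - Q) \<subseteq> fib (V - C)"
    proof
      fix u assume "u \<in> \<Union>(P - Q)"
      then obtain B where "B \<in> P - Q" "u \<in> B" by blast
      moreover from this have "f u \<notin> C" using outside by blast
      ultimately show "u \<in> fib (V - C)" using U by (auto simp: fib_def)
    qed
    show "fib (V - C) \<subseteq> \<Union>(P - Q)"
    proof
      fix u assume "u \<in> fib (V - C)"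
      then have "u \<in> fib V" "f u \<notin> C" by (auto simp: fib_def)
      then show "u \<in> \<Union>(P - Q)" using block[of u] by blast
    qed
  qed
  then show "partition_on (fib (V - C)) (P - Q)"
    using ne dis by (auto simp: partition_on_def disjoint_def)
  show "linked f C Q"
    unfolding linked_iff
  proof (intro allI impI notI)
    fix J assume J: "J \<subseteq> C" "J \<noteq> {}" "J \<noteq> C" "saturated f Q J"
    show False
    proof (cases "x \<in> J")
      case True
      have "saturated f P J" using J outside by blast
      moreover have "J \<subseteq> V" using J(1) C(3) by blast
      ultimately have "C \<subseteq> J" unfolding C_def by (intro component_minimal True)
      then show False using J by blast
    next
      case False
      have "saturated f P (C - J)"
      proof (intro ballI impI)
        fix B assume B: "B \<in> P" "f ` B \<inter> (C - J) \<noteq> {}"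
        then have "B \<in> Q" "f ` B \<subseteq> C" using C(1) by (auto simp: Q_def)
        moreover have "f ` B \<inter> J = {}" using J(4) B \<open>B \<in> Q\<close> by blast
        ultimately show "f ` B \<subseteq> C - J" by blast
      qed
      moreover have "C - J \<subseteq> V" "x \<in> C - J" using False C(2,3) by blast+
      ultimately have "component f V x P \<subseteq> C - J" by (intro component_minimal)
      then have "C \<subseteq> C - J" unfolding C_def .
      then show False using J by blast
    qed
  qed
qed

text \<open>The inverse of splitting off a component. No block of \<open>Q\<close> or
  \<open>R\<close> cuts \<open>C\<close>, so the component lies inside \<open>C\<close>; being uncut
  by \<open>Q\<close> as well, it is all of \<open>C\<close> because \<open>Q\<close> links
  \<open>C\<close>.\<close>

lemma component_join:
  fixes f :: "'u \<Rightarrow> 'i" and U :: "'u set"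
  defines "fib \<equiv> \<lambda>S. {u \<in> U. f u \<in> S}"
  assumes Q: "partition_on (fib C) Q" "linked f C Q" and R: "partition_on (fib (V - C)) R"
    and C: "C \<subseteq> V" "x \<in> C"
  shows "partition_on (fib V) (Q \<union> R)" "component f V x (Q \<union> R) = C"
    "{B\<in>Q \<union> R. f ` B \<subseteq> C} = Q" "Q \<union> R - Q = R" "Q \<inter> R = {}"
proof -
  have UQ: "\<Union>Q = fib C" and UR: "\<Union>R = fib (V - C)" using Q R by (auto simp: partition_on_def)
  have neR: "{} \<notin> R" and neQ: "{} \<notin> Q" using R Q by (auto simp: partition_on_def)
  have sQ: "f ` B \<subseteq> C" if "B \<in> Q" for B using UQ that by (auto simp: fib_def)
  have sR: "f ` B \<subseteq> V - C" if "B \<in> R" for B using UR that by (auto simp: fib_def)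
  have "\<not> f ` B \<subseteq> C" if "B \<in> R" for B
  proof -
    obtain b where "b \<in> B" using neR \<open>B \<in> R\<close> by (metis ex_in_conv)
    then show ?thesis using sR[OF that] by blast
  qed
  then show eq: "{B\<in>Q \<union> R. f ` B \<subseteq> C} = Q" and disj: "Q \<inter> R = {}" using sQ by blast+
  then show "Q \<union> R - Q = R" by blast
  have "disjoint (Q \<union> R)"
    using Q(1) R UQ UR by (intro disjoint_union) (auto simp: partition_on_def fib_def)
  moreover have "\<Union>(Q \<union> R) = fib V" using UQ UR C by (auto simp: fib_def)
  ultimately show P: "partition_on (fib V) (Q \<union> R)" using neR neQ by (simp add: partition_on_def)
  then have U: "\<Union>(Q \<union> R) = {u \<in> U. f u \<in> V}" by (simp add: partition_on_def fib_def)
  have xV: "x \<in> V" using C by blast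
  note K = saturated_component[OF U xV]
  have sat: "saturated f (Q \<union> R) C" using sQ sR by blast
  have sub: "component f V x (Q \<union> R) \<subseteq> C" by (intro component_minimal C sat)
  have "saturated f Q (component f V x (Q \<union> R))" using K(1) by blast
  moreover have "component f V x (Q \<union> R) \<noteq> {}" using K(2) by blast
  ultimately show "component f V x (Q \<union> R) = C" using Q(2) sub unfolding linked_iff by blast
qed

text \<open>The formula of Leonov and Shiryaev for joint cumulants of products, the products being
  taken over the fibres of \<open>f\<close>. Both sides satisfy the recursion that determines the
  cumulants, because the component of a point under the relation generated by \<open>P\<close> can be split
  off.\<close>
theorem cumulant_fibres:
  fixes f :: "'u \<Rightarrow> 'i" and M :: "'u set \<Rightarrow> real"
  assumes "finite U" "finite I" "I \<noteq> {}" "M {} = 1"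
  shows "cumulant (\<lambda>S. M {u \<in> U. f u \<in> S}) I =
    (\<Sum>P | partition_on {u \<in> U. f u \<in> I} P \<and> linked f I P. \<Prod>B\<in>P. cumulant M B)"
proof (rule cumulant_unique[OF assms(2)])
  let ?fib = "\<lambda>S. {u \<in> U. f u \<in> S}"
  let ?w = "\<lambda>P. \<Prod>B\<in>P. cumulant M B"
  fix x A assume x: "x \<notin> A" "insert x A \<subseteq> I"
  let ?V = "insert x A"
  have finA: "finite A" using x assms finite_subset by auto
  have finf: "finite (?fib S)" for S using assms by simp
  have finp: "finite {P. partition_on (?fib S) P}" for S using finf by (rule finite_partitions)
  have M: "M (?fib S) = (\<Sum>P | partition_on (?fib S) P. ?w P)" for S
    using partition_exp_cumulant[of M, OF assms(4) finf] by (simp add: partition_exp_def)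
  let ?A1 = "\<lambda>S. {P. partition_on (?fib (insert x S)) P \<and> linked f (insert x S) P}"
  let ?A2 = "\<lambda>S. {P. partition_on (?fib (A - S)) P}"
  have f1: "finite (?A1 S)" for S by (rule finite_subset[OF _ finp[of "insert x S"]]) auto
  have finS: "\<forall>S\<in>Pow A. finite (?A1 S \<times> ?A2 S)" by (intro ballI finite_cartesian_product f1 finp)
  have "(\<Sum>S\<in>Pow A. sum ?w (?A1 S) * M (?fib (A - S))) =
      (\<Sum>S\<in>Pow A. \<Sum>(Q, R)\<in>?A1 S \<times> ?A2 S. ?w Q * ?w R)"
    unfolding M sum_product sum.cartesian_product ..
  also have "\<dots> = (\<Sum>(S, Q, R)\<in>(SIGMA S:Pow A. ?A1 S \<times> ?A2 S). ?w Q * ?w R)"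
    by (rule sum.Sigma[OF finite_Pow_iff[THEN iffD2, OF finA] finS])
  \<comment> \<open>A partition of the whole fibre corresponds to the triple of the component of
    \<open>x\<close> without \<open>x\<close>, the blocks over that component, and the remaining
    blocks.\<close>
  also have "\<dots> = (\<Sum>P | partition_on (?fib ?V) P. ?w P)"
  proof (rule sum.reindex_bij_witness[of _
        "\<lambda>P. (component f ?V x P - {x}, {B\<in>P. f ` B \<subseteq> component f ?V x P},
              P - {B\<in>P. f ` B \<subseteq> component f ?V x P})"
        "\<lambda>(S, Q, R). Q \<union> R"], goal_cases)
    case (1 a)
    then obtain S Q R where a: "a = (S, Q, R)" "S \<subseteq> A" "partition_on (?fib (insert x S)) Q"
      "linked f (insert x S) Q" "partition_on (?fib (?V - insert x S)) R" using x by (auto simp: insert_Diff_if)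
    have sub: "insert x S \<subseteq> ?V" "S - {x} = S" using a x by auto
    note j = component_join[OF a(3-5) sub(1) insertI1]
    have "insert x S - {x} = S" using a x by auto
    then show ?case by (simp only: a(1) prod.case j(2,3,4))
  next
    case (2 a)
    then obtain S Q R where a: "a = (S, Q, R)" "S \<subseteq> A" "partition_on (?fib (insert x S)) Q"
      "linked f (insert x S) Q" "partition_on (?fib (?V - insert x S)) R" using x by (auto simp: insert_Diff_if)
    have sub: "insert x S \<subseteq> ?V" "S - {x} = S" using a x by auto
    note j = component_join[OF a(3-5) sub(1) insertI1]
    then show ?case by (simp add: a(1))
  next
    case (3 P)
    then show ?case unfolding prod.case by blast
  next
    case (4 P)
    then have P: "partition_on (?fib ?V) P" by simp
    then have U: "\<Union>P = {u \<in> U. f u \<in> ?V}" by (simp add: partition_on_def)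
    note C = saturated_component[OF U insertI1]
    let ?C = "component f ?V x P"
    have "insert x (?C - {x}) = ?C" "?C - {x} \<subseteq> A" "?V - ?C = A - (?C - {x})"
      using C(2,3) x by auto
    moreover from this component_split[OF P insertI1]
    have "partition_on (?fib (insert x (?C - {x}))) {B\<in>P. f ` B \<subseteq> ?C}"
      "linked f (insert x (?C - {x})) {B\<in>P. f ` B \<subseteq> ?C}"
      "partition_on (?fib (A - (?C - {x}))) (P - {B\<in>P. f ` B \<subseteq> ?C})" by (simp_all only:)
    ultimately show ?case by - (intro SigmaI CollectI conjI PowI, assumption+)
  next
    case (5 a)
    then obtain S Q R where a: "a = (S, Q, R)" "S \<subseteq> A" "partition_on (?fib (insert x S)) Q"
      "linked f (insert x S) Q" "partition_on (?fib (?V - insert x S)) R" using x by (auto simp: insert_Diff_if)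
    have sub: "insert x S \<subseteq> ?V" "S - {x} = S" using a x by auto
    note j = component_join[OF a(3-5) sub(1) insertI1]
    have "finite Q" "finite R" using a finf finite_elements by blast+
    then show ?case using j(5) by (simp add: a(1) prod.union_disjoint)
  qed
  finally show "M (?fib ?V) = (\<Sum>S\<in>Pow A. sum ?w (?A1 S) * M (?fib (A - S)))" using M[of ?V] by (simp only:)
qed (use assms in auto)

text \<open>One step of growing a spanning tree: some block \<open>B\<close> leaves
  \<open>J\<close>, and the index \<open>f v\<close> that it reaches is added. Its fibre brings
  \<open>card ?X\<close> new elements but one block fewer, so the inequality persists.\<close>

lemma linked_grow:
  assumes "finite U" "partition_on U P" "f ` U \<subseteq> I" "linked f I P" "finite I"
    and "J \<subseteq> I" "J \<noteq> {}" "J \<noteq> I" "card {B\<in>P. f ` B \<inter> J \<noteq> {}} + card J \<le> card {u\<in>U. f u \<in> J} + 1"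
  shows "\<exists>x\<in>I - J. card {B\<in>P. f ` B \<inter> insert x J \<noteq> {}} + card (insert x J) \<le>
    card {u\<in>U. f u \<in> insert x J} + 1"
proof -
  obtain B where B: "B \<in> P" "f ` B \<inter> J \<noteq> {}" "\<not> f ` B \<subseteq> J"
    using assms(4)[unfolded linked_def, rule_format, OF assms(6-8)] by blast
  then obtain v where v: "v \<in> B" "f v \<notin> J" by blast
  have U: "\<Union>P = U" and dis: "disjoint P" using assms(2) by (auto simp: partition_on_def)
  have vU: "v \<in> U" "f v \<in> I" using v B U assms(3) by auto
  let ?x = "f v"
  let ?N = "{C\<in>P. f ` C \<inter> insert ?x J \<noteq> {}}" and ?O = "{C\<in>P. f ` C \<inter> J \<noteq> {}}"
  let ?X = "{u\<in>U. f u = ?x}"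
  have "\<forall>u\<in>U. \<exists>C\<in>P. u \<in> C" using U by blast
  then obtain b where b: "\<And>u. u \<in> U \<Longrightarrow> b u \<in> P \<and> u \<in> b u" by metis
  have bu: "b u = C" if "u \<in> C" "C \<in> P" "u \<in> U" for u C
    using b[OF that(3)] that dis by (auto simp: disjoint_def)
  \<comment> \<open>A block met for the first time contains an element of the new fibre other than
    \<open>v\<close>, because \<open>v\<close> lies in the block \<open>B\<close> that was met
    before.\<close>
  have "?N \<subseteq> ?O \<union> b ` (?X - {v})"
  proof
    fix C assume C: "C \<in> ?N"
    show "C \<in> ?O \<union> b ` (?X - {v})"
    proof (cases "f ` C \<inter> J = {}")
      case True
      then obtain u where u: "u \<in> C" "f u = ?x" using C by auto
      then have "u \<in> U" "b u = C" using C U bu by auto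
      moreover have "u \<noteq> v"
      proof
        assume "u = v"
        then have "C = B" using u C B v dis by (auto simp: disjoint_def)
        then show False using True B by simp
      qed
      ultimately show ?thesis using u by auto
    qed (use C in auto)
  qed
  moreover have finP: "finite P" using finite_elements assms by auto
  ultimately have "card ?N \<le> card (?O \<union> b ` (?X - {v}))"
    using assms(1) by (intro card_mono) auto
  also have "\<dots> \<le> card ?O + card (b ` (?X - {v}))" by (rule card_Un_le)
  also have "card (b ` (?X - {v})) \<le> card (?X - {v})" using assms(1) by (intro card_image_le) auto
  also have "card (?X - {v}) = card ?X - 1" using assms(1) vU by simp
  finally have 1: "card ?N \<le> card ?O + (card ?X - 1)" by simp
  have Xpos: "card ?X > 0" using vU assms(1) by (auto simp: card_gt_0_iff)
  have "{u\<in>U. f u \<in> insert ?x J} = {u\<in>U. f u \<in> J} \<union> ?X" by auto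
  moreover have "card ({u\<in>U. f u \<in> J} \<union> ?X) = card {u\<in>U. f u \<in> J} + card ?X"
    using assms(1) v by (intro card_Un_disjoint) auto
  moreover have "finite J" by (rule finite_subset[OF assms(6,5)])
  ultimately have "card ?N + card (insert ?x J) \<le> card {u\<in>U. f u \<in> insert ?x J} + 1"
    using 1 Xpos assms(9) v by simp
  then show ?thesis using v vU by blast
qed

text \<open>A connected bipartite graph has at most one more vertex than it has edges; here the vertices
  are the blocks of \<open>P\<close> and the fibres of \<open>f\<close>, the edges are the elements of \<open>U\<close>.\<close>
lemma linked_card_le:
  assumes "finite U" "partition_on U P" "f ` U \<subseteq> I" "linked f I P" "finite I" "I \<noteq> {}"
  shows "card P + card I \<le> card U + 1"
proof -
  let ?good = "\<lambda>J. card {B\<in>P. f ` B \<inter> J \<noteq> {}} + card J \<le> card {u\<in>U. f u \<in> J} + 1"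
  have U: "\<Union>P = U" and dis: "disjoint P" using assms(2) by (auto simp: partition_on_def)
  \<comment> \<open>Every block over the single index \<open>x\<close> contains an element of the
    fibre of \<open>x\<close>, so there are at most as many such blocks as elements.\<close>
  have base: "?good {x}" for x
  proof -
    let ?X = "{u\<in>U. f u = x}"
    have "\<forall>u\<in>U. \<exists>C\<in>P. u \<in> C" using U by blast
    then obtain b where b: "\<And>u. u \<in> U \<Longrightarrow> b u \<in> P \<and> u \<in> b u" by metis
    have "{B\<in>P. f ` B \<inter> {x} \<noteq> {}} \<subseteq> b ` ?X"
    proof
      fix C assume C: "C \<in> {B\<in>P. f ` B \<inter> {x} \<noteq> {}}"
      then obtain u where u: "u \<in> C" "f u = x" by auto
      then have "u \<in> U" "b u = C" using C U b[of u] dis by (auto simp: disjoint_def)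
      then show "C \<in> b ` ?X" using u by auto
    qed
    then have "card {B\<in>P. f ` B \<inter> {x} \<noteq> {}} \<le> card (b ` ?X)"
      using assms(1) by (intro card_mono) auto
    also have "\<dots> \<le> card ?X" using assms(1) by (intro card_image_le) auto
    finally have "card {B\<in>P. f ` B \<inter> {x} \<noteq> {}} \<le> card ?X" .
    then show ?thesis by simp
  qed
  have "\<exists>J\<subseteq>I. card J = Suc k \<and> ?good J" if "Suc k \<le> card I" for k
    using that
  proof (induction k)
    case 0
    obtain x where "x \<in> I" using assms(6) by blast
    then show ?case using base[of x] by (intro exI[of _ "{x}"] conjI) simp_all
  next
    case (Suc k)
    then have "\<exists>J\<subseteq>I. card J = Suc k \<and> ?good J" by simp
    then obtain J where J: "J \<subseteq> I" "card J = Suc k" "?good J" by (elim exE conjE)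
    have ne: "J \<noteq> {}" "J \<noteq> I" using J(2) Suc(2) by auto
    obtain x where x: "x \<in> I - J" "?good (insert x J)"
      using linked_grow[OF assms(1-5) J(1) ne J(3)] by (elim bexE)
    have "finite J" by (rule finite_subset[OF J(1) assms(5)])
    then have "card (insert x J) = Suc (Suc k)" "insert x J \<subseteq> I" using x(1) J(1,2) by auto
    then show ?case using x(2) by (intro exI[of _ "insert x J"] conjI)
  qed
  from this[of "card I - 1"] have "\<exists>J\<subseteq>I. card J = card I \<and> ?good J"
    using assms(5,6) by (simp add: card_gt_0_iff)
  then obtain J where J: "J \<subseteq> I" "card J = card I" "?good J" by (elim exE conjE)
  then have "J = I" using assms(5) by (intro card_subset_eq)
  moreover have "{B\<in>P. f ` B \<inter> I \<noteq> {}} = P"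
  proof -
    have "f ` B \<inter> I \<noteq> {}" if "B \<in> P" for B
    proof -
      have "B \<noteq> {}" using that partition_onD3[OF assms(2)] by blast
      then obtain b where "b \<in> B" by blast
      then show ?thesis using that U assms(3) by blast
    qed
    then show ?thesis by blast
  qed
  moreover have "{u\<in>U. f u \<in> I} = U" using assms(3) by blast
  ultimately show ?thesis using J by simp
qed

section \<open>Sums over half-integers\<close>


text \<open>The kernel \<open>\<kappa>\<close> has a simple pole at the centre of the cell; it is exponentially small on the
  lower edge and exponentially close to 1 on the upper edge.\<close>
lemma half_integer_cell:
  fixes F G :: "complex \<Rightarrow> complex" and h B :: real and n :: int
  assumes hol: "F holomorphic_on {z. \<bar>Im z\<bar> < 3/2}"
    and G: "\<And>z. \<bar>Im z\<bar> < 3/2 \<Longrightarrow> (G has_field_derivative F z) (at z)"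
    and h: "h > 0"
    and B: "\<And>z. \<bar>Im z\<bar> < 3/2 \<Longrightarrow> h * n \<le> Re z \<Longrightarrow> Re z \<le> h * (n + 1) \<Longrightarrow> norm (F z) \<le> B"
  defines "\<kappa> \<equiv> \<lambda>w. 1 / (1 + exp (2 * pi * \<i> * w / h))"
  defines "V \<equiv> \<lambda>x. contour_integral (linepath (Complex x (-1)) (Complex x 1)) (\<lambda>w. F w * \<kappa> w)"
  shows "norm (h * F (of_real (h * (n + 1/2))) -
      ((G (Complex (h * (n + 1)) 1) - V (h * (n + 1))) - (G (Complex (h * n) 1) - V (h * n))))
    \<le> 2 * h * B / (exp (2 * pi / h) - 1)"
proof -
  define x0 where "x0 = h * n"
  define x1 where "x1 = h * (n + 1)"
  define a where "a = h * (n + 1/2)"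
  define E where "E w = exp (2 * pi * \<i> * w / h)" for w
  define g where "g w = F w * \<kappa> w" for w
  define e where "e = exp (2 * pi / h)"
  have x01: "x1 = x0 + h" "a = x0 + h/2" by (simp_all add: x0_def x1_def a_def algebra_simps)
  \<comment> \<open>The margin \<open>h/4\<close> around the cell stays clear of the neighbouring
    poles, which lie at distance \<open>h/2\<close> from its vertical edges; so \<open>a\<close> is
    the only pole in \<open>S\<close>.\<close>
  define S where "S = box (Complex (x0 - h/4) (-3/2)) (Complex (x1 + h/4) (3/2))"
  have S: "z \<in> S \<longleftrightarrow> x0 - h/4 < Re z \<and> Re z < x1 + h/4 \<and> \<bar>Im z\<bar> < 3/2" for z
    by (auto simp: S_def in_box_complex_iff)
  have [simp]: "open S" "convex S" "connected S" unfolding S_def by (simp_all only: open_box convex_box convex_connected)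
  have e1: "e > 1" using h by (simp add: e_def)
  have normE: "norm (E w) = exp (- 2 * pi * Im w / h)" for w
    by (simp add: E_def norm_exp_eq_Re field_simps)
  have pole: "w = of_real a" if "w \<in> S" "1 + E w = 0" for w
  proof -
    have "E w = exp (\<i> * pi)" using that by (simp add: add_eq_0_iff)
    then obtain k :: int where k: "2 * pi * \<i> * w / h = \<i> * pi + (of_int (2 * k) * pi) * \<i>"
      unfolding E_def exp_eq by blast
    then have "w * (2 * pi * \<i>) = (h * (k + 1/2)) * (2 * pi * \<i>)"
      using h by (simp add: field_simps)
    then have w: "w = of_real (h * (k + 1/2))" by simp
    have "h * (n - 1/4) < h * (k + 1/2)" "h * (k + 1/2) < h * (n + 1 + 1/4)"
      using that(1) unfolding S w x0_def x1_def by (simp_all add: algebra_simps)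
    then have "real_of_int n - 1/4 < k + 1/2" "k + 1/2 < real_of_int n + 1 + 1/4"
      using h by (simp_all only: mult_less_cancel_left_pos)
    then have "k = n" by linarith
    then show ?thesis using w by (simp add: a_def)
  qed
  have Ea: "E (of_real a) = -1"
  proof -
    have "2 * pi * \<i> * of_real a / h = \<i> * pi + (of_int (2 * n) * pi) * \<i>"
      unfolding a_def using h by (simp add: field_simps)
    then have "E (of_real a) = exp (\<i> * pi + (of_int (2 * n) * pi) * \<i>)"
      unfolding E_def by (simp only:)
    also have "\<dots> = exp (\<i> * pi)" unfolding exp_eq by blast
    finally show ?thesis by simp
  qed
  have aS: "of_real a \<in> S" using h by (simp add: S x01)
  have SF: "S \<subseteq> {z. \<bar>Im z\<bar> < 3/2}" by (auto simp: S)
  have FS: "F holomorphic_on S" using hol SF by (rule holomorphic_on_subset)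
  have ES: "(\<lambda>w. 1 + E w) holomorphic_on A" for A unfolding E_def using h by (intro holomorphic_intros) auto
  have g_eq: "g = (\<lambda>w. F w / (1 + E w))" by (simp add: fun_eq_iff g_def \<kappa>_def E_def)
  have gS: "g holomorphic_on S - {of_real a}"
    unfolding g_eq using pole by (intro holomorphic_on_divide holomorphic_on_subset[OF FS] ES) auto
  have res: "residue g (of_real a) = - (F a * h / (2 * pi * \<i>))"
  proof -
    \<comment> \<open>The difference quotient of \<open>1 + E\<close> at its zero. It is holomorphic
      and nowhere zero on \<open>S\<close> and equals \<open>- (2 * pi * \<i> / h)\<close> at the
      pole, which makes the pole simple and gives the residue \<open>F a / Q a\<close>.\<close>
    define Q where "Q z = (if z = complex_of_real a then deriv (\<lambda>w. 1 + E w) a else ((1 + E z) - (1 + E a)) / (z - a))" for z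
    have Q: "Q holomorphic_on S" unfolding Q_def by (rule pole_lemma_open[OF ES \<open>open S\<close>])
    have Qz: "1 + E z = Q z * (z - a)" if "z \<noteq> a" for z :: complex using that Ea by (simp add: Q_def)
    have "((\<lambda>w. 1 + E w) has_field_derivative (2 * pi * \<i> / h * E a)) (at (of_real a))"
      unfolding E_def using h by (auto intro!: derivative_eq_intros simp: field_simps)
    then have Qa: "Q a = - (2 * pi * \<i> / h)" by (simp add: Q_def DERIV_imp_deriv Ea)
    have Q0: "Q z \<noteq> 0" if "z \<in> S" for z
      using Qz[of z] pole[OF that] Qa h by (cases "z = a") auto
    have "residue g a = residue (\<lambda>w. (F w / Q w) / (w - a)) a"
    proof (rule residue_cong)
      have "\<forall>\<^sub>F z in at (of_real a). z \<in> S - {of_real a}"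
        using aS by (intro eventually_at_in_open) auto
      then show "\<forall>\<^sub>F z in at (of_real a). g z = (F z / Q z) / (z - a)"
        by eventually_elim (simp add: g_eq Qz)
    qed simp
    also have "\<dots> = F a / Q a"
      using Q Q0 by (intro residue_simple[OF \<open>open S\<close> aS] holomorphic_on_divide FS)
    finally show ?thesis using h by (simp add: Qa field_simps)
  qed
  let ?r = "rectpath (Complex x0 (-1)) (Complex x1 1)"
  have bx: "of_real a \<in> box (Complex x0 (-1)) (Complex x1 1)" using h by (simp add: in_box_complex_iff x01)
  have img: "path_image ?r = cbox (Complex x0 (-1)) (Complex x1 1) - box (Complex x0 (-1)) (Complex x1 1)"
    using h by (intro path_image_rectpath_cbox_minus_box) (simp_all add: x01)
  have imgS: "path_image ?r \<subseteq> S - {of_real a}"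
    unfolding img using bx h by (auto simp: in_cbox_complex_iff S x01)
  have "contour_integral ?r g = 2 * pi * \<i> * (\<Sum>p\<in>{of_real a}. winding_number ?r p * residue g p)"
  proof (rule Residue_theorem[OF \<open>open S\<close> \<open>connected S\<close> _ gS])
    show "\<forall>z. z \<notin> S \<longrightarrow> winding_number ?r z = 0"
    proof (intro allI impI winding_number_rectpath_outside)
      fix z assume "z \<notin> S"
      then show "z \<notin> cbox (Complex x0 (-1)) (Complex x1 1)" using h by (auto simp: in_cbox_complex_iff S)
    qed (use h in \<open>auto simp: x01\<close>)
  qed (use imgS in auto)
  then have I: "contour_integral ?r g = - (F a * h)"
    using bx by (simp add: winding_number_rectpath res)
  have cont: "continuous_on (path_image ?r) g"
    using gS imgS by (meson holomorphic_on_imp_continuous_on continuous_on_subset)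
  define bot where "bot = linepath (Complex x0 (-1)) (Complex x1 (-1))"
  define rgt where "rgt = linepath (Complex x1 (-1)) (Complex x1 1)"
  define top where "top = linepath (Complex x1 1) (Complex x0 1)"
  define lft where "lft = linepath (Complex x0 1) (Complex x0 (-1))"
  have r: "?r = bot +++ rgt +++ top +++ lft"
    by (simp add: rectpath_def Let_def bot_def rgt_def top_def lft_def)
  have pi_r: "path_image ?r = path_image bot \<union> path_image rgt \<union> path_image top \<union> path_image lft"
    unfolding r by (simp add: path_image_join bot_def rgt_def top_def lft_def Un_assoc)
  have int: "g contour_integrable_on bot" "g contour_integrable_on rgt"
    "g contour_integrable_on top" "g contour_integrable_on lft"
    using cont unfolding pi_r bot_def rgt_def top_def lft_def
    by (auto intro!: contour_integrable_continuous_linepath elim!: continuous_on_subset)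
  have split: "contour_integral ?r g = contour_integral bot g + contour_integral rgt g +
      contour_integral top g + contour_integral lft g"
    unfolding r using int
    by (simp add: bot_def rgt_def top_def lft_def contour_integrable_join)
  have g_fun: "g = (\<lambda>w. F w * \<kappa> w)" by (simp add: fun_eq_iff g_def)
  have Vr: "contour_integral rgt g = V x1" by (simp add: V_def rgt_def g_fun)
  have Vl: "contour_integral lft g = - V x0"
  proof -
    have "continuous_on (closed_segment (Complex x0 1) (Complex x0 (-1))) g"
      using cont unfolding pi_r lft_def by (auto elim!: continuous_on_subset)
    then show ?thesis unfolding lft_def by (subst contour_integral_reverse_linepath) (auto simp: V_def g_fun)
  qed
  have seg: "closed_segment (Complex x0 y) (Complex x1 y) = {z. Im z = y \<and> x0 \<le> Re z \<and> Re z \<le> x1}" for y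
    using h by (auto simp: closed_segment_same_Im closed_segment_eq_real_ivl x01)
  have B0: "B \<ge> 0" using B[of "of_real a"] h norm_ge_zero[of "F (of_real a)"]
    by (simp add: a_def algebra_simps order_trans[OF norm_ge_zero])
  have FB: "norm (F z) \<le> B" if "\<bar>Im z\<bar> \<le> 1" "x0 \<le> Re z" "Re z \<le> x1" for z
    using that by (intro B) (auto simp: x0_def x1_def)
  have b1: "norm (contour_integral bot g) \<le> B / (e - 1) * norm (Complex x1 (-1) - Complex x0 (-1))"
    unfolding bot_def
  proof (rule contour_integral_bound_linepath)
    fix z assume "z \<in> closed_segment (Complex x0 (-1)) (Complex x1 (-1))"
    then have z: "Im z = -1" "x0 \<le> Re z" "Re z \<le> x1" unfolding seg by auto
    have "norm (E z) = e" unfolding normE e_def z by simp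
    then have "e - 1 \<le> norm (1 + E z)" using norm_triangle_ineq2[of "E z" "-1"] by (simp add: add.commute)
    then show "norm (g z) \<le> B / (e - 1)"
      unfolding g_eq norm_divide using e1 FB[of z] z B0 by (intro frac_le) auto
  qed (use int B0 e1 in \<open>auto simp: bot_def\<close>)
  have FT: "(F has_contour_integral (G (Complex x0 1) - G (Complex x1 1))) top"
  proof -
    have "(F has_contour_integral (G (pathfinish top) - G (pathstart top))) top"
    proof (rule contour_integral_primitive[of "{z. \<bar>Im z\<bar> < 3/2}"])
      fix z assume "z \<in> {z. \<bar>Im z\<bar> < 3/2}"
      then show "(G has_field_derivative F z) (at z within {z. \<bar>Im z\<bar> < 3/2})"
        using G by (auto intro: has_field_derivative_at_within)
    next
      show "path_image top \<subseteq> {z. \<bar>Im z\<bar> < 3/2}"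
        using seg[of 1] by (auto simp: top_def closed_segment_commute)
    qed (simp add: top_def)
    then show ?thesis by (simp add: top_def)
  qed
  have topE: "1 + E z \<noteq> 0 \<and> norm (E z) = inverse e" if "Im z = 1" for z
  proof -
    have "norm (E z) = inverse e" unfolding normE e_def that by (simp add: exp_minus)
    moreover have "inverse e < 1" using e1 by (simp add: inverse_less_1_iff)
    ultimately show ?thesis using add_eq_0_iff[of 1 "E z"] by auto
  qed
  \<comment> \<open>On the upper edge the kernel differs from 1 by \<open>E z / (1 + E z)\<close>,
    and \<open>E z\<close> has modulus exp (- 2 pi / h) there; subtracting the exact integral of
    \<open>F\<close> by its primitive leaves only this error.\<close>
  have b2: "norm (contour_integral top g - (G (Complex x0 1) - G (Complex x1 1))) \<le>
      B / (e - 1) * norm (Complex x0 1 - Complex x1 1)"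
    unfolding top_def
  proof (rule has_contour_integral_bound_linepath)
    show "((\<lambda>z. g z - F z) has_contour_integral
      (contour_integral (linepath (Complex x1 1) (Complex x0 1)) g - (G (Complex x0 1) - G (Complex x1 1))))
      (linepath (Complex x1 1) (Complex x0 1))"
      using int(3) FT unfolding top_def by (intro has_contour_integral_diff has_contour_integral_integral)
    fix z assume "z \<in> closed_segment (Complex x1 1) (Complex x0 1)"
    then have z: "Im z = 1" "x0 \<le> Re z" "Re z \<le> x1" using seg[of 1] by (auto simp: closed_segment_commute)
    have "g z - F z = - (F z * E z / (1 + E z))"
      unfolding g_eq using topE[OF z(1)] by (simp add: field_simps)
    then have "norm (g z - F z) = norm (F z) * inverse e / norm (1 + E z)"
      using topE[OF z(1)] by (simp add: norm_mult norm_divide)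
    also have "\<dots> \<le> B * inverse e / (1 - inverse e)"
    proof (intro frac_le mult_right_mono)
      show "1 - inverse e \<le> norm (1 + E z)"
        using norm_triangle_ineq2[of 1 "- E z"] topE[OF z(1)] by simp
      show "norm (F z) \<le> B" using FB[of z] z by simp
      show "0 < 1 - inverse e" using e1 by (simp add: inverse_less_1_iff)
    qed (use e1 B0 in auto)
    also have "\<dots> = B / (e - 1)" using e1 by (simp add: field_simps)
    finally show "norm (g z - F z) \<le> B / (e - 1)" .
  qed (use B0 e1 in auto)
  have len: "norm (Complex x1 (-1) - Complex x0 (-1)) = h" "norm (Complex x0 1 - Complex x1 1) = h"
    using h by (simp_all add: x01 cmod_def)
  have "h * F a - ((G (Complex x1 1) - V x1) - (G (Complex x0 1) - V x0)) =
      - (contour_integral bot g) - (contour_integral top g - (G (Complex x0 1) - G (Complex x1 1)))"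
    using I split Vr Vl by (simp add: algebra_simps)
  also have "norm \<dots> \<le> norm (contour_integral bot g) + norm (contour_integral top g - (G (Complex x0 1) - G (Complex x1 1)))"
    using norm_triangle_ineq4[of "- (contour_integral bot g)"] by simp
  also have "\<dots> \<le> B / (e - 1) * h + B / (e - 1) * h" using b1 b2 unfolding len by linarith
  also have "\<dots> = 2 * h * B / (e - 1)" by simp
  finally show ?thesis unfolding a_def x0_def x1_def e_def .
qed

text \<open>Increments of \<open>\<psi>\<close> are dominated by those of the primitive
  \<open>-2 * C * exp (- x / 2)\<close> of the bound. This supplies the limits of a primitive at
  both ends of a horizontal line, in place of an improper contour integral.\<close>

lemma limit_of_exp_decaying_derivative:
  fixes \<psi> :: "real \<Rightarrow> 'a::banach"
  assumes d: "\<And>x. x \<ge> 0 \<Longrightarrow> (\<psi> has_vector_derivative \<psi>' x) (at x)"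
    and b: "\<And>x. x \<ge> 0 \<Longrightarrow> norm (\<psi>' x) \<le> C * exp (- x / 2)"
  shows "\<exists>L. (\<psi> \<longlongrightarrow> L) at_top"
proof -
  have C0: "C \<ge> 0" using order_trans[OF norm_ge_zero b[of 0]] by simp
  have diff: "norm (\<psi> y - \<psi> x) \<le> 2 * C * exp (- x / 2)" if "0 \<le> x" "x \<le> y" for x y
  proof (cases "x = y")
    case False
    have "norm (\<psi> y - \<psi> x) \<le> (\<lambda>x. -2 * C * exp (- x / 2)) y - (\<lambda>x. -2 * C * exp (- x / 2)) x"
    proof (rule differentiable_bound_general[where \<phi>' = "\<lambda>x. C * exp (- x / 2)" and f' = \<psi>'])
      show "continuous_on {x..y} \<psi>"
        using d that by (intro continuous_at_imp_continuous_on ballI)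
          (meson atLeastAtMost_iff has_vector_derivative_continuous order_trans)
      show "((\<lambda>x. - 2 * C * exp (- x / 2)) has_vector_derivative C * exp (- t / 2)) (at t)" for t
        unfolding has_real_derivative_iff_has_vector_derivative[symmetric]
        by (auto intro!: derivative_eq_intros)
    qed (use that False d b in \<open>auto intro!: continuous_intros\<close>)
    also have "\<dots> \<le> 2 * C * exp (- x / 2)" using C0 by simp
    finally show ?thesis .
  qed (use C0 in simp)
  have lim0: "((\<lambda>x. 2 * C * exp (- x / 2)) \<longlongrightarrow> 0) at_top"
  proof -
    have "filterlim (\<lambda>x::real. 1/2 * x) at_top at_top"
      by (rule filterlim_tendsto_pos_mult_at_top[OF tendsto_const _ filterlim_ident]) simp
    then have "((\<lambda>x::real. inverse (exp (1/2 * x))) \<longlongrightarrow> 0) at_top"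
      by (intro tendsto_inverse_0_at_top filterlim_compose[OF exp_at_top])
    from tendsto_mult_left[OF this, of "2 * C"] show ?thesis by (simp add: exp_minus)
  qed
  have "Cauchy (\<lambda>n. \<psi> (real n))"
  proof (rule CauchyI)
    fix e :: real assume e: "e > 0"
    have "\<forall>\<^sub>F n in sequentially. 2 * C * exp (- real n / 2) < e"
      using order_tendstoD(2)[OF filterlim_compose[OF lim0 filterlim_real_sequentially] e] .
    then obtain M where M: "2 * C * exp (- real M / 2) < e"
      by (auto simp: eventually_sequentially)
    have "norm (\<psi> (real m) - \<psi> (real n)) < e" if "M \<le> m" "M \<le> n" for m n
    proof -
      have mono: "2 * C * exp (- real k / 2) < e" if "M \<le> k" for k
        using M that C0 by (intro le_less_trans[OF _ M] mult_left_mono) auto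
      show ?thesis
      proof (cases "n \<le> m")
        case True then show ?thesis using diff[of n m] mono[of n] that by simp
      next
        case False then show ?thesis using diff[of m n] mono[of m] that by (simp add: norm_minus_commute)
      qed
    qed
    then show "\<exists>M. \<forall>m\<ge>M. \<forall>n\<ge>M. norm (\<psi> (real m) - \<psi> (real n)) < e" by blast
  qed
  then obtain L where L: "(\<lambda>n. \<psi> (real n)) \<longlonglongrightarrow> L" using Cauchy_convergent convergent_def by blast
  have "norm (\<psi> x - L) \<le> 2 * C * exp (- x / 2)" if "x \<ge> 0" for x
  proof (rule LIMSEQ_le_const2)
    show "(\<lambda>n. norm (\<psi> x - \<psi> (real n))) \<longlonglongrightarrow> norm (\<psi> x - L)" by (intro tendsto_intros L)
    have "norm (\<psi> x - \<psi> (real n)) \<le> 2 * C * exp (- x / 2)" if "n \<ge> nat \<lceil>x\<rceil>" for n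
      using diff[of x "real n"] that \<open>x \<ge> 0\<close> by (simp add: norm_minus_commute nat_ceiling_le_eq)
    then show "\<exists>N. \<forall>n\<ge>N. norm (\<psi> x - \<psi> (real n)) \<le> 2 * C * exp (- x / 2)" by blast
  qed
  then have "\<forall>\<^sub>F x in at_top. norm (\<psi> x - L) \<le> 2 * C * exp (- x / 2)"
    by (intro eventually_at_top_linorderI[of 0])
  then have "((\<lambda>x. \<psi> x - L) \<longlongrightarrow> 0) at_top" by (rule Lim_null_comparison[OF _ lim0])
  then show ?thesis using LIM_zero_cancel by blast
qed


text \<open>Summing the cells, the terms \<open>V\<close> telescope and vanish at infinity, while the
  primitive contributes its total increment, which does not depend on \<open>h\<close>.\<close>
theorem half_integer_sum:
  fixes F :: "complex \<Rightarrow> complex" and C :: real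
  assumes hol: "F holomorphic_on {z. \<bar>Im z\<bar> < 3/2}"
    and bnd: "\<And>z. \<bar>Im z\<bar> < 3/2 \<Longrightarrow> norm (F z) \<le> C * exp (- \<bar>Re z\<bar> / 2)"
  shows "\<exists>(c::complex) (K::real). \<forall>h::real. 0 < h \<longrightarrow> h \<le> 1 \<longrightarrow>
    norm ((\<Sum>n. F (of_real (h * (n + 1/2))) + F (of_real (- (h * (n + 1/2))))) - c / h) \<le> K * exp (- (2 * pi) / h) / h"
proof -
  let ?S = "{z. \<bar>Im z\<bar> < 3/2}"
  have S: "convex ?S" "open ?S"
  proof -
    have "?S = {z. Im z < 3/2} \<inter> {z. Im z > -3/2}" by auto
    then show "convex ?S" "open ?S"
      by (simp_all only: convex_Int convex_halfspace_Im_lt convex_halfspace_Im_gt open_halfspace_Im_lt open_halfspace_Im_gt open_Int)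
  qed
  obtain G where G0: "\<And>z. z \<in> ?S \<Longrightarrow> (G has_field_derivative F z) (at z within ?S)"
    using holomorphic_convex_primitive'[OF S hol] by blast
  have G: "(G has_field_derivative F z) (at z)" if "\<bar>Im z\<bar> < 3/2" for z
  proof -
    have "z \<in> ?S" using that by simp
    then show ?thesis using G0[of z] unfolding at_within_open[OF \<open>z \<in> ?S\<close> S(2)] by blast
  qed
  have C0: "C \<ge> 0" using order_trans[OF norm_ge_zero bnd[of 0]] by simp
  have Gv: "((\<lambda>x. G (Complex (s * x) 1)) has_vector_derivative (of_real s * F (Complex (s * x) 1))) (at x)" for s x
  proof -
    have "((\<lambda>x. Complex (s * x) 1) has_vector_derivative of_real s) (at x)"
      by (auto simp: Complex_eq has_vector_derivative_def scaleR_conv_of_real mult.commute intro!: derivative_eq_intros)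
    moreover have "(G has_field_derivative F (Complex (s * x) 1)) (at (Complex (s * x) 1))" by (intro G) simp
    ultimately show ?thesis
      using field_vector_diff_chain_at[of "\<lambda>x. Complex (s * x) 1" "of_real s" x G] by (simp add: o_def)
  qed
  have lim: "\<exists>L. ((\<lambda>x. G (Complex (s * x) 1)) \<longlongrightarrow> L) at_top" if "\<bar>s\<bar> = 1" for s
  proof (rule limit_of_exp_decaying_derivative[OF Gv])
    fix x :: real assume "x \<ge> 0"
    then show "norm (of_real s * F (Complex (s * x) 1)) \<le> C * exp (- x / 2)"
      using bnd[of "Complex (s * x) 1"] that by (simp add: norm_mult abs_mult)
  qed
  obtain L1 L2 where L: "((\<lambda>x. G (Complex x 1)) \<longlongrightarrow> L1) at_top" "((\<lambda>x. G (Complex (-x) 1)) \<longlongrightarrow> L2) at_top"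
    using lim[of 1] lim[of "-1"] by auto
  have main: "norm ((\<Sum>n. F (of_real (h * (n + 1/2))) + F (of_real (- (h * (n + 1/2))))) - (L1 - L2) / h)
      \<le> 32 * C * exp (- (2 * pi) / h) / h" if h: "0 < h" "h \<le> 1" for h :: real
  proof -
    define \<kappa> where "\<kappa> = (\<lambda>w. 1 / (1 + exp (2 * pi * \<i> * w / h)))"
    define V where "V = (\<lambda>x. contour_integral (linepath (Complex x (-1)) (Complex x 1)) (\<lambda>w. F w * \<kappa> w))"
    define A where "A x = G (Complex x 1) - V x" for x
    define \<epsilon> where "\<epsilon> = 1 / (exp (2 * pi / h) - 1)"
    define r where "r = exp (- h / 2)"
    define t where "t n = F (of_real (h * (real n + 1/2))) + F (of_real (- (h * (real n + 1/2))))" for n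
    have r: "0 < r" "r < 1" using h by (simp_all add: r_def)
    have rpow: "r ^ n = exp (- (h * n) / 2)" for n
      unfolding r_def exp_of_nat_mult[symmetric] by (simp add: mult.commute)
    have \<epsilon>0: "\<epsilon> \<ge> 0" using h by (simp add: \<epsilon>_def)
    have cell1: "norm (h * F (of_real (h * (real n + 1/2))) - (A (h * (real n + 1)) - A (h * real n))) \<le> 2 * h * (C * r ^ n) * \<epsilon>" for n
    proof -
      have "norm (F z) \<le> C * r ^ n" if "\<bar>Im z\<bar> < 3/2" "h * of_int (int n) \<le> Re z" for z
      proof -
        have "norm (F z) \<le> C * exp (- \<bar>Re z\<bar> / 2)" using bnd that by blast
        also have "\<dots> \<le> C * r ^ n" unfolding rpow using that C0 h by (intro mult_left_mono) auto
        finally show ?thesis .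
      qed
      from half_integer_cell[OF hol G h(1), of "int n" "C * r ^ n", OF _ this]
      show ?thesis by (simp add: A_def V_def \<kappa>_def \<epsilon>_def algebra_simps)
    qed
    have cell2: "norm (h * F (of_real (- (h * (real n + 1/2)))) - (A (- (h * real n)) - A (- (h * (real n + 1))))) \<le> 2 * h * (C * r ^ n) * \<epsilon>" for n
    proof -
      have b: "norm (F z) \<le> C * r ^ n" if "\<bar>Im z\<bar> < 3/2" "Re z \<le> h * (of_int (- int n - 1) + 1)" for z
      proof -
        have "norm (F z) \<le> C * exp (- \<bar>Re z\<bar> / 2)" using bnd that by blast
        also have "\<dots> \<le> C * r ^ n" unfolding rpow using that C0 h by (intro mult_left_mono) (auto simp: algebra_simps)
        finally show ?thesis .
      qed
      have "- (h * (real n + 1/2)) = h * (real_of_int (- int n - 1) + 1/2)" "- (h * real n) = h * (real_of_int (- int n - 1) + 1)"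
        "- (h * (real n + 1)) = h * real_of_int (- int n - 1)" by (simp_all add: algebra_simps)
      note eq = this
      from half_integer_cell[OF hol G h(1), of "- int n - 1" "C * r ^ n", OF _ b]
      show ?thesis unfolding eq A_def V_def \<kappa>_def \<epsilon>_def by simp
    qed
    have tel: "norm (h * (\<Sum>n<N. t n) - (A (h * real N) - A (- (h * real N)))) \<le> (\<Sum>n<N. 4 * h * C * \<epsilon> * r ^ n)" for N
    proof (induction N)
      case (Suc N)
      have "h * (\<Sum>n<Suc N. t n) - (A (h * real (Suc N)) - A (- (h * real (Suc N)))) =
        (h * (\<Sum>n<N. t n) - (A (h * real N) - A (- (h * real N)))) +
        ((h * F (of_real (h * (real N + 1/2))) - (A (h * (real N + 1)) - A (h * real N))) +
         (h * F (of_real (- (h * (real N + 1/2)))) - (A (- (h * real N)) - A (- (h * (real N + 1))))))"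
        by (simp add: t_def algebra_simps)
      also have "norm \<dots> \<le> (\<Sum>n<N. 4 * h * C * \<epsilon> * r ^ n) + (2 * h * (C * r ^ N) * \<epsilon> + 2 * h * (C * r ^ N) * \<epsilon>)"
        by (intro norm_triangle_mono Suc cell1 cell2)
      also have "\<dots> = (\<Sum>n<Suc N. 4 * h * C * \<epsilon> * r ^ n)" by (simp add: algebra_simps)
      finally show ?case .
    qed simp
    have tb: "norm (t n) \<le> 2 * C * r ^ n" for n
    proof -
      have "norm (F (of_real x)) \<le> C * r ^ n" if "\<bar>x\<bar> = h * (real n + 1/2)" for x
      proof -
        have "norm (F (of_real x)) \<le> C * exp (- \<bar>x\<bar> / 2)" using bnd[of "of_real x"] by simp
        also have "\<dots> \<le> C * r ^ n" unfolding rpow that using C0 h by (intro mult_left_mono) (auto simp: algebra_simps)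
        finally show ?thesis .
      qed
      from this[of "h * (real n + 1/2)"] this[of "- (h * (real n + 1/2))"] h
      have "norm (t n) \<le> C * r ^ n + C * r ^ n" unfolding t_def by (intro norm_triangle_mono) auto
      then show ?thesis by simp
    qed
    have summ: "summable t"
      using r by (intro summable_comparison_test[OF _ summable_mult[OF summable_geometric[of r]]] exI[of _ 0])
        (auto intro!: tb)
    \<comment> \<open>At cell boundaries the real part of \<open>w\<close> is a multiple of
      \<open>h\<close>, so the exponential in the kernel is a positive real number and the
      denominator is at least 1: the vertical sides run midway between the poles.\<close>
    have V0: "norm (V x) \<le> 2 * C * exp (- \<bar>x\<bar> / 2)" if x: "x = h * of_int k" for x and k :: int
    proof -
      have K: "1 \<le> norm (1 + exp (2 * pi * \<i> * w / h))" if w: "w = Complex x y" for w y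
      proof -
        have "2 * pi * \<i> * w / h = of_real (- 2 * pi * y / h) + of_int (2 * k) * pi * \<i>"
          using h unfolding w x Complex_eq by (simp add: field_simps)
        then have "exp (2 * pi * \<i> * w / h) = exp (of_real (- 2 * pi * y / h))"
          by (metis exp_eq)
        also have "1 + \<dots> = of_real (1 + exp (- 2 * pi * y / h))" by (simp only: of_real_add of_real_1 exp_of_real)
        finally show ?thesis by (simp only: norm_of_real) simp
      qed
      have b: "norm (F z * \<kappa> z) \<le> C * exp (- \<bar>x\<bar> / 2)" if "z \<in> closed_segment (Complex x (-1)) (Complex x 1)" for z
      proof -
        have z: "z = Complex x (Im z)" "\<bar>Im z\<bar> \<le> 1"
          using that by (auto simp: closed_segment_same_Re closed_segment_eq_real_ivl complex_eq_iff)
        have "norm (F z) \<le> C * exp (- \<bar>Re z\<bar> / 2)" using z(2) by (intro bnd) auto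
        also have "Re z = x" using z(1) by (metis complex.sel(1))
        finally have "norm (F z) / norm (1 + exp (2 * pi * \<i> * z / h)) \<le> (C * exp (- \<bar>x\<bar> / 2)) / 1"
          using K[OF z(1)] C0 by (intro frac_le) auto
        then show ?thesis by (simp add: \<kappa>_def norm_mult norm_divide)
      qed
      have "norm (V x) \<le> C * exp (- \<bar>x\<bar> / 2) * norm (Complex x 1 - Complex x (-1))"
        unfolding V_def
      proof (rule contour_integral_bound_linepath)
        have "1 + exp (2 * pi * \<i> * z / h) \<noteq> 0" if "z \<in> closed_segment (Complex x (-1)) (Complex x 1)" for z
        proof -
          have "z = Complex x (Im z)" using that by (auto simp: closed_segment_same_Re complex_eq_iff)
          from K[OF this] show ?thesis by auto
        qed
        moreover have "closed_segment (Complex x (-1)) (Complex x 1) \<subseteq> ?S"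
          by (auto simp: closed_segment_same_Re closed_segment_eq_real_ivl)
        ultimately show "(\<lambda>w. F w * \<kappa> w) contour_integrable_on linepath (Complex x (-1)) (Complex x 1)"
          unfolding \<kappa>_def using h
          by (intro contour_integrable_continuous_linepath continuous_intros
              continuous_on_subset[OF holomorphic_on_imp_continuous_on[OF hol]]) auto
      qed (use b C0 in auto)
      also have "norm (Complex x 1 - Complex x (-1)) = 2" by (simp add: cmod_def)
      finally show ?thesis by simp
    qed
    have hN: "filterlim (\<lambda>N. h * real N) at_top sequentially"
      using h by (intro filterlim_tendsto_pos_mult_at_top[OF tendsto_const]) (auto intro: filterlim_real_sequentially)
    have dec: "(\<lambda>N. 2 * C * exp (- (h * real N) / 2)) \<longlonglongrightarrow> 0"
    proof -
      have "(\<lambda>N. 2 * C * r ^ N) \<longlonglongrightarrow> 2 * C * 0" using r by (intro tendsto_intros LIMSEQ_power_zero) auto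
      then show ?thesis by (simp add: rpow)
    qed
    have Vlim: "(\<lambda>N. V (h * real N)) \<longlonglongrightarrow> 0" "(\<lambda>N. V (- (h * real N))) \<longlonglongrightarrow> 0"
    proof (rule_tac [!] Lim_null_comparison[OF _ dec])
      show "\<forall>\<^sub>F N in sequentially. norm (V (h * real N)) \<le> 2 * C * exp (- (h * real N) / 2)"
        using V0[of "h * real _" "int _"] h by (intro always_eventually allI) simp
      show "\<forall>\<^sub>F N in sequentially. norm (V (- (h * real N))) \<le> 2 * C * exp (- (h * real N) / 2)"
        using V0[of "- (h * real _)" "- int _"] h by (intro always_eventually allI) simp
    qed
    have Alim: "(\<lambda>N. A (h * real N) - A (- (h * real N))) \<longlonglongrightarrow> (L1 - 0) - (L2 - 0)"
      unfolding A_def by (intro tendsto_intros Vlim filterlim_compose[OF L(1) hN] filterlim_compose[OF L(2) hN])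
    have bound: "(\<Sum>n<N. 4 * h * C * \<epsilon> * r ^ n) \<le> 4 * h * C * \<epsilon> / (1 - r)" for N
    proof -
      have "(\<Sum>n<N. r ^ n) \<le> 1 / (1 - r)" using r by (simp add: sum_gp_strict divide_right_mono)
      from mult_left_mono[OF this, of "4 * h * C * \<epsilon>"] show ?thesis
        using C0 h \<epsilon>0 by (simp add: sum_distrib_left)
    qed
    have "norm (h * (\<Sum>n. t n) - ((L1 - 0) - (L2 - 0))) \<le> 4 * h * C * \<epsilon> / (1 - r)"
    proof (rule LIMSEQ_le_const2)
      show "(\<lambda>N. norm (h * (\<Sum>n<N. t n) - (A (h * real N) - A (- (h * real N))))) \<longlonglongrightarrow>
          norm (h * (\<Sum>n. t n) - ((L1 - 0) - (L2 - 0)))"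
        by (intro tendsto_intros Alim summable_LIMSEQ summ)
      show "\<exists>N. \<forall>n\<ge>N. norm (h * sum t {..<n} - (A (h * real n) - A (- (h * real n)))) \<le> 4 * h * C * \<epsilon> / (1 - r)"
        using order_trans[OF tel bound] by blast
    qed
    \<comment> \<open>Since \<open>h \<le> 1\<close>, both \<open>1 - r \<ge> h / 4\<close> and
      \<open>exp (2 * pi / h) \<ge> 2\<close> hold; the second gives the factor 2 in the bound for
      \<open>\<epsilon>\<close>, and together they give the constant 32.\<close>
    also have "\<dots> \<le> 4 * h * C * (2 * exp (- (2 * pi) / h)) / (h / 4)"
    proof (intro frac_le mult_left_mono)
      have "1 + h / 2 \<le> exp (h / 2)" by (rule exp_ge_add_one_self)
      then have "r \<le> inverse (1 + h / 2)"
        unfolding r_def minus_divide_left[symmetric] exp_minus using h by (intro le_imp_inverse_le) auto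
      also have "\<dots> \<le> 1 - h / 4"
      proof -
        have "1 \<le> (1 - h / 4) * (1 + h / 2)" using h by (simp add: algebra_simps mult_left_le)
        then show ?thesis using h by (simp add: inverse_eq_divide pos_divide_le_eq)
      qed
      finally show "h / 4 \<le> 1 - r" by simp
      define e where "e = exp (2 * pi / h)"
      have "1 \<le> 2 * pi / h" using h pi_ge_two by (simp add: field_simps)
      then have e: "2 \<le> e" unfolding e_def using exp_ge_add_one_self[of "2 * pi / h"] by linarith
      have "exp (- (2 * pi) / h) = inverse e"
        unfolding e_def minus_divide_left[symmetric] exp_minus ..
      moreover have "1 / (e - 1) \<le> 2 * inverse e" using e by (simp add: field_simps)
      ultimately show "\<epsilon> \<le> 2 * exp (- (2 * pi) / h)"
        unfolding \<epsilon>_def e_def[symmetric] by simp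
    qed (use h C0 in auto)
    also have "\<dots> = 32 * C * exp (- (2 * pi) / h)" using h by simp
    finally have "norm (h * (\<Sum>n. t n) - (L1 - L2)) / h \<le> 32 * C * exp (- (2 * pi) / h) / h"
      using h by (intro divide_right_mono) auto
    also have "norm (h * (\<Sum>n. t n) - (L1 - L2)) / h = norm ((h * (\<Sum>n. t n) - (L1 - L2)) / h)"
      using h by (simp add: norm_divide)
    also have "(h * (\<Sum>n. t n) - (L1 - L2)) / h = (\<Sum>n. t n) - (L1 - L2) / h"
      using h by (simp add: field_simps)
    finally show ?thesis by (simp add: t_def)
  qed
  show ?thesis by (intro exI[of _ "L1 - L2"] exI[of _ "32 * C"] allI impI main)
qed

section \<open>Expansions in inverse powers of h\<close>


text \<open>A form of the error without a power of \<open>h\<close>. It describes the same error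
  class as \<open>is_h_expansion\<close>, and it is more convenient for sums and products.\<close>

definition exp_small :: "(real \<Rightarrow> real) \<Rightarrow> bool" where
  "exp_small f \<longleftrightarrow> (\<exists>c>0. \<exists>K. \<forall>\<^sub>F h in at_right 0. \<bar>f h\<bar> \<le> K * exp (- c / h))"

text \<open>Half of the exponent is spent on absorbing the power of \<open>h\<close>.\<close>

lemma exp_small_powrI:
  assumes "c > 0" "\<forall>\<^sub>F h in at_right 0. \<bar>f h\<bar> \<le> K * (exp (- c / h) / h powr C)"
  shows "exp_small f"
proof -
  have "((\<lambda>h. exp (- (c / 2) / h) / h powr C) \<longlongrightarrow> 0) (at_right 0)"
    using assms(1) by real_asymp
  then have "\<forall>\<^sub>F h in at_right 0. exp (- (c / 2) / h) / h powr C < 1"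
    by (rule order_tendstoD) simp
  with assms(2) have "\<forall>\<^sub>F h in at_right 0. \<bar>f h\<bar> \<le> \<bar>K\<bar> * exp (- (c / 2) / h)"
  proof eventually_elim
    case (elim h)
    have "\<bar>f h\<bar> \<le> K * (exp (- (c / 2) / h) * (exp (- (c / 2) / h) / h powr C))"
      using elim(1) by (simp add: exp_add[symmetric] add_divide_distrib[symmetric])
    also have "\<dots> \<le> \<bar>K\<bar> * (exp (- (c / 2) / h) * (exp (- (c / 2) / h) / h powr C))"
      by (intro mult_right_mono) auto
    also have "\<dots> \<le> \<bar>K\<bar> * (exp (- (c / 2) / h) * 1)"
      using elim(2) by (intro mult_left_mono) auto
    finally show ?case by simp
  qed
  then show ?thesis unfolding exp_small_def using assms(1) half_gt_zero by blast
qed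

lemma exp_small_add:
  assumes "exp_small f" "exp_small g"
  shows "exp_small (\<lambda>h. f h + g h)"
proof -
  obtain c K c' K' where *: "c > 0" "\<forall>\<^sub>F h in at_right 0. \<bar>f h\<bar> \<le> K * exp (- c / h)"
    "c' > 0" "\<forall>\<^sub>F h in at_right 0. \<bar>g h\<bar> \<le> K' * exp (- c' / h)"
    using assms unfolding exp_small_def by blast
  have "\<forall>\<^sub>F h in at_right 0. \<bar>f h + g h\<bar> \<le> (\<bar>K\<bar> + \<bar>K'\<bar>) * exp (- min c c' / h)"
    using *(2,4) eventually_at_right_less[of 0]
  proof eventually_elim
    case (elim h)
    have e: "exp (- c / h) \<le> exp (- min c c' / h)" "exp (- c' / h) \<le> exp (- min c c' / h)"
      using elim by (auto simp: divide_right_mono)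
    have "K * exp (- c / h) \<le> \<bar>K\<bar> * exp (- min c c' / h)"
      "K' * exp (- c' / h) \<le> \<bar>K'\<bar> * exp (- min c c' / h)"
      using e by (intro mult_mono; simp)+
    then show ?case using elim(1,2) unfolding distrib_right by linarith
  qed
  then show ?thesis unfolding exp_small_def using *(1,3) by (metis min_less_iff_conj)
qed

lemma exp_small_0: "exp_small (\<lambda>_. 0)"
  unfolding exp_small_def by (intro exI[of _ 1] conjI exI[of _ 0]) auto

lemma exp_small_mult_bounded:
  assumes "exp_small f" "\<forall>\<^sub>F h in at_right 0. \<bar>g h\<bar> \<le> B"
  shows "exp_small (\<lambda>h. f h * g h)"
proof -
  obtain c K where *: "c > 0" "\<forall>\<^sub>F h in at_right 0. \<bar>f h\<bar> \<le> K * exp (- c / h)"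
    using assms unfolding exp_small_def by blast
  have "\<forall>\<^sub>F h in at_right 0. \<bar>f h * g h\<bar> \<le> (K * B) * exp (- c / h)"
    using *(2) assms(2)
  proof eventually_elim
    case (elim h)
    then show ?case using mult_mono[of "\<bar>f h\<bar>" "K * exp (- c / h)" "\<bar>g h\<bar>" B]
      by (simp add: abs_mult algebra_simps)
  qed
  then show ?thesis using *(1) unfolding exp_small_def by blast
qed

lemma exp_small_cong:
  assumes "\<forall>\<^sub>F h in at_right 0. f h = g h" "exp_small f"
  shows "exp_small g"
proof -
  obtain c K where *: "c > 0" "\<forall>\<^sub>F h in at_right 0. \<bar>f h\<bar> \<le> K * exp (- c / h)"
    using assms unfolding exp_small_def by blast
  have "\<forall>\<^sub>F h in at_right 0. \<bar>g h\<bar> \<le> K * exp (- c / h)"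
    using *(2) assms(1) by eventually_elim simp
  then show ?thesis using *(1) unfolding exp_small_def by blast
qed

lemma exp_small_cmult: "exp_small f \<Longrightarrow> exp_small (\<lambda>h. f h * c)"
  by (rule exp_small_mult_bounded[where B = "\<bar>c\<bar>"]) auto

lemma exp_small_bounded:
  assumes "exp_small f"
  shows "\<exists>B. \<forall>\<^sub>F h in at_right 0. \<bar>f h\<bar> \<le> B"
proof -
  obtain c K where *: "c > 0" "\<forall>\<^sub>F h in at_right 0. \<bar>f h\<bar> \<le> K * exp (- c / h)"
    using assms unfolding exp_small_def by blast
  have "\<forall>\<^sub>F h in at_right 0. \<bar>f h\<bar> \<le> \<bar>K\<bar>"
    using *(2) eventually_at_right_less[of 0]
  proof eventually_elim
    case (elim h)
    have "K * exp (- c / h) \<le> \<bar>K\<bar> * 1" using *(1) elim by (intro mult_mono) auto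
    then show ?case using elim by simp
  qed
  then show ?thesis by blast
qed

lemma exp_small_mult_inverse:
  assumes "exp_small f"
  shows "exp_small (\<lambda>h. f h * (1 / h))"
proof -
  obtain c K where *: "c > 0" "\<forall>\<^sub>F h in at_right 0. \<bar>f h\<bar> \<le> K * exp (- c / h)"
    using assms unfolding exp_small_def by blast
  have "\<forall>\<^sub>F h in at_right 0. \<bar>f h * (1 / h)\<bar> \<le> K * (exp (- c / h) / h powr 1)"
    using *(2) eventually_at_right_less[of 0]
    by eventually_elim (auto simp: abs_mult divide_right_mono)
  then show ?thesis by (rule exp_small_powrI[OF *(1)])
qed

lemma exp_small_mult_poly:
  "exp_small f \<Longrightarrow> exp_small (\<lambda>h. f h * poly P (1 / h))"
proof (induction P arbitrary: f)
  case (pCons a P)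
  have "exp_small (\<lambda>h. f h * a + f h * (1 / h) * poly P (1 / h))"
    using pCons by (intro exp_small_add exp_small_cmult pCons.IH exp_small_mult_inverse)
  then show ?case by (simp add: algebra_simps)
qed (simp add: exp_small_0)

section \<open>Uniqueness and algebra of expansions in 1/h\<close>

lemma is_h_expansion_iff:
  "is_h_expansion f P \<longleftrightarrow> exp_small (\<lambda>h. f h - poly P (1 / h))"
proof
  assume "is_h_expansion f P"
  then obtain c C K where "c > 0"
    "\<forall>\<^sub>F h in at_right 0. norm (f h - poly P (1 / h)) \<le> K * norm (exp (- c / h) / h powr C)"
    unfolding is_h_expansion_def by (auto elim!: landau_o.bigE)
  then show "exp_small (\<lambda>h. f h - poly P (1 / h))"
    by (intro exp_small_powrI[of c _ K C]) auto
next
  assume "exp_small (\<lambda>h. f h - poly P (1 / h))"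
  then obtain c K where *: "c > 0" "\<forall>\<^sub>F h in at_right 0. \<bar>f h - poly P (1 / h)\<bar> \<le> K * exp (- c / h)"
    unfolding exp_small_def by blast
  have "\<forall>\<^sub>F h in at_right 0. norm (f h - poly P (1 / h)) \<le> K * norm (exp (- c / h) / h powr 0)"
    using *(2) eventually_at_right_less[of 0] by eventually_elim auto
  then show "is_h_expansion f P" unfolding is_h_expansion_def using *(1) by (blast intro: bigoI)
qed

text \<open>Up to sign a nonzero polynomial eventually stays above its positive leading coefficient,
  whereas an exponentially small function tends to 0. This makes the polynomial selected by
  \<open>connected_hbracket\<close> unique.\<close>

lemma exp_small_poly_imp_0:
  assumes "exp_small (\<lambda>h. poly P (1 / h))"
  shows "P = 0"
proof (rule ccontr)
  assume "P \<noteq> 0"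
  define Q where "Q = (if lead_coeff P > 0 then P else - P)"
  have Q: "lead_coeff Q > 0" using \<open>P \<noteq> 0\<close>
    by (auto simp: Q_def) (metis lead_coeff_minus leading_coeff_0_iff neg_0_less_iff_less linorder_neqE_linordered_idom)
  obtain n where n: "\<And>x. x \<ge> n \<Longrightarrow> poly Q x \<ge> lead_coeff Q"
    using poly_pinfty_gt_lc[OF Q] by blast
  obtain c K where *: "c > 0" "\<forall>\<^sub>F h in at_right 0. \<bar>poly P (1 / h)\<bar> \<le> K * exp (- c / h)"
    using assms unfolding exp_small_def by blast
  have "((\<lambda>h. K * exp (- c / h)) \<longlongrightarrow> 0) (at_right 0)" using *(1) by real_asymp
  then have 1: "\<forall>\<^sub>F h in at_right 0. K * exp (- c / h) < lead_coeff Q"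
    using Q by (rule order_tendstoD)
  have "filterlim (\<lambda>h::real. 1 / h) at_top (at_right 0)" by real_asymp
  then have 2: "\<forall>\<^sub>F h in at_right 0. n \<le> 1 / h" by (simp add: filterlim_at_top)
  have "\<forall>\<^sub>F h in at_right (0::real). False"
    using *(2) 1 2
  proof eventually_elim
    case (elim h)
    have "poly Q (1 / h) \<le> \<bar>poly P (1 / h)\<bar>" by (auto simp: Q_def)
    then show ?case using n[OF elim(3)] elim by linarith
  qed
  then show False by simp
qed

lemma is_h_expansion_unique:
  assumes "is_h_expansion f P" "is_h_expansion f Q"
  shows "P = Q"
proof -
  have "exp_small (\<lambda>h. (f h - poly Q (1 / h)) + (f h - poly P (1 / h)) * (-1))"
    using assms unfolding is_h_expansion_iff by (intro exp_small_add exp_small_cmult)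
  then have "exp_small (\<lambda>h. poly (P - Q) (1 / h))" by (simp add: algebra_simps)
  then show ?thesis using exp_small_poly_imp_0 by fastforce
qed

lemma is_h_expansion_add:
  "is_h_expansion f P \<Longrightarrow> is_h_expansion g Q \<Longrightarrow> is_h_expansion (\<lambda>h. f h + g h) (P + Q)"
  using exp_small_add[of "\<lambda>h. f h - poly P (1 / h)" "\<lambda>h. g h - poly Q (1 / h)"]
  by (simp add: is_h_expansion_iff algebra_simps)

lemma is_h_expansion_mult:
  assumes "is_h_expansion f P" "is_h_expansion g Q"
  shows "is_h_expansion (\<lambda>h. f h * g h) (P * Q)"
proof -
  let ?f = "\<lambda>h. f h - poly P (1 / h)" and ?g = "\<lambda>h. g h - poly Q (1 / h)"
  have fg: "exp_small ?f" "exp_small ?g" using assms by (simp_all add: is_h_expansion_iff)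
  obtain B where "\<forall>\<^sub>F h in at_right 0. \<bar>?g h\<bar> \<le> B" using exp_small_bounded[OF fg(2)] by blast
  then have "exp_small (\<lambda>h. ?f h * ?g h + (?f h * poly Q (1 / h) + ?g h * poly P (1 / h)))"
    by (intro exp_small_add exp_small_mult_bounded[OF fg(1)] exp_small_mult_poly fg)
  then show ?thesis by (simp add: is_h_expansion_iff algebra_simps)
qed

lemma is_h_expansion_const: "is_h_expansion (\<lambda>_. c) [:c:]"
  by (simp add: is_h_expansion_iff exp_small_0)

lemma is_h_expansion_sum:
  assumes "\<And>i. i \<in> I \<Longrightarrow> is_h_expansion (f i) (P i)"
  shows "is_h_expansion (\<lambda>h. \<Sum>i\<in>I. f i h) (\<Sum>i\<in>I. P i)"
  using assms is_h_expansion_const[of 0]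
  by (induction I rule: infinite_finite_induct) (auto intro!: is_h_expansion_add)

lemma is_h_expansion_prod:
  assumes "\<And>i. i \<in> I \<Longrightarrow> is_h_expansion (f i) (P i)"
  shows "is_h_expansion (\<lambda>h. \<Prod>i\<in>I. f i h) (\<Prod>i\<in>I. P i)"
  using assms is_h_expansion_const[of 1]
  by (induction I rule: infinite_finite_induct) (auto intro!: is_h_expansion_mult simp: one_pCons)

lemma is_h_expansion_cong:
  assumes "\<And>h. h > 0 \<Longrightarrow> f h = g h" "is_h_expansion f P"
  shows "is_h_expansion g P"
  unfolding is_h_expansion_iff
proof (rule exp_small_cong)
  show "\<forall>\<^sub>F h in at_right 0. f h - poly P (1 / h) = g h - poly P (1 / h)"
    using eventually_at_right_less[of 0] by eventually_elim (simp add: assms)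
qed (use assms(2) in \<open>simp add: is_h_expansion_iff\<close>)

text \<open>Existence of the expansion and the bound on its degree are carried together, since they
  are inherited by sums and products through the same closure rules.\<close>

definition h_degree_le :: "(real \<Rightarrow> real) \<Rightarrow> nat \<Rightarrow> bool" where
  "h_degree_le f d \<longleftrightarrow> (\<exists>P. is_h_expansion f P \<and> degree P \<le> d)"

lemma h_degree_le_cong: "(\<And>h. h > 0 \<Longrightarrow> f h = g h) \<Longrightarrow> h_degree_le f d \<Longrightarrow> h_degree_le g d"
  unfolding h_degree_le_def using is_h_expansion_cong[of f g] by blast

lemma h_degree_le_mono: "h_degree_le f d \<Longrightarrow> d \<le> d' \<Longrightarrow> h_degree_le f d'"
  unfolding h_degree_le_def using order_trans by blast

lemma h_degree_le_const: "h_degree_le (\<lambda>_. c) d"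
  unfolding h_degree_le_def using is_h_expansion_const[of c] by force

lemma h_degree_le_add: "h_degree_le f d \<Longrightarrow> h_degree_le g d \<Longrightarrow> h_degree_le (\<lambda>h. f h + g h) d"
  unfolding h_degree_le_def using is_h_expansion_add degree_add_le by metis

lemma h_degree_le_mult:
  "h_degree_le f d \<Longrightarrow> h_degree_le g d' \<Longrightarrow> h_degree_le (\<lambda>h. f h * g h) (d + d')"
  unfolding h_degree_le_def
  using is_h_expansion_mult degree_mult_le add_mono order_trans by meson

lemma h_degree_le_cmult: "h_degree_le f d \<Longrightarrow> h_degree_le (\<lambda>h. c * f h) d"
  using h_degree_le_mult[OF h_degree_le_const[of c 0]] by simp

lemma h_degree_le_sum:
  "(\<And>i. i \<in> I \<Longrightarrow> h_degree_le (f i) d) \<Longrightarrow> h_degree_le (\<lambda>h. \<Sum>i\<in>I. f i h) d"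
  by (induction I rule: infinite_finite_induct)
    (auto intro: h_degree_le_const h_degree_le_add)

lemma h_degree_le_prod:
  "(\<And>i. i \<in> I \<Longrightarrow> h_degree_le (f i) (d i)) \<Longrightarrow> h_degree_le (\<lambda>h. \<Prod>i\<in>I. f i h) (\<Sum>i\<in>I. d i)"
  by (induction I rule: infinite_finite_induct)
    (auto intro: h_degree_le_const h_degree_le_mult)

lemma h_degree_le_of_small:
  assumes "exp_small (\<lambda>h. f h - c / h ^ d)"
  shows "h_degree_le f d"
  unfolding h_degree_le_def is_h_expansion_iff
  using assms by (intro exI[of _ "monom c d"]) (simp add: poly_monom power_divide degree_monom_le)

text \<open>By the mean value theorem, and because \<open>exp (- c / h)\<close> increases with
  \<open>h\<close>, the increments of \<open>f\<close> below \<open>h\<close> are bounded by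
  \<open>K * exp (- c / h) * h\<close>. So \<open>f\<close> has a limit \<open>L\<close> at 0 and
  approaches it exponentially fast.\<close>

lemma exp_small_integrate:
  fixes f :: "real \<Rightarrow> real"
  assumes c: "c > 0" and d: "\<And>h. 0 < h \<Longrightarrow> h < b \<Longrightarrow> (f has_real_derivative f' h) (at h)"
    and bd: "\<And>h. 0 < h \<Longrightarrow> h < b \<Longrightarrow> \<bar>f' h\<bar> \<le> K * exp (- c / h)" and b: "b > 0"
  shows "\<exists>L. exp_small (\<lambda>h. f h - L)"
proof -
  have "0 \<le> K * exp (- c / (b/2))" by (rule order_trans[OF abs_ge_zero bd]) (use b in auto)
  then have K0: "K \<ge> 0" by (simp add: zero_le_mult_iff)
  have diff: "\<bar>f y - f x\<bar> \<le> K * exp (- c / y) * y" if "0 < x" "x \<le> y" "y < b" for x y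
  proof (cases "x = y")
    case False
    then have "x < y" using that by simp
    moreover have "DERIV f t :> f' t" if "x \<le> t" "t \<le> y" for t
      using d that \<open>0 < x\<close> \<open>y < b\<close> by simp
    ultimately obtain z where z: "x < z" "z < y" "f y - f x = (y - x) * f' z"
      using MVT2[of x y f f'] by blast
    have "\<bar>f' z\<bar> \<le> K * exp (- c / z)" using bd z that by simp
    also have "\<dots> \<le> K * exp (- c / y)"
      using z that c K0 by (intro mult_left_mono) (auto simp: divide_left_mono frac_le)
    finally have "\<bar>y - x\<bar> * \<bar>f' z\<bar> \<le> y * (K * exp (- c / y))"
      using that by (intro mult_mono) auto
    then show ?thesis unfolding z(3) abs_mult by (simp add: algebra_simps)
  qed (use K0 that in simp)
  have lim0: "((\<lambda>h. K * exp (- c / h) * h) \<longlongrightarrow> 0) (at_right 0)" using c by real_asymp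
  \<comment> \<open>With \<open>n + 2\<close> in the denominator every sample point, also the one
    for \<open>n = 0\<close>, is strictly below \<open>b\<close>, as the bound on the derivative
    requires.\<close>
  define g where "g n = f (b / (real n + 2))" for n
  have g0: "filterlim (\<lambda>n. b / (real n + 2)) (at_right 0) sequentially" using b by real_asymp
  have bn: "0 < b / (real n + 2)" "b / (real n + 2) < b" for n using b by (auto simp: field_simps intro!: add_pos_nonneg)
  have dec: "b / (real m + 2) \<le> b / (real n + 2)" if "n \<le> m" for n m
    using b that by (intro divide_left_mono) auto
  have "Cauchy g"
  proof (rule metric_CauchyI)
    fix e :: real assume "e > 0"
    from order_tendstoD(2)[OF filterlim_compose[OF lim0 g0] this]
    obtain M where M: "\<And>n. n \<ge> M \<Longrightarrow> K * exp (- c / (b / (real n + 2))) * (b / (real n + 2)) < e"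
      by (auto simp: eventually_sequentially)
    have 1: "dist (g m) (g n) < e" if "M \<le> n" "n \<le> m" for m n
    proof -
      have "\<bar>g n - g m\<bar> \<le> K * exp (- c / (b / (real n + 2))) * (b / (real n + 2))"
        unfolding g_def by (rule diff[OF bn(1) dec[OF that(2)] bn(2)])
      then show ?thesis using M[OF that(1)] by (simp add: dist_real_def abs_minus_commute)
    qed
    show "\<exists>M. \<forall>m\<ge>M. \<forall>n\<ge>M. dist (g m) (g n) < e"
      using 1 by (metis dist_commute nat_le_linear)
  qed
  then obtain L where L: "g \<longlonglongrightarrow> L" using Cauchy_convergent convergent_def by blast
  have "\<bar>f h - L\<bar> \<le> K * exp (- c / h) * h" if h: "0 < h" "h < b" for h
  proof (rule tendsto_upperbound)
    show "(\<lambda>n. \<bar>f h - g n\<bar>) \<longlonglongrightarrow> \<bar>f h - L\<bar>" by (intro tendsto_intros L)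
    have "filterlim (\<lambda>n. b / (real n + 2)) (at_right 0) sequentially" by (rule g0)
    then have "\<forall>\<^sub>F n in sequentially. b / (real n + 2) < h"
      using b h by real_asymp
    then show "\<forall>\<^sub>F n in sequentially. \<bar>f h - g n\<bar> \<le> K * exp (- c / h) * h"
      by eventually_elim (unfold g_def, rule diff, use bn h in auto)
  qed auto
  moreover have "K * exp (- c / h) * h \<le> (K * b) * exp (- c / h)" if "0 < h" "h < b" for h
    using mult_left_mono[of h b "K * exp (- c / h)"] that K0 by (simp add: algebra_simps)
  ultimately have "\<bar>f h - L\<bar> \<le> (K * b) * exp (- c / h)" if "0 < h" "h < b" for h
    using that order_trans by blast
  then have "\<forall>\<^sub>F h in at_right 0. \<bar>f h - L\<bar> \<le> (K * b) * exp (- c / h)"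
    unfolding eventually_at_right_field using b by blast
  then show ?thesis unfolding exp_small_def using c by blast
qed

section \<open>Sums of cumulants of a single site\<close>


text \<open>The cumulant of a Bernoulli variable is a polynomial in \<open>p\<close>, and it
  vanishes at \<open>p = 0\<close> and \<open>p = 1\<close>, where the variable is deterministic.
  For a Fermi probability the factor \<open>p * (1 - p)\<close> then gives decay in both
  directions.\<close>

lemma cumulant_const_factor:
  assumes "finite A" "card A \<ge> 2"
  shows "\<exists>R. \<forall>p. cumulant (\<lambda>_. p) A = p * (1 - p) * poly R p"
proof -
  define Q :: "real poly" where
    "Q = (\<Sum>P | partition_on A P. monom ((-1) ^ (card P - 1) * fact (card P - 1)) (card P))"
  have Q: "poly Q p = cumulant (\<lambda>_. p) A" for p
    by (simp add: Q_def cumulant_def poly_sum poly_monom)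
  have ne: "A \<noteq> {}" using assms by auto
  have "poly Q 1 = 0" using assms ne by (simp add: Q cumulant_one)
  moreover have "poly Q 0 = 0"
  proof -
    have "card P \<noteq> 0" if "partition_on A P" for P
      using that ne finite_elements[OF assms(1) that] by (auto simp: partition_on_def)
    then show ?thesis by (auto simp: Q_def poly_sum poly_monom power_0_left intro!: sum.neutral)
  qed
  ultimately have Q0: "[:0, 1:] dvd Q" and "poly Q 1 = 0"
    using poly_eq_0_iff_dvd[of Q 0] by simp_all
  from Q0 obtain R where R: "Q = [:0, 1:] * R" by (rule dvdE)
  then have "poly R 1 = 0" using \<open>poly Q 1 = 0\<close> by simp
  then have "[:-1, 1:] dvd R" using poly_eq_0_iff_dvd[of R 1] by simp
  then obtain R' where "R = [:-1, 1:] * R'" by (rule dvdE)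
  then have "Q = [:0, 1:] * ([:-1, 1:] * R')" using R by simp
  then have "cumulant (\<lambda>_. p) A = p * (1 - p) * poly (- R') p" for p
    unfolding Q[symmetric] by (simp add: algebra_simps)
  then show ?thesis by blast
qed

section \<open>Fermi factors and their sums over half-integers\<close>

lemma power_le_fact_exp:
  fixes x :: real
  assumes "x \<ge> 0"
  shows "x ^ k \<le> fact k * exp x"
proof -
  have "(\<Sum>n\<in>{k}. x ^ n /\<^sub>R fact n) \<le> (\<Sum>n. x ^ n /\<^sub>R fact n)"
    using assms by (intro sum_le_suminf summable_exp_generic) auto
  then show ?thesis by (simp add: exp_def field_simps)
qed

lemma summable_power_exp:
  assumes "h > (0::real)"
  shows "summable (\<lambda>n. (real n + 1/2) ^ k * exp (- (h * (real n + 1/2))))"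
proof -
  have "norm ((real n + 1/2) ^ k * exp (- (h * (real n + 1/2)))) \<le> (2 / h) ^ k * fact k * exp (- h / 2) ^ n" for n
  proof -
    have "(real n + 1/2) ^ k = (2 / h) ^ k * (h / 2 * (real n + 1/2)) ^ k"
    proof -
      have "2 / h * (h / 2 * (real n + 1/2)) = real n + 1/2" using assms by simp
      then show ?thesis unfolding power_mult_distrib[symmetric] by (simp only:)
    qed
    also have "\<dots> \<le> (2 / h) ^ k * (fact k * exp (h / 2 * (real n + 1/2)))"
      using assms by (intro mult_left_mono power_le_fact_exp) auto
    finally have "norm ((real n + 1/2) ^ k * exp (- (h * (real n + 1/2)))) \<le>
        (2 / h) ^ k * (fact k * exp (h / 2 * (real n + 1/2))) * exp (- (h * (real n + 1/2)))"
      by (simp add: abs_mult mult_right_mono)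
    also have "\<dots> = (2 / h) ^ k * fact k * exp (h / 2 * (real n + 1/2) + - (h * (real n + 1/2)))"
      unfolding exp_add by (simp add: mult.assoc)
    also have "\<dots> \<le> (2 / h) ^ k * fact k * exp (real n * (- h / 2))"
      using assms by (intro mult_left_mono) (auto simp: algebra_simps)
    finally show ?thesis by (simp only: exp_of_nat_mult)
  qed
  moreover have "summable (\<lambda>n. (2 / h) ^ k * fact k * exp (- h / 2) ^ n)"
    using assms by (intro summable_mult summable_geometric) auto
  ultimately show ?thesis by (rule summable_comparison_test'[rotated])
qed

text \<open>The probability u / (1 + u) that a site of weight u = exp (- x) is excited.\<close>

definition fermi :: "real \<Rightarrow> real" where "fermi x = 1 / (1 + exp x)"

lemma fermi_bounds: "0 < fermi x" "fermi x < 1" "fermi x \<le> exp (- x)"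
proof -
  have "0 < exp x" by simp
  then show "0 < fermi x" "fermi x < 1" unfolding fermi_def by (auto simp: add_pos_pos)
  have "1 / (1 + exp x) \<le> 1 / exp x" by (intro divide_left_mono) (auto simp: add_pos_pos)
  then show "fermi x \<le> exp (- x)" by (simp add: fermi_def exp_minus inverse_eq_divide)
qed

lemma fermi_minus: "fermi (- x) = 1 - fermi x"
proof -
  have "1 + exp x \<noteq> 0" using exp_gt_zero[of x] by linarith
  then show ?thesis by (simp add: fermi_def exp_minus divide_simps)
qed

text \<open>The summand extends to a function holomorphic in the strip, and
  \<open>fermi * (1 - fermi)\<close> makes it decay at both ends, so the half-integer sum applies.
  Rescaling by \<open>h ^ k\<close> turns its main term \<open>c / h\<close> into
  \<open>c / h ^ Suc k\<close>.\<close>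

lemma fermi_sum_asymptotics:
  fixes R :: "real poly"
  defines "g \<equiv> \<lambda>x. fermi x * (1 - fermi x) * poly R (fermi x)"
  shows "\<exists>c K. \<forall>h. 0 < h \<longrightarrow> h \<le> 1 \<longrightarrow>
    \<bar>(\<Sum>n. (real n + 1/2) ^ k * g (h * (real n + 1/2)) + (- (real n + 1/2)) ^ k * g (- (h * (real n + 1/2)))) - c / h ^ Suc k\<bar>
      \<le> K * exp (- (2 * pi) / h) / h ^ Suc k"
proof -
  define f where "f w = 1 / (1 + exp w)" for w :: complex
  define RC where "RC = map_poly complex_of_real R"
  define F where "F w = w ^ k * (f w * (1 - f w) * poly RC (f w))" for w
  \<comment> \<open>The half-width 3/2 exceeds the height 1 of the contours but is below pi/2, so
    \<open>exp w\<close> has positive real part. Hence \<open>1 + exp w\<close> is at least 1 and at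
    least \<open>exp w\<close> in modulus.\<close>
  have pos: "0 < Re (exp w)" if "\<bar>Im w\<bar> < 3/2" for w
  proof -
    have "\<bar>Im w\<bar> < pi / 2" using that pi_gt3 by linarith
    then show ?thesis by (simp add: Re_exp cos_gt_zero_pi abs_less_iff)
  qed
  have den: "1 \<le> norm (1 + exp w)" "norm (exp w) \<le> norm (1 + exp w)" if "\<bar>Im w\<bar> < 3/2" for w
  proof -
    have "1 \<le> Re (1 + exp w)" using pos[OF that] by simp
    then show "1 \<le> norm (1 + exp w)" using complex_Re_le_cmod order_trans by blast
    have "(norm (exp w))\<^sup>2 \<le> (norm (1 + exp w))\<^sup>2"
      unfolding cmod_power2 using pos[OF that] by (simp add: power2_eq_square algebra_simps)
    then show "norm (exp w) \<le> norm (1 + exp w)" by (simp add: power2_le_iff_abs_le)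
  qed
  have nz: "1 + exp w \<noteq> 0" if "\<bar>Im w\<bar> < 3/2" for w using den(1)[OF that] by auto
  have hol: "F holomorphic_on {z. \<bar>Im z\<bar> < 3/2}"
  proof -
    have "f holomorphic_on {z. \<bar>Im z\<bar> < 3/2}" unfolding f_def using nz by (intro holomorphic_intros) auto
    then have "(\<lambda>w. poly RC (f w)) holomorphic_on {z. \<bar>Im z\<bar> < 3/2}"
      by (induction RC) (auto intro!: holomorphic_intros)
    with \<open>f holomorphic_on _\<close> show ?thesis unfolding F_def by (intro holomorphic_intros)
  qed
  have "bounded (poly RC ` cball 0 1)"
    by (intro compact_imp_bounded compact_continuous_image continuous_intros compact_cball)
  then obtain B0 where "\<forall>z\<in>cball 0 1. norm (poly RC z) \<le> B0"
    unfolding bounded_iff by auto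
  then have B0: "norm (poly RC z) \<le> B0" if "norm z \<le> 1" for z using that by simp
  then have "B0 \<ge> 0" using order_trans[OF norm_ge_zero B0[of 0]] by simp
  \<comment> \<open>Half of the decay \<open>exp (- \<bar>Re w\<bar>)\<close> absorbs the power
    \<open>w ^ k\<close>; the factor \<open>exp (3/4)\<close> is what the bound 3/2 on the imaginary
    part contributes after halving.\<close>
  define C where "C = 2 ^ k * fact k * exp (3/4) * B0"
  have bnd: "norm (F w) \<le> C * exp (- \<bar>Re w\<bar> / 2)" if w: "\<bar>Im w\<bar> < 3/2" for w
  proof -
    have f1: "norm (f w) \<le> 1" unfolding f_def norm_divide using den(1)[OF w] by (auto simp: divide_le_eq_1)
    have "f w * (1 - f w) = exp w / ((1 + exp w) * (1 + exp w))" unfolding f_def using nz[OF w] by (simp add: field_simps)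
    then have eq: "norm (f w * (1 - f w)) = norm (exp w) / (norm (1 + exp w) * norm (1 + exp w))"
      by (simp only: norm_divide norm_mult)
    have pos1: "0 < norm (1 + exp w)" using den(1)[OF w] by linarith
    have f2: "norm (f w * (1 - f w)) \<le> exp (- \<bar>Re w\<bar>)"
    proof (cases "Re w \<ge> 0")
      case True
      have "norm (exp w) / (norm (1 + exp w) * norm (1 + exp w)) \<le> norm (exp w) / (norm (exp w) * norm (exp w))"
        using den[OF w] pos1 by (intro divide_left_mono mult_mono) (auto intro!: mult_pos_pos)
      then show ?thesis using True unfolding eq by (simp add: exp_minus inverse_eq_divide)
    next
      case False
      have "norm (exp w) / (norm (1 + exp w) * norm (1 + exp w)) \<le> norm (exp w) / (1 * 1)"
        using den[OF w] pos1 by (intro divide_left_mono mult_mono) (auto intro!: mult_pos_pos)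
      then show ?thesis using False unfolding eq by simp
    qed
    have "norm w ^ k \<le> (\<bar>Re w\<bar> + 3/2) ^ k"
      using cmod_le[of w] w by (intro power_mono) auto
    also have "\<dots> = 2 ^ k * ((\<bar>Re w\<bar> + 3/2) / 2) ^ k" by (simp add: power_divide)
    also have "\<dots> \<le> 2 ^ k * (fact k * exp ((\<bar>Re w\<bar> + 3/2) / 2))"
      by (intro mult_left_mono power_le_fact_exp) auto
    finally have f3: "norm w ^ k \<le> 2 ^ k * (fact k * exp ((\<bar>Re w\<bar> + 3/2) / 2))" .
    have "norm (F w) = norm w ^ k * (norm (f w * (1 - f w)) * norm (poly RC (f w)))"
      by (simp add: F_def norm_mult norm_power)
    also have "\<dots> \<le> (2 ^ k * (fact k * exp ((\<bar>Re w\<bar> + 3/2) / 2))) * (exp (- \<bar>Re w\<bar>) * B0)"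
      using f1 f2 f3 B0 by (intro mult_mono) auto
    also have "\<dots> = 2 ^ k * fact k * B0 * exp ((\<bar>Re w\<bar> + 3/2) / 2 + - \<bar>Re w\<bar>)"
      unfolding exp_add by (simp add: algebra_simps)
    also have "(\<bar>Re w\<bar> + 3/2) / 2 + - \<bar>Re w\<bar> = 3/4 + - \<bar>Re w\<bar> / 2" by simp
    also have "2 ^ k * fact k * B0 * exp (3/4 + - \<bar>Re w\<bar> / 2) = C * exp (- \<bar>Re w\<bar> / 2)"
      unfolding exp_add C_def by (simp add: algebra_simps)
    finally show ?thesis .
  qed
  have Freal: "F (of_real x) = of_real (x ^ k * g x)" for x
  proof -
    have "f (of_real x) = of_real (fermi x)" by (simp add: f_def fermi_def exp_of_real[symmetric])
    moreover have "poly RC (of_real y) = of_real (poly R y)" for y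
      unfolding RC_def by (induction R) (simp_all add: map_poly_pCons)
    ultimately show ?thesis by (simp add: F_def g_def)
  qed
  have "\<exists>(c::complex) (K::real). \<forall>h::real. 0 < h \<longrightarrow> h \<le> 1 \<longrightarrow>
      norm ((\<Sum>n. F (of_real (h * (n + 1/2))) + F (of_real (- (h * (n + 1/2))))) - c / h) \<le> K * exp (- (2 * pi) / h) / h"
    by (rule half_integer_sum[OF hol]) (rule bnd)
  then obtain c :: complex and K :: real where cK': "\<forall>h::real. 0 < h \<longrightarrow> h \<le> 1 \<longrightarrow>
      norm ((\<Sum>n. F (of_real (h * (n + 1/2))) + F (of_real (- (h * (n + 1/2))))) - c / h) \<le> K * exp (- (2 * pi) / h) / h"
    by (elim exE)
  note cK = cK'[rule_format]
  have "\<bar>(\<Sum>n. (real n + 1/2) ^ k * g (h * (real n + 1/2)) + (- (real n + 1/2)) ^ k * g (- (h * (real n + 1/2)))) - Re c / h ^ Suc k\<bar>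
      \<le> K * exp (- (2 * pi) / h) / h ^ Suc k" if h: "0 < h" "h \<le> 1" for h
  proof -
    define t where "t n = (real n + 1/2) ^ k * g (h * (real n + 1/2)) + (- (real n + 1/2)) ^ k * g (- (h * (real n + 1/2)))" for n
    have t: "F (of_real (h * (real n + 1/2))) + F (of_real (- (h * (real n + 1/2)))) = of_real (h ^ k * t n)" for n
    proof -
      have "(- (h * (real n + 1/2))) ^ k = h ^ k * (- (real n + 1/2)) ^ k"
        by (simp only: power_mult_distrib[symmetric] mult_minus_right)
      then have "(h * (real n + 1/2)) ^ k * g (h * (real n + 1/2)) + (- (h * (real n + 1/2))) ^ k * g (- (h * (real n + 1/2))) = h ^ k * t n"
        unfolding t_def power_mult_distrib[of h "real n + 1/2"] by (simp only: ring_distribs(1)[of "h ^ k"] mult.assoc)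
      then show ?thesis unfolding Freal of_real_add[symmetric] by (simp only:)
    qed
    have Fb: "norm (F (of_real x)) \<le> C * exp (- (h / 2 * (real n + 1/2)))" if "\<bar>x\<bar> = h * (real n + 1/2)" for x n
      using bnd[of "of_real x"] that by (simp add: mult.commute)
    have s0: "summable (\<lambda>n. 2 * C * exp (- (h / 2 * (real n + 1/2))))"
      using summable_mult[OF summable_power_exp[of "h/2" 0], of "2 * C"] h by (simp add: mult.assoc)
    have "summable (\<lambda>n. complex_of_real (h ^ k * t n))"
    proof (rule summable_comparison_test'[OF s0, of 0])
      fix n
      have "norm (complex_of_real (h ^ k * t n)) \<le> C * exp (- (h / 2 * (real n + 1/2))) + C * exp (- (h / 2 * (real n + 1/2)))"
        unfolding t[symmetric] using h by (intro norm_triangle_mono Fb) auto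
      then show "norm (complex_of_real (h ^ k * t n)) \<le> 2 * C * exp (- (h / 2 * (real n + 1/2)))" by simp
    qed
    then have "(\<Sum>n. F (of_real (h * (n + 1/2))) + F (of_real (- (h * (n + 1/2))))) = of_real (\<Sum>n. h ^ k * t n)"
      and s1: "summable (\<lambda>n. h ^ k * t n)"
      unfolding t by (simp_all add: suminf_of_real[symmetric] summable_complex_of_real del: of_real_mult)
    with cK[OF h] have "norm (of_real (\<Sum>n. h ^ k * t n) - c / h) \<le> K * exp (- (2 * pi) / h) / h" by simp
    then have "\<bar>Re (of_real (\<Sum>n. h ^ k * t n) - c / h)\<bar> \<le> K * exp (- (2 * pi) / h) / h"
      using abs_Re_le_cmod order_trans by blast
    moreover have "(\<Sum>n. h ^ k * t n) = h ^ k * (\<Sum>n. t n)"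
      using s1 h by (intro suminf_mult) (simp add: summable_cmult_iff)
    ultimately have "\<bar>h ^ k * (\<Sum>n. t n) - Re c / h\<bar> \<le> K * exp (- (2 * pi) / h) / h"
      using Re_divide_of_real by simp
    then have "\<bar>h ^ k * (\<Sum>n. t n) - Re c / h\<bar> / h ^ k \<le> K * exp (- (2 * pi) / h) / h / h ^ k"
      using h by (intro divide_right_mono) auto
    moreover have "\<bar>h ^ k * (\<Sum>n. t n) - Re c / h\<bar> / h ^ k = \<bar>(h ^ k * (\<Sum>n. t n) - Re c / h) / h ^ k\<bar>"
      using h by simp
    moreover have "(h ^ k * (\<Sum>n. t n) - Re c / h) / h ^ k = (\<Sum>n. t n) - Re c / h ^ Suc k"
      using h by (simp add: field_simps)
    ultimately show ?thesis unfolding t_def[symmetric] by simp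
  qed
  then show ?thesis by (intro exI[of _ "Re c"] exI[of _ K] allI impI)
qed

lemma exp_small_of_bound:
  assumes "\<And>h. 0 < h \<Longrightarrow> h \<le> 1 \<Longrightarrow> \<bar>f h\<bar> \<le> K * exp (- (2 * pi) / h) / h ^ d"
  shows "exp_small f"
proof (rule exp_small_powrI[of "2 * pi"])
  show "\<forall>\<^sub>F h in at_right 0. \<bar>f h\<bar> \<le> K * (exp (- (2 * pi) / h) / h powr real d)"
    unfolding eventually_at_right_field
    using assms by (intro exI[of _ 1]) (auto simp: powr_realpow)
qed simp


lemma h_degree_le_fermi_sum:
  fixes g :: "real \<Rightarrow> real"
  assumes "\<And>x. g x = fermi x * (1 - fermi x) * poly R (fermi x)"
  shows "h_degree_le (\<lambda>h. \<Sum>n. (real n + 1/2) ^ k * g (h * (real n + 1/2)) +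
    (- (real n + 1/2)) ^ k * g (- (h * (real n + 1/2)))) (Suc k)"
proof -
  obtain c K where "\<forall>h. 0 < h \<longrightarrow> h \<le> 1 \<longrightarrow>
    \<bar>(\<Sum>n. (real n + 1/2) ^ k * g (h * (real n + 1/2)) + (- (real n + 1/2)) ^ k * g (- (h * (real n + 1/2)))) - c / h ^ Suc k\<bar>
      \<le> K * exp (- (2 * pi) / h) / h ^ Suc k"
    using fermi_sum_asymptotics[of k R] unfolding assms by (elim exE)
  note * = this[rule_format]
  show ?thesis by (rule h_degree_le_of_small[OF exp_small_of_bound[OF *]])
qed

lemma cumulant_singleton:
  assumes "card B = 1"
  shows "cumulant M B = M B"
proof -
  obtain x where B: "B = {x}" using assms card_1_singletonE by blast
  have "{P. partition_on {x} P} = {{{x}}}"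
  proof -
    have "P = {{x}}" if "partition_on {x} P" for P
    proof -
      have "\<Union>P = {x}" "{} \<notin> P" using that by (auto simp: partition_on_def)
      then have "\<forall>B\<in>P. B = {x}" by (metis Union_upper subset_singletonD)
      moreover have "P \<noteq> {}" using \<open>\<Union>P = {x}\<close> by auto
      ultimately show ?thesis by auto
    qed
    then show ?thesis by (auto simp: partition_on_def)
  qed
  then show ?thesis unfolding B cumulant_def by simp
qed

lemma DERIV_fermi: "(fermi has_real_derivative - (fermi y * (1 - fermi y))) (at y)"
proof -
  have nz: "1 + exp y \<noteq> 0" using exp_gt_zero[of y] by linarith
  then have "((\<lambda>y. 1 / (1 + exp y)) has_real_derivative - (exp y / ((1 + exp y) * (1 + exp y)))) (at y)"
    by (auto intro!: derivative_eq_intros)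
  moreover have "exp y / ((1 + exp y) * (1 + exp y)) = fermi y * (1 - fermi y)"
    using nz by (simp add: fermi_def diff_divide_eq_iff)
  ultimately show ?thesis by (simp add: fermi_def[abs_def])
qed

text \<open>Termwise differentiation is allowed because on \<open>{h/2..}\<close> the differentiated
  series is dominated by a convergent series with exponent \<open>h / 2\<close>.\<close>

lemma has_derivative_fermi_series:
  assumes h: "h > 0"
  shows "((\<lambda>h. \<Sum>n. (real n + 1/2) ^ k * fermi (h * (real n + 1/2))) has_real_derivative
    (\<Sum>n. - ((real n + 1/2) ^ Suc k * (fermi (h * (real n + 1/2)) * (1 - fermi (h * (real n + 1/2))))))) (at h)"
proof (rule has_field_derivative_series'(2))
  let ?S = "{h/2..}"
  show "convex ?S" by simp
  show "h \<in> interior ?S" using h by simp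
  show "h \<in> ?S" using h by simp
  show "summable (\<lambda>n. (real n + 1/2) ^ k * fermi (h * (real n + 1/2)))"
    by (rule summable_comparison_test'[OF summable_power_exp[OF h], of 0])
      (use fermi_bounds in \<open>auto simp: abs_mult less_imp_le intro!: mult_left_mono\<close>)
  show "((\<lambda>h. (real n + 1/2) ^ k * fermi (h * (real n + 1/2))) has_real_derivative
     - ((real n + 1/2) ^ Suc k * (fermi (x * (real n + 1/2)) * (1 - fermi (x * (real n + 1/2)))))) (at x within ?S)" for n x
  proof -
    have "((\<lambda>h. h * (real n + 1/2)) has_real_derivative (real n + 1/2)) (at x within ?S)"
      by (auto intro!: derivative_eq_intros)
    from DERIV_chain2[OF DERIV_fermi this]
    have "((\<lambda>h. fermi (h * (real n + 1/2))) has_real_derivative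
       - ((real n + 1/2) * (fermi (x * (real n + 1/2)) * (1 - fermi (x * (real n + 1/2)))))) (at x within ?S)"
      by (simp add: mult.commute)
    from DERIV_cmult[OF this, of "(real n + 1/2) ^ k"] show ?thesis by (simp add: algebra_simps)
  qed
  show "uniformly_convergent_on ?S (\<lambda>n x. \<Sum>i<n. - ((real i + 1/2) ^ Suc k * (fermi (x * (real i + 1/2)) * (1 - fermi (x * (real i + 1/2))))))"
  proof (rule Weierstrass_m_test')
    show "summable (\<lambda>n. (real n + 1/2) ^ Suc k * exp (- (h / 2 * (real n + 1/2))))"
      using h by (intro summable_power_exp) simp
    fix n x assume x: "x \<in> ?S"
    let ?p = "fermi (x * (real n + 1/2))"
    have "\<bar>?p * (1 - ?p)\<bar> \<le> exp (- (x * (real n + 1/2))) * 1"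
      unfolding abs_mult using fermi_bounds[of "x * (real n + 1/2)"] by (intro mult_mono) auto
    also have "\<dots> \<le> exp (- (h / 2 * (real n + 1/2)))" using x by (simp add: mult_right_mono)
    finally show "norm (- ((real n + 1/2) ^ Suc k * (?p * (1 - ?p)))) \<le> (real n + 1/2) ^ Suc k * exp (- (h / 2 * (real n + 1/2)))"
      by (simp add: abs_mult mult_left_mono)
  qed
qed

text \<open>A lone \<open>fermi\<close> tends to 1 at minus infinity, so the two-sided sum diverges
  and the contour argument fails. The derivative in \<open>h\<close> has the even factor
  \<open>fermi * (1 - fermi)\<close>, to which it applies. For odd \<open>k\<close> the derivative
  involves the even power \<open>Suc k\<close>, so the two half-lines contribute equally; for even
  \<open>k\<close> the mean is zero.\<close>

lemma h_degree_le_fermi_mean: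
  "h_degree_le (\<lambda>h. \<Sum>n. ((real n + 1/2) ^ k - (- (real n + 1/2)) ^ k) * fermi (h * (real n + 1/2))) (Suc k)"
proof (cases "even k")
  case True
  then show ?thesis unfolding power_minus_even[OF True] by (simp add: h_degree_le_const)
next
  case False
  define f where "f h = (\<Sum>n. (real n + 1/2) ^ k * fermi (h * (real n + 1/2)))" for h
  define f' where "f' h = (\<Sum>n. - ((real n + 1/2) ^ Suc k * (fermi (h * (real n + 1/2)) * (1 - fermi (h * (real n + 1/2))))))" for h
  have der: "(f has_real_derivative f' h) (at h)" if "h > 0" for h
    unfolding f_def f'_def by (rule has_derivative_fermi_series[OF that])
  have "\<exists>c K. \<forall>h. 0 < h \<longrightarrow> h \<le> 1 \<longrightarrow>
    \<bar>(\<Sum>n. (real n + 1/2) ^ Suc k * (fermi (h * (real n + 1/2)) * (1 - fermi (h * (real n + 1/2)))) +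
        (- (real n + 1/2)) ^ Suc k * (fermi (- (h * (real n + 1/2))) * (1 - fermi (- (h * (real n + 1/2)))))) - c / h ^ Suc (Suc k)\<bar>
      \<le> K * exp (- (2 * pi) / h) / h ^ Suc (Suc k)"
    using fermi_sum_asymptotics[of "Suc k" 1] by (simp only: poly_1 mult_1_right)
  then obtain c K where "\<forall>h. 0 < h \<longrightarrow> h \<le> 1 \<longrightarrow>
    \<bar>(\<Sum>n. (real n + 1/2) ^ Suc k * (fermi (h * (real n + 1/2)) * (1 - fermi (h * (real n + 1/2)))) +
        (- (real n + 1/2)) ^ Suc k * (fermi (- (h * (real n + 1/2))) * (1 - fermi (- (h * (real n + 1/2)))))) - c / h ^ Suc (Suc k)\<bar>
      \<le> K * exp (- (2 * pi) / h) / h ^ Suc (Suc k)"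
    by (elim exE)
  note cK = this[rule_format]
  have f'_eq: "(\<Sum>n. (real n + 1/2) ^ Suc k * (fermi (h * (real n + 1/2)) * (1 - fermi (h * (real n + 1/2)))) +
        (- (real n + 1/2)) ^ Suc k * (fermi (- (h * (real n + 1/2))) * (1 - fermi (- (h * (real n + 1/2)))))) = -2 * f' h"
    if h: "h > 0" for h
  proof -
    let ?t = "\<lambda>n. - ((real n + 1/2) ^ Suc k * (fermi (h * (real n + 1/2)) * (1 - fermi (h * (real n + 1/2)))))"
    have s: "summable ?t"
    proof (rule summable_comparison_test'[OF summable_power_exp[OF h], of 0 _ "Suc k"])
      fix n
      let ?p = "fermi (h * (real n + 1/2))"
      have "\<bar>?p * (1 - ?p)\<bar> \<le> exp (- (h * (real n + 1/2))) * 1"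
        unfolding abs_mult using fermi_bounds[of "h * (real n + 1/2)"] by (intro mult_mono) auto
      then show "norm (?t n) \<le> (real n + 1/2) ^ Suc k * exp (- (h * (real n + 1/2)))"
        by (simp add: abs_mult mult_left_mono)
    qed
    have "(\<Sum>n. -2 * ?t n) = -2 * f' h" unfolding f'_def by (rule suminf_mult[OF s])
    moreover have "even (Suc k)" using False by simp
    moreover have "x * (p * (1 - p)) + x * ((1 - p) * (1 - (1 - p))) = -2 * - (x * (p * (1 - p)))" for x p :: real
      by (simp add: algebra_simps)
    ultimately show ?thesis unfolding fermi_minus by (simp only: power_minus_even)
  qed
  have small': "exp_small (\<lambda>h. -2 * f' h - c / h ^ Suc (Suc k))"
    by (rule exp_small_of_bound[where K = K and d = "Suc (Suc k)"]) (use cK f'_eq in simp)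
  \<comment> \<open>The added term is chosen so that its derivative is
    \<open>- c / h ^ Suc (Suc k)\<close>; it cancels the main term of \<open>-2 * f'\<close>, and
    the derivative of \<open>\<psi>\<close> is exponentially small.\<close>
  define \<psi> where "\<psi> h = -2 * f h + (c / real (Suc k)) * inverse h ^ Suc k * 1" for h
  from small' obtain a K' where a: "a > 0" "\<forall>\<^sub>F h in at_right 0. \<bar>-2 * f' h - c / h ^ Suc (Suc k)\<bar> \<le> K' * exp (- a / h)"
    unfolding exp_small_def by blast
  then obtain b where b: "b > 0" "\<And>h. 0 < h \<Longrightarrow> h < b \<Longrightarrow> \<bar>-2 * f' h - c / h ^ Suc (Suc k)\<bar> \<le> K' * exp (- a / h)"
    unfolding eventually_at_right_field by auto
  have d\<psi>: "(\<psi> has_real_derivative (-2 * f' h - c / h ^ Suc (Suc k))) (at h)" if "h > 0" for h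
  proof -
    have "((\<lambda>h. inverse h ^ Suc k) has_real_derivative - (real (Suc k) / h ^ Suc (Suc k))) (at h)"
      using DERIV_power_Suc[OF DERIV_inverse[of h], of k] that
      by (simp add: divide_inverse power_inverse algebra_simps)
    from DERIV_add[OF DERIV_cmult[OF der[OF that], of "-2"] DERIV_cmult[OF this, of "c / real (Suc k)"]]
    show ?thesis unfolding \<psi>_def by simp
  qed
  obtain L where L: "exp_small (\<lambda>h. \<psi> h - L)"
    using exp_small_integrate[of a b \<psi>, OF a(1) d\<psi> b(2) b(1)] by blast
  define P where "P = monom (c / real (Suc k)) (Suc k) + [:- L:]"
  have fermi_summable: "summable (\<lambda>n. (real n + 1/2) ^ k * fermi (h * (real n + 1/2)))" if "h > 0" for h
    by (rule summable_comparison_test'[OF summable_power_exp[OF that], of 0])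
      (use fermi_bounds in \<open>auto simp: abs_mult less_imp_le intro!: mult_left_mono\<close>)
  have eq: "(\<Sum>n. ((real n + 1/2) ^ k - (- (real n + 1/2)) ^ k) * fermi (h * (real n + 1/2))) = 2 * f h" if "h > 0" for h
  proof -
    have "(- (real n + 1/2)) ^ k = - ((real n + 1/2) ^ k)" for n using False by (intro power_minus_odd) simp
    then show ?thesis unfolding f_def suminf_mult[OF fermi_summable[OF that], symmetric] by (simp add: algebra_simps)
  qed
  have "is_h_expansion (\<lambda>h. 2 * f h) P"
    unfolding is_h_expansion_iff
    using exp_small_cmult[OF L, of "-1"]
    by (simp add: P_def \<psi>_def poly_monom power_one_over inverse_eq_divide algebra_simps)
  moreover have "degree P \<le> Suc k" unfolding P_def
    by (intro degree_add_le degree_monom_le) auto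
  ultimately have "h_degree_le (\<lambda>h. 2 * f h) (Suc k)" unfolding h_degree_le_def by blast
  then show ?thesis by (rule h_degree_le_cong[rotated]) (rule eq[symmetric])
qed

text \<open>The sign \<open>(-1) ^ card B\<close> comes from the negative sites. For at least two
  indices it is the sign by which the cumulant changes under p -> 1 - p, that is under x -> - x in
  the Fermi factor; so the one-sided sum is a sum of a single analytic function over all
  half-integers. For one index it is the Fermi mean.\<close>

lemma h_degree_le_site_cumulants:
  assumes "finite B" "B \<noteq> {}"
  shows "h_degree_le (\<lambda>h. \<Sum>n. ((real n + 1/2) ^ k + (-1) ^ card B * (- (real n + 1/2)) ^ k) *
    cumulant (\<lambda>_. fermi (h * (real n + 1/2))) B) (Suc k)"
proof (cases "card B = 1")
  case True
  then show ?thesis using h_degree_le_fermi_mean[of k] by (simp add: cumulant_singleton)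
next
  case False
  then have B: "card B \<ge> 2" using assms by (metis One_nat_def Suc_1 card_gt_0_iff less_2_cases_iff not_less zero_less_iff_neq_zero)
  obtain R where R: "\<And>p. cumulant (\<lambda>_. p) B = p * (1 - p) * poly R p"
    using cumulant_const_factor[OF assms(1) B] by blast
  have "h_degree_le (\<lambda>h. \<Sum>n. (real n + 1/2) ^ k * cumulant (\<lambda>_. fermi (h * (real n + 1/2))) B +
    (- (real n + 1/2)) ^ k * cumulant (\<lambda>_. fermi (- (h * (real n + 1/2)))) B) (Suc k)"
    by (rule h_degree_le_fermi_sum[OF R])
  then show ?thesis
    unfolding fermi_minus cumulant_const_reflect[OF assms(1) B]
    by (simp add: distrib_right mult.left_commute mult.assoc)
qed

lemma summable_site_cumulants:
  assumes "finite B" "B \<noteq> {}" "h > 0"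
  shows "summable (\<lambda>n. ((real n + 1/2) ^ k + (-1) ^ card B * (- (real n + 1/2)) ^ k) *
    cumulant (\<lambda>_. fermi (h * (real n + 1/2))) B)"
proof -
  define c :: real where "c = (\<Sum>P | partition_on B P. fact (card P - 1))"
  have b: "\<bar>cumulant (\<lambda>_. p) B\<bar> \<le> c * p" if p: "0 < p" "p < 1" for p :: real
  proof -
    have "\<bar>cumulant (\<lambda>_. p) B\<bar> \<le> (\<Sum>P | partition_on B P. \<bar>(-1) ^ (card P - 1) * fact (card P - 1) * (\<Prod>B\<in>P. p)\<bar>)"
      unfolding cumulant_def by (rule sum_abs)
    also have "\<dots> \<le> (\<Sum>P | partition_on B P. fact (card P - 1) * p)"
    proof (rule sum_mono)
      fix P assume "P \<in> {P. partition_on B P}"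
      then have P: "partition_on B P" by simp
      then have "card P \<noteq> 0" using assms(2) finite_elements[OF assms(1) P] by (auto simp: partition_on_def)
      then have "p ^ card P \<le> p ^ 1" using p by (intro power_decreasing) auto
      then show "\<bar>(-1) ^ (card P - 1) * fact (card P - 1) * (\<Prod>B\<in>P. p)\<bar> \<le> fact (card P - 1) * p"
        using p by (simp add: abs_mult power_abs)
    qed
    finally show ?thesis by (simp add: c_def sum_distrib_right)
  qed
  have c0: "c \<ge> 0" unfolding c_def by (intro sum_nonneg) simp
  show ?thesis
  proof (rule summable_comparison_test'[OF summable_mult[OF summable_power_exp[OF assms(3), of k], of "2 * c"], of 0])
    fix n
    let ?a = "real n + 1/2"
    have "\<bar>?a ^ k + (-1) ^ card B * (- ?a) ^ k\<bar> \<le> \<bar>?a ^ k\<bar> + \<bar>(-1) ^ card B * (- ?a) ^ k\<bar>" by (rule abs_triangle_ineq)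
    also have "\<dots> = 2 * ?a ^ k" by (simp add: abs_mult power_abs add.commute)
    finally have 1: "\<bar>?a ^ k + (-1) ^ card B * (- ?a) ^ k\<bar> \<le> 2 * ?a ^ k" .
    have "\<bar>cumulant (\<lambda>_. fermi (h * ?a)) B\<bar> \<le> c * fermi (h * ?a)" using fermi_bounds by (intro b)
    also have "\<dots> \<le> c * exp (- (h * ?a))" using c0 fermi_bounds by (intro mult_left_mono)
    finally have "\<bar>?a ^ k + (-1) ^ card B * (- ?a) ^ k\<bar> * \<bar>cumulant (\<lambda>_. fermi (h * ?a)) B\<bar> \<le> 2 * ?a ^ k * (c * exp (- (h * ?a)))"
      using 1 by (intro mult_mono) auto
    then show "norm ((?a ^ k + (-1) ^ card B * (- ?a) ^ k) * cumulant (\<lambda>_. fermi (h * ?a)) B) \<le> 2 * c * (?a ^ k * exp (- (h * ?a)))"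
      by (simp only: real_norm_def abs_mult mult.assoc mult.commute mult.left_commute)
  qed
qed

section \<open>The grand canonical ensemble\<close>


text \<open>The weight of a subset factors over the sites, so each site is occupied independently
  with probability \<open>u z / (1 + u z)\<close>. Adding a site convolves the moments with those of
  a rescaled Bernoulli variable, hence adds its cumulants; the constants \<open>c i\<close> are seen
  by first cumulants only.\<close>

lemma cumulant_product_measure:
  fixes u :: "'z \<Rightarrow> real" and x :: "'i \<Rightarrow> 'z \<Rightarrow> real"
  assumes "finite W" "\<And>z. u z > 0" "finite B" "B \<noteq> {}"
  shows "cumulant (\<lambda>I. (\<Sum>D\<in>Pow W. (\<Prod>z\<in>D. u z) * (\<Prod>i\<in>I. c i + (\<Sum>z\<in>D. x i z))) / (\<Prod>z\<in>W. 1 + u z)) B =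
    (if card B = 1 then \<Prod>i\<in>B. c i else 0) +
    (\<Sum>z\<in>W. cumulant (\<lambda>_. u z / (1 + u z)) B * (\<Prod>i\<in>B. x i z))"
  using assms(1)
proof (induction W rule: finite_induct)
  case empty
  then show ?case using cumulant_deterministic[OF assms(3,4), of c] by simp
next
  case (insert w W)
  let ?M = "\<lambda>W I. (\<Sum>D\<in>Pow W. (\<Prod>z\<in>D. u z) * (\<Prod>i\<in>I. c i + (\<Sum>z\<in>D. x i z))) / (\<Prod>z\<in>W. 1 + u z)"
  define p where "p = u w / (1 + u w)"
  \<comment> \<open>The moments of the new site alone. The empty product has moment 1, not
    \<open>p\<close>, because it counts the unoccupied state too.\<close>
  let ?m = "\<lambda>J. if J = {} then 1 else p * (\<Prod>i\<in>J. x i w)"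
  have u1: "1 + u w > 0" using assms(2)[of w] by simp
  have Wpos: "(\<Prod>z\<in>W. 1 + u z) > 0" using assms(2) by (intro prod_pos) (simp add: add_pos_pos)
  have conv: "?M (insert w W) I = (\<Sum>J\<in>Pow I. ?M W J * ?m (I - J))" if I: "I \<subseteq> B" for I
  proof -
    have finI: "finite I" using I assms(3) finite_subset by auto
    have D: "finite D" "w \<notin> D" if "D \<in> Pow W" for D using that insert finite_subset by auto
    have "(\<Sum>D\<in>Pow W. (\<Prod>z\<in>insert w D. u z) * (\<Prod>i\<in>I. c i + (\<Sum>z\<in>insert w D. x i z))) =
      (\<Sum>D\<in>Pow W. \<Sum>J\<in>Pow I. u w * ((\<Prod>z\<in>D. u z) * (\<Prod>i\<in>J. c i + (\<Sum>z\<in>D. x i z)) * (\<Prod>i\<in>I - J. x i w)))"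
    proof (intro sum.cong refl)
      fix D assume "D \<in> Pow W"
      note D = D[OF this]
      have "(\<Prod>i\<in>I. c i + (\<Sum>z\<in>insert w D. x i z)) = (\<Prod>i\<in>I. (c i + (\<Sum>z\<in>D. x i z)) + x i w)"
        using D by (simp add: algebra_simps)
      also have "\<dots> = (\<Sum>J\<in>Pow I. (\<Prod>i\<in>J. c i + (\<Sum>z\<in>D. x i z)) * (\<Prod>i\<in>I - J. x i w))"
        by (rule prod_add[OF finI])
      finally show "(\<Prod>z\<in>insert w D. u z) * (\<Prod>i\<in>I. c i + (\<Sum>z\<in>insert w D. x i z)) =
        (\<Sum>J\<in>Pow I. u w * ((\<Prod>z\<in>D. u z) * (\<Prod>i\<in>J. c i + (\<Sum>z\<in>D. x i z)) * (\<Prod>i\<in>I - J. x i w)))"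
        using D by (simp add: sum_distrib_left mult.assoc)
    qed
    also have "\<dots> = u w * (\<Sum>J\<in>Pow I. (\<Sum>D\<in>Pow W. (\<Prod>z\<in>D. u z) * (\<Prod>i\<in>J. c i + (\<Sum>z\<in>D. x i z))) * (\<Prod>i\<in>I - J. x i w))"
      by (subst sum.swap) (simp add: sum_distrib_left sum_distrib_right)
    finally have ins: "(\<Sum>D\<in>Pow W. (\<Prod>z\<in>insert w D. u z) * (\<Prod>i\<in>I. c i + (\<Sum>z\<in>insert w D. x i z))) =
      u w * (\<Sum>J\<in>Pow I. (\<Sum>D\<in>Pow W. (\<Prod>z\<in>D. u z) * (\<Prod>i\<in>J. c i + (\<Sum>z\<in>D. x i z))) * (\<Prod>i\<in>I - J. x i w))" .
    have "?M (insert w W) I = (1 - p) * ?M W I + p * (\<Sum>J\<in>Pow I. ?M W J * (\<Prod>i\<in>I - J. x i w))"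
    proof -
      have "?M (insert w W) I = ((\<Sum>D\<in>Pow W. (\<Prod>z\<in>D. u z) * (\<Prod>i\<in>I. c i + (\<Sum>z\<in>D. x i z))) +
          u w * (\<Sum>J\<in>Pow I. (\<Sum>D\<in>Pow W. (\<Prod>z\<in>D. u z) * (\<Prod>i\<in>J. c i + (\<Sum>z\<in>D. x i z))) * (\<Prod>i\<in>I - J. x i w)))
          / ((1 + u w) * (\<Prod>z\<in>W. 1 + u z))"
        using insert.hyps by (simp add: sum_Pow_insert ins)
      also have "\<dots> = (1 / (1 + u w)) * ?M W I + p * ((\<Sum>J\<in>Pow I. (\<Sum>D\<in>Pow W. (\<Prod>z\<in>D. u z) * (\<Prod>i\<in>J. c i + (\<Sum>z\<in>D. x i z))) * (\<Prod>i\<in>I - J. x i w)) / (\<Prod>z\<in>W. 1 + u z))"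
        unfolding p_def by (simp add: add_divide_distrib)
      also have "1 / (1 + u w) = 1 - p" using u1 by (simp add: p_def field_simps)
      moreover have "(\<Sum>J\<in>Pow I. A J * C J) / Z = (\<Sum>J\<in>Pow I. A J / Z * C J)" for A C :: "'i set \<Rightarrow> real" and Z
        by (simp add: sum_divide_distrib)
      ultimately show ?thesis by (simp only:)
    qed
    also have "(1 - p) * ?M W I = (\<Sum>J\<in>Pow I. if J = I then (1 - p) * ?M W I else 0)"
      using finI by (subst sum.delta) auto
    also have "\<dots> + p * (\<Sum>J\<in>Pow I. ?M W J * (\<Prod>i\<in>I - J. x i w)) =
        (\<Sum>J\<in>Pow I. (if J = I then (1 - p) * ?M W I else 0) + p * (?M W J * (\<Prod>i\<in>I - J. x i w)))"
      by (simp only: sum.distrib sum_distrib_left)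
    also have "\<dots> = (\<Sum>J\<in>Pow I. ?M W J * ?m (I - J))"
    proof (intro sum.cong refl)
      fix J assume "J \<in> Pow I"
      then have "I - J = {} \<longleftrightarrow> J = I" by auto
      then have g: "(if J = I then (1 - p) * Y I else 0) + p * (Y J * Q (I - J)) = Y J * (if I - J = {} then 1 else p * Q (I - J))"
        if "Q {} = 1" for Y Q :: "'i set \<Rightarrow> real" using that by (auto simp: algebra_simps)
      show "(if J = I then (1 - p) * ?M W I else 0) + p * (?M W J * (\<Prod>i\<in>I - J. x i w)) = ?M W J * ?m (I - J)"
        by (rule g[where Y = "?M W" and Q = "\<lambda>J. \<Prod>i\<in>J. x i w"]) simp
    qed
    finally show ?thesis .
  qed
  have "?M W {} = 1"
  proof -
    have "(\<Sum>D\<in>Pow W. (\<Prod>z\<in>D. u z)) = (\<Prod>z\<in>W. u z + 1)" using insert.hyps by (subst prod_add) auto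
    then show ?thesis using Wpos by (simp add: add.commute)
  qed
  have "cumulant (?M (insert w W)) B = cumulant (\<lambda>I. \<Sum>J\<in>Pow I. ?M W J * ?m (I - J)) B"
    by (rule cumulant_cong) (rule conv)
  also have "\<dots> = cumulant (?M W) B + cumulant ?m B"
    using assms \<open>?M W {} = 1\<close> by (intro cumulant_convolution) auto
  also have "cumulant ?m B = cumulant (\<lambda>J. p * (\<Prod>i\<in>J. x i w)) B" by (rule cumulant_cong) simp
  also have "\<dots> = cumulant (\<lambda>_. p) B * (\<Prod>i\<in>B. x i w)" by (rule cumulant_scale[OF assms(3)])
  finally show ?case using insert by (simp add: p_def algebra_simps)
qed

section \<open>Observables on finite sets of excitations and their convergence\<close>

definition energy :: "int set \<Rightarrow> real" where
  "energy D = (\<Sum>z\<in>D. \<bar>real_of_int z + 1/2\<bar>)"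

text \<open>A regularised power sum over the occupied positions: particles above the vacuum count
  with plus, holes below it with minus. Index 0 gives the charge and index 1 the energy.\<close>

definition charge_moment :: "nat \<Rightarrow> int set \<Rightarrow> real" where
  "charge_moment k D = (\<Sum>z\<in>D. sgn (real_of_int z + 1/2) * (real_of_int z + 1/2) ^ k)"

text \<open>Invariant under the exchange of \<open>z\<close> and \<open>- 1 - z\<close>, so the
  half-integers it represents come in pairs of opposite sign.\<close>

definition window :: "nat \<Rightarrow> int set" where "window N = {- int N..<int N}"

lemma sum_window:
  "(\<Sum>z\<in>window N. g z) = (\<Sum>n<N. g (int n) + g (- 1 - int n) :: 'a::comm_monoid_add)"
proof (induction N)
  case (Suc N)
  have "window (Suc N) = insert (int N) (insert (- 1 - int N) (window N))" by (auto simp: window_def)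
  moreover have "int N \<notin> insert (- 1 - int N) (window N)" "- 1 - int N \<notin> window N" "finite (window N)"
    by (auto simp: window_def)
  ultimately show ?case using Suc by (simp add: add_ac)
qed (simp add: window_def)

lemma finite_subset_window:
  assumes "finite W"
  shows "\<exists>N. W \<subseteq> window N"
proof -
  obtain N where "\<And>z. z \<in> W \<Longrightarrow> nat \<bar>z\<bar> < N"
    using finite_imageI[OF assms, of "\<lambda>z. nat \<bar>z\<bar>"] unfolding finite_nat_set_iff_bounded by auto
  then have "W \<subseteq> window N" by (force simp: window_def)
  then show ?thesis by blast
qed

lemma window_mono: "N \<le> N' \<Longrightarrow> window N \<subseteq> window N'" by (auto simp: window_def)

lemma exp_energy: "exp (- h * energy D) = (\<Prod>z\<in>D. exp (- h * \<bar>real_of_int z + 1/2\<bar>))" if "finite D"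
  using that by (simp add: energy_def sum_distrib_left exp_sum sum_negf[symmetric])

lemma energy_nonneg: "energy D \<ge> 0" by (auto simp: energy_def intro: sum_nonneg)

text \<open>Over the subsets of a window the sum factors into a product of terms
  \<open>1 + u z\<close>, and this is at most the exponential of the convergent sum of the
  \<open>u z\<close>.\<close>

lemma summable_exp_energy:
  assumes h: "h > 0"
  shows "(\<lambda>D. exp (- h * energy D)) summable_on {D. finite D}"
proof (rule nonneg_bdd_above_summable_on)
  define u where "u z = exp (- h * \<bar>real_of_int z + 1/2\<bar>)" for z
  define S where "S = (\<Sum>n. 2 * exp (- (h * (real n + 1/2))))"
  have sm: "summable (\<lambda>n. 2 * exp (- (h * (real n + 1/2))))"
    using summable_mult[OF summable_power_exp[OF h, of 0], of 2] by simp
  have "(\<Sum>z\<in>window N. u z) \<le> S" for N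
  proof -
    have "(\<Sum>z\<in>window N. u z) = (\<Sum>n<N. 2 * exp (- (h * (real n + 1/2))))"
      unfolding sum_window by (intro sum.cong refl) (simp add: u_def algebra_simps abs_if)
    also have "\<dots> \<le> S" unfolding S_def by (rule sum_le_suminf[OF sm]) auto
    finally show ?thesis .
  qed
  note window = this
  show "bdd_above (sum (\<lambda>D. exp (- h * energy D)) ` {F. F \<subseteq> {D. finite D} \<and> finite F})"
  proof (rule bdd_aboveI2)
    fix F :: "int set set" assume F: "F \<in> {F. F \<subseteq> {D. finite D} \<and> finite F}"
    then have "finite (\<Union>F)" by auto
    then obtain N where N: "\<Union>F \<subseteq> window N" using finite_subset_window by blast
    have fw: "finite (window N)" by (simp add: window_def)
    have "(\<Sum>D\<in>F. exp (- h * energy D)) \<le> (\<Sum>D\<in>Pow (window N). exp (- h * energy D))"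
      using F N fw by (intro sum_mono2) auto
    also have "\<dots> = (\<Sum>D\<in>Pow (window N). \<Prod>z\<in>D. u z)"
      using fw finite_subset unfolding u_def by (intro sum.cong refl exp_energy) auto
    also have "\<dots> = (\<Prod>z\<in>window N. u z + 1)" using fw by (subst prod_add) auto
    also have "\<dots> \<le> (\<Prod>z\<in>window N. exp (u z))"
      using exp_ge_add_one_self by (intro prod_mono) (auto simp: u_def add.commute add_nonneg_nonneg)
    also have "\<dots> = exp (\<Sum>z\<in>window N. u z)" using fw by (simp add: exp_sum)
    also have "\<dots> \<le> exp S" using window by simp
    finally show "(\<Sum>D\<in>F. exp (- h * energy D)) \<le> exp S" .
  qed
qed auto

text \<open>Polynomial growth in the energy: stable under sums and products, and enough for
  summability against the weight at every positive \<open>h\<close>.\<close>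

definition tame :: "(int set \<Rightarrow> real) \<Rightarrow> bool" where
  "tame X \<longleftrightarrow> (\<exists>C N. C \<ge> 0 \<and> (\<forall>D. finite D \<longrightarrow> \<bar>X D\<bar> \<le> C * (1 + energy D) ^ N))"

lemma tame_const: "tame (\<lambda>_. c)"
  unfolding tame_def by (intro exI[of _ "\<bar>c\<bar>"] exI[of _ 0]) auto

lemma tame_mult:
  assumes "tame X" "tame Y"
  shows "tame (\<lambda>D. X D * Y D)"
proof -
  obtain C N C' N' where *: "C \<ge> 0" "\<And>D. finite D \<Longrightarrow> \<bar>X D\<bar> \<le> C * (1 + energy D) ^ N"
    "C' \<ge> 0" "\<And>D. finite D \<Longrightarrow> \<bar>Y D\<bar> \<le> C' * (1 + energy D) ^ N'"
    using assms unfolding tame_def by blast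
  have "\<bar>X D * Y D\<bar> \<le> (C * C') * (1 + energy D) ^ (N + N')" if "finite D" for D
    using mult_mono[OF *(2)[OF that] *(4)[OF that]] *(1) energy_nonneg[of D]
    by (simp add: abs_mult power_add algebra_simps)
  then show ?thesis unfolding tame_def using *(1,3) by (meson mult_nonneg_nonneg)
qed

lemma tame_add:
  assumes "tame X" "tame Y"
  shows "tame (\<lambda>D. X D + Y D)"
proof -
  obtain C N C' N' where *: "C \<ge> 0" "\<And>D. finite D \<Longrightarrow> \<bar>X D\<bar> \<le> C * (1 + energy D) ^ N"
    "C' \<ge> 0" "\<And>D. finite D \<Longrightarrow> \<bar>Y D\<bar> \<le> C' * (1 + energy D) ^ N'"
    using assms unfolding tame_def by blast
  have "\<bar>X D + Y D\<bar> \<le> (C + C') * (1 + energy D) ^ (N + N')" if "finite D" for D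
  proof -
    have "C * (1 + energy D) ^ N \<le> C * (1 + energy D) ^ (N + N')"
      "C' * (1 + energy D) ^ N' \<le> C' * (1 + energy D) ^ (N + N')"
      using *(1,3) energy_nonneg[of D] by (intro mult_left_mono power_increasing; simp)+
    then show ?thesis using *(2,4)[OF that] unfolding distrib_right by linarith
  qed
  then show ?thesis unfolding tame_def using *(1,3) by (meson add_nonneg_nonneg)
qed

lemma tame_prod: "(\<And>i. i \<in> I \<Longrightarrow> tame (X i)) \<Longrightarrow> tame (\<lambda>D. \<Prod>i\<in>I. X i D)"
  by (induction I rule: infinite_finite_induct) (auto intro: tame_const tame_mult)

text \<open>No site of \<open>D\<close> is larger in modulus than the energy, and the number of
  sites is at most twice the energy because every half-integer has modulus at least 1/2.\<close>

lemma tame_charge_moment: "tame (charge_moment k)"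
proof -
  have "\<bar>charge_moment k D\<bar> \<le> 2 ^ Suc k * (1 + energy D) ^ Suc k" if D: "finite D" for D
  proof -
    have "\<bar>charge_moment k D\<bar> \<le> (\<Sum>z\<in>D. \<bar>real_of_int z + 1/2\<bar> ^ k)"
      unfolding charge_moment_def by (rule order_trans[OF sum_abs]) (auto simp: abs_mult power_abs abs_sgn_eq intro!: sum_mono)
    also have "\<dots> \<le> (\<Sum>z\<in>D. (1 + energy D) ^ k * (2 * \<bar>real_of_int z + 1/2\<bar>))"
    proof (rule sum_mono)
      fix z assume z: "z \<in> D"
      have "\<bar>real_of_int z + 1/2\<bar> \<le> energy D"
        unfolding energy_def using D z by (intro member_le_sum) auto
      then have "\<bar>real_of_int z + 1/2\<bar> ^ k \<le> (1 + energy D) ^ k" by (intro power_mono) auto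
      moreover have "1 \<le> 2 * \<bar>real_of_int z + 1/2\<bar>"
      proof -
        have "z \<ge> 0 \<or> z \<le> -1" by linarith
        then have "real_of_int z \<ge> 0 \<or> real_of_int z \<le> -1" by linarith
        then have "1/2 \<le> real_of_int z + 1/2 \<or> real_of_int z + 1/2 \<le> -1/2" by linarith
        moreover have "1 \<le> 2 * \<bar>y\<bar>" if "1/2 \<le> y \<or> y \<le> -1/2" for y :: real using that by (auto simp: abs_if)
        ultimately show ?thesis by blast
      qed
      ultimately have "\<bar>real_of_int z + 1/2\<bar> ^ k * 1 \<le> (1 + energy D) ^ k * (2 * \<bar>real_of_int z + 1/2\<bar>)"
        using energy_nonneg[of D] by (intro mult_mono) auto
      then show "\<bar>real_of_int z + 1/2\<bar> ^ k \<le> (1 + energy D) ^ k * (2 * \<bar>real_of_int z + 1/2\<bar>)" by simp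
    qed
    also have "\<dots> = 2 * ((1 + energy D) ^ k * energy D)"
      unfolding sum_distrib_left[symmetric] energy_def[symmetric] by simp
    also have "\<dots> \<le> 2 ^ Suc k * ((1 + energy D) ^ k * (1 + energy D))"
      using energy_nonneg[of D] by (intro mult_mono) auto
    finally show ?thesis by (simp add: mult.commute)
  qed
  then have "0 \<le> (2::real) ^ Suc k \<and> (\<forall>D. finite D \<longrightarrow> \<bar>charge_moment k D\<bar> \<le> 2 ^ Suc k * (1 + energy D) ^ Suc k)"
    by (intro conjI allI impI zero_le_power zero_le_numeral)
  then show ?thesis unfolding tame_def by (intro exI)
qed

lemma summable_tame:
  assumes "tame X" and h: "h > 0"
  shows "(\<lambda>D. exp (- h * energy D) * X D) summable_on {D. finite D}"
proof -
  obtain C N where C: "C \<ge> 0" "\<And>D. finite D \<Longrightarrow> \<bar>X D\<bar> \<le> C * (1 + energy D) ^ N"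
    using assms unfolding tame_def by blast
  define A where "A = C * ((2 / h) ^ N * fact N * exp (h / 2))"
  have "\<bar>exp (- h * energy D) * X D\<bar> \<le> A * exp (- (h / 2) * energy D)" if "finite D" for D
  proof -
    have eq: "2 / h * (h / 2 * (1 + energy D)) = 1 + energy D" using h by simp
    have "(1 + energy D) ^ N = (2 / h) ^ N * (h / 2 * (1 + energy D)) ^ N"
      unfolding power_mult_distrib[symmetric] eq ..
    also have "\<dots> \<le> (2 / h) ^ N * (fact N * exp (h / 2 * (1 + energy D)))"
      using h energy_nonneg[of D] by (intro mult_left_mono power_le_fact_exp) auto
    finally have 1: "C * (1 + energy D) ^ N \<le> C * ((2 / h) ^ N * (fact N * exp (h / 2 * (1 + energy D))))"
      using C(1) by (rule mult_left_mono)
    have "\<bar>exp (- h * energy D) * X D\<bar> \<le> exp (- h * energy D) * (C * ((2 / h) ^ N * (fact N * exp (h / 2 * (1 + energy D)))))"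
      using order_trans[OF C(2)[OF that] 1] by (simp add: abs_mult)
    also have "\<dots> = C * ((2 / h) ^ N * fact N) * exp (h / 2 + - (h / 2) * energy D)"
    proof -
      have "exp (- h * energy D) * exp (h / 2 * (1 + energy D)) = exp (h / 2 + - (h / 2) * energy D)"
        unfolding exp_add[symmetric] by (simp add: field_simps)
      note eq = this
      show ?thesis unfolding eq[symmetric] by (simp only: mult_ac)
    qed
    also have "\<dots> = A * exp (- (h / 2) * energy D)" unfolding exp_add A_def by (simp add: algebra_simps)
    finally show ?thesis .
  qed
  moreover have "(\<lambda>D. A * exp (- (h / 2) * energy D)) summable_on {D. finite D}"
    using h by (intro summable_on_cmult_right summable_exp_energy) simp
  ultimately have "(\<lambda>D. norm (exp (- h * energy D) * X D)) summable_on {D. finite D}"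
    by (intro Infinite_Sum.abs_summable_on_comparison_test'[of "\<lambda>D. A * exp (- (h / 2) * energy D)"]) auto
  then show ?thesis by (rule Infinite_Sum.abs_summable_summable)
qed

definition partition_function :: "real \<Rightarrow> real" where
  "partition_function h = (\<Sum>\<^sub>\<infinity>D\<in>{D. finite D}. exp (- h * energy D))"

definition grand_mean :: "real \<Rightarrow> (int set \<Rightarrow> real) \<Rightarrow> real" where
  "grand_mean h X = (\<Sum>\<^sub>\<infinity>D\<in>{D. finite D}. exp (- h * energy D) * X D) / partition_function h"

lemma partition_function_pos:
  assumes "h > 0"
  shows "partition_function h > 0"
proof -
  have "(\<Sum>\<^sub>\<infinity>D\<in>{{}}. exp (- h * energy D)) \<le> partition_function h"
    unfolding partition_function_def
    by (intro infsum_mono_neutral summable_exp_energy assms) auto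
  then show ?thesis by (simp add: energy_def)
qed

lemma grand_mean_1: "h > 0 \<Longrightarrow> grand_mean h (\<lambda>_. 1) = 1"
  using partition_function_pos[of h] by (simp add: grand_mean_def partition_function_def)

lemma grand_mean_add:
  assumes "tame X" "tame Y" "h > 0"
  shows "grand_mean h (\<lambda>D. X D + Y D) = grand_mean h X + grand_mean h Y"
  unfolding grand_mean_def distrib_left
  unfolding infsum_add[OF summable_tame[OF assms(1,3)] summable_tame[OF assms(2,3)]]
  by (rule add_divide_distrib)

lemma grand_mean_cmult: "grand_mean h (\<lambda>D. c * X D) = c * grand_mean h X"
  unfolding grand_mean_def mult.left_commute[of _ c] infsum_cmult_right' by simp

text \<open>The power sets of the windows are cofinal among the finite families of finite sets, so
  the unordered sum is a limit along windows, where the product structure is available.\<close>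

lemma window_limit:
  assumes "(f :: int set \<Rightarrow> real) summable_on {D. finite D}"
  shows "(\<lambda>N. \<Sum>D\<in>Pow (window N). f D) \<longlonglongrightarrow> (\<Sum>\<^sub>\<infinity>D\<in>{D. finite D}. f D)"
proof -
  have "(sum f \<longlongrightarrow> (\<Sum>\<^sub>\<infinity>D\<in>{D. finite D}. f D)) (finite_subsets_at_top {D. finite D})"
    using has_sum_infsum[OF assms] by (simp add: has_sum_def)
  moreover have "filterlim (\<lambda>N. Pow (window N)) (finite_subsets_at_top {D. finite D}) sequentially"
    unfolding filterlim_finite_subsets_at_top
  proof (intro allI impI)
    fix X :: "int set set" assume X: "finite X \<and> X \<subseteq> {D. finite D}"
    then have "finite (\<Union>X)" by auto
    then obtain N where N: "\<Union>X \<subseteq> window N" using finite_subset_window by blast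
    have "\<forall>\<^sub>F M in sequentially. N \<le> M" by (rule eventually_ge_at_top)
    then show "\<forall>\<^sub>F M in sequentially. finite (Pow (window M)) \<and> X \<subseteq> Pow (window M) \<and> Pow (window M) \<subseteq> {D. finite D}"
    proof eventually_elim
      case (elim M)
      have "finite (window M)" by (simp add: window_def)
      moreover have "\<Union>X \<subseteq> window M" using N window_mono[OF elim] by blast
      ultimately show ?case using finite_subset by auto
    qed
  qed
  ultimately show ?thesis by (rule filterlim_compose)
qed

lemma cumulant_tendsto:
  assumes "\<And>B. B \<subseteq> I \<Longrightarrow> ((\<lambda>N. M N B) \<longlongrightarrow> L B) F"
  shows "((\<lambda>N. cumulant (M N) I) \<longlongrightarrow> cumulant L I) F"
  unfolding cumulant_def
  by (intro tendsto_sum tendsto_mult tendsto_const tendsto_prod assms) (auto simp: partition_on_def)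

text \<open>A cumulant is a polynomial in finitely many moments, so it commutes with the limit over
  windows. The bracket collects the sites a and - a, which have equal occupation probability since
  the energy depends on the modulus only.\<close>

lemma grand_cumulant:
  assumes "finite B" "B \<noteq> {}" and h: "h > 0"
  shows "cumulant (\<lambda>I. grand_mean h (\<lambda>D. \<Prod>i\<in>I. c i + charge_moment (k i) D)) B =
    (if card B = 1 then \<Prod>i\<in>B. c i else 0) +
    (\<Sum>n. ((real n + 1/2) ^ (\<Sum>i\<in>B. k i) + (-1) ^ card B * (- (real n + 1/2)) ^ (\<Sum>i\<in>B. k i)) *
      cumulant (\<lambda>_. fermi (h * (real n + 1/2))) B)"
proof -
  define u where "u z = exp (- h * \<bar>real_of_int z + 1/2\<bar>)" for z
  define x where "x i z = sgn (real_of_int z + 1/2) * (real_of_int z + 1/2) ^ k i" for i z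
  define M where "M N I = (\<Sum>D\<in>Pow (window N). (\<Prod>z\<in>D. u z) * (\<Prod>i\<in>I. c i + (\<Sum>z\<in>D. x i z))) / (\<Prod>z\<in>window N. 1 + u z)" for N I
  define t where "t n = ((real n + 1/2) ^ (\<Sum>i\<in>B. k i) + (-1) ^ card B * (- (real n + 1/2)) ^ (\<Sum>i\<in>B. k i)) *
      cumulant (\<lambda>_. fermi (h * (real n + 1/2))) B" for n
  have fw: "finite (window N)" for N by (simp add: window_def)
  have uD: "(\<Prod>z\<in>D. u z) = exp (- h * energy D)" if "D \<in> Pow (window N)" for D N
    using that finite_subset[OF _ fw] unfolding u_def by (intro exp_energy[symmetric]) auto
  have Z: "(\<lambda>N. \<Prod>z\<in>window N. 1 + u z) \<longlonglongrightarrow> partition_function h"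
  proof -
    have "(\<Prod>z\<in>window N. 1 + u z) = (\<Sum>D\<in>Pow (window N). exp (- h * energy D))" for N
    proof -
      have "(\<Sum>D\<in>Pow (window N). exp (- h * energy D)) = (\<Sum>D\<in>Pow (window N). \<Prod>z\<in>D. u z)"
        using uD by (intro sum.cong refl) simp
      also have "\<dots> = (\<Prod>z\<in>window N. u z + 1)" using fw by (subst prod_add) auto
      finally show ?thesis by (simp add: add.commute)
    qed
    then show ?thesis using window_limit[OF summable_exp_energy[OF h]] by (simp add: partition_function_def)
  qed
  have tm: "tame (\<lambda>D. \<Prod>i\<in>I. c i + charge_moment (k i) D)" for I
    by (intro tame_prod tame_add tame_const tame_charge_moment)
  have lim: "(\<lambda>N. M N I) \<longlonglongrightarrow> grand_mean h (\<lambda>D. \<Prod>i\<in>I. c i + charge_moment (k i) D)" for I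
  proof -
    have "(\<Sum>D\<in>Pow (window N). (\<Prod>z\<in>D. u z) * (\<Prod>i\<in>I. c i + (\<Sum>z\<in>D. x i z))) =
        (\<Sum>D\<in>Pow (window N). exp (- h * energy D) * (\<Prod>i\<in>I. c i + charge_moment (k i) D))" for N
      using uD by (intro sum.cong refl) (simp add: charge_moment_def x_def)
    then show ?thesis unfolding M_def grand_mean_def
      using partition_function_pos[OF h]
      by (simp only:) (intro tendsto_divide Z window_limit summable_tame tm h, simp)
  qed
  have 1: "(\<lambda>N. cumulant (M N) B) \<longlonglongrightarrow> cumulant (\<lambda>I. grand_mean h (\<lambda>D. \<Prod>i\<in>I. c i + charge_moment (k i) D)) B"
    by (rule cumulant_tendsto) (rule lim)
  have fermi: "u z / (1 + u z) = fermi (h * \<bar>real_of_int z + 1/2\<bar>)" for z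
  proof -
    have "exp (- y) / (1 + exp (- y)) = fermi y" for y :: real
    proof -
      have "1 + exp y \<noteq> 0" "exp y + 1 \<noteq> 0" using exp_gt_zero[of y] by linarith+
      then show ?thesis by (simp add: fermi_def exp_minus divide_simps)
    qed
    then show ?thesis by (simp only: u_def mult_minus_left)
  qed
  have "cumulant (M N) B = (if card B = 1 then \<Prod>i\<in>B. c i else 0) + (\<Sum>n<N. t n)" for N
  proof -
    have "cumulant (M N) B = (if card B = 1 then \<Prod>i\<in>B. c i else 0) +
        (\<Sum>z\<in>window N. cumulant (\<lambda>_. u z / (1 + u z)) B * (\<Prod>i\<in>B. x i z))"
      unfolding M_def[abs_def] by (rule cumulant_product_measure[OF fw _ assms(1,2)]) (simp add: u_def)
    also have "(\<Sum>z\<in>window N. cumulant (\<lambda>_. u z / (1 + u z)) B * (\<Prod>i\<in>B. x i z)) = (\<Sum>n<N. t n)"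
      unfolding sum_window
    proof (intro sum.cong refl)
      fix n
      have a: "real_of_int (- 1 - int n) + 1/2 = - (real n + 1/2)" "real_of_int (int n) + 1/2 = real n + 1/2" by simp_all
      have f: "u (int n) / (1 + u (int n)) = fermi (h * (real n + 1/2))" "u (- 1 - int n) / (1 + u (- 1 - int n)) = fermi (h * (real n + 1/2))"
        unfolding fermi a by (simp_all add: add.commute)
      have s: "sgn (real n + 1/2) = 1" "sgn (- (real n + 1/2)) = -1" by (simp_all add: sgn_if)
      have x1: "x i (int n) = (real n + 1/2) ^ k i" for i unfolding x_def a s by simp
      have x2: "x i (- 1 - int n) = (-1) * (- (real n + 1/2)) ^ k i" for i unfolding x_def a s by simp
      have p1: "(\<Prod>i\<in>B. x i (int n)) = (real n + 1/2) ^ (\<Sum>i\<in>B. k i)"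
        unfolding x1 by (simp add: power_sum)
      have p2: "(\<Prod>i\<in>B. x i (- 1 - int n)) = (-1) ^ card B * (- (real n + 1/2)) ^ (\<Sum>i\<in>B. k i)"
        unfolding x2 prod.distrib by (simp add: power_sum)
      show "cumulant (\<lambda>_. u (int n) / (1 + u (int n))) B * (\<Prod>i\<in>B. x i (int n)) +
          cumulant (\<lambda>_. u (- 1 - int n) / (1 + u (- 1 - int n))) B * (\<Prod>i\<in>B. x i (- 1 - int n)) = t n"
        unfolding f p1 p2 t_def by (simp only: distrib_left distrib_right mult.commute)
    qed
    finally show ?thesis .
  qed
  moreover have "(\<lambda>N. (if card B = 1 then \<Prod>i\<in>B. c i else 0) + (\<Sum>n<N. t n)) \<longlonglongrightarrow> (if card B = 1 then \<Prod>i\<in>B. c i else 0) + (\<Sum>n. t n)"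
    unfolding t_def by (intro tendsto_add tendsto_const summable_LIMSEQ summable_site_cumulants assms)
  ultimately have "(\<lambda>N. cumulant (M N) B) \<longlonglongrightarrow> (if card B = 1 then \<Prod>i\<in>B. c i else 0) + (\<Sum>n. t n)" by simp
  from LIMSEQ_unique[OF 1 this] show ?thesis unfolding t_def .
qed

theorem grand_cumulant_degree:
  assumes "finite B" "B \<noteq> {}"
  shows "h_degree_le (\<lambda>h. cumulant (\<lambda>I. grand_mean h (\<lambda>D. \<Prod>i\<in>I. c i + charge_moment (k i) D)) B)
    (Suc (\<Sum>i\<in>B. k i))"
proof (rule h_degree_le_cong)
  show "h_degree_le (\<lambda>h. (if card B = 1 then \<Prod>i\<in>B. c i else 0) +
    (\<Sum>n. ((real n + 1/2) ^ (\<Sum>i\<in>B. k i) + (-1) ^ card B * (- (real n + 1/2)) ^ (\<Sum>i\<in>B. k i)) *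
      cumulant (\<lambda>_. fermi (h * (real n + 1/2))) B)) (Suc (\<Sum>i\<in>B. k i))"
    by (intro h_degree_le_add h_degree_le_const h_degree_le_site_cumulants assms)
qed (rule grand_cumulant[OF assms, symmetric])

section \<open>Maya diagrams\<close>


text \<open>Once the earlier terms agree, the next term of either sequence is the largest value of
  the common range that remains.\<close>

lemma strict_decreasing_unique:
  fixes s t :: "nat \<Rightarrow> int"
  assumes s: "\<And>i j. i < j \<Longrightarrow> s j < s i" and t: "\<And>i j. i < j \<Longrightarrow> t j < t i"
    and "range s = range t"
  shows "s = t"
proof
  have le: "a i \<le> b i" if a: "\<And>i j. i < j \<Longrightarrow> a j < a i" and b: "\<And>i j. i < j \<Longrightarrow> b j < b i"
    and r: "range a = range b" and eq: "\<And>j. j < i \<Longrightarrow> a j = b j" for a b :: "nat \<Rightarrow> int" and i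
  proof -
    have "a i \<in> range b" using r by blast
    then obtain j where j: "a i = b j" by blast
    have "\<not> j < i"
    proof
      assume "j < i"
      then show False using a[of j i] eq[of j] j by simp
    qed
    then show ?thesis using b[of i j] j by (cases "i = j") auto
  qed
  fix i
  show "s i = t i"
  proof (induction i rule: less_induct)
    case (less i)
    show ?case using le[of s t i, OF s t assms(3)] le[of t s i, OF t s assms(3)[symmetric]] less by fastforce
  qed
qed

text \<open>The position of the \<open>i\<close>-th particle of the Maya diagram of the partition \<open>lam\<close> with
  charge \<open>c\<close>; the site \<open>z\<close> stands for the half-integer \<open>z + 1/2\<close>.\<close>
definition maya :: "(nat \<Rightarrow> nat) \<Rightarrow> int \<Rightarrow> nat \<Rightarrow> int" where
  "maya lam c i = int (lam i) - int i - 1 + c"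

text \<open>The sites at which the Maya diagram differs from the vacuum.\<close>
definition excitations :: "(nat \<Rightarrow> nat) \<Rightarrow> int \<Rightarrow> int set" where
  "excitations lam c = (range (maya lam c) - {..<0}) \<union> ({..<0} - range (maya lam c))"

lemma int_partitions_bounded:
  assumes "lam \<in> int_partitions"
  shows "\<exists>L. \<forall>i\<ge>L. lam i = 0"
proof -
  obtain L where L: "\<And>i. lam i \<noteq> 0 \<Longrightarrow> i < L"
    using assms unfolding int_partitions_def finite_nat_set_iff_bounded by auto
  then have "\<forall>i\<ge>L. lam i = 0" by (meson not_le)
  then show ?thesis by blast
qed

lemma maya_decreasing:
  assumes "lam \<in> int_partitions" "i < j"
  shows "maya lam c j < maya lam c i"
proof -
  have "lam j \<le> lam i" using assms by (auto simp: int_partitions_def antimono_def)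
  then show ?thesis using assms(2) by (simp add: maya_def)
qed

lemma range_maya:
  assumes "lam \<in> int_partitions" "\<forall>i\<ge>L. lam i = 0"
  shows "range (maya lam c) = maya lam c ` {..<L} \<union> {..<c - int L}"
    "maya lam c ` {..<L} \<subseteq> {c - int L..}"
proof -
  have far: "maya lam c i = c - 1 - int i" if "i \<ge> L" for i using assms(2) that by (simp add: maya_def)
  show "maya lam c ` {..<L} \<subseteq> {c - int L..}" by (auto simp: maya_def)
  have "maya lam c ` {L..} = {..<c - int L}"
  proof
    show "maya lam c ` {L..} \<subseteq> {..<c - int L}" using far by auto
    show "{..<c - int L} \<subseteq> maya lam c ` {L..}"
    proof
      fix z assume "z \<in> {..<c - int L}"
      then have "nat (c - 1 - z) \<ge> L" "z = c - 1 - int (nat (c - 1 - z))" by auto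
      then show "z \<in> maya lam c ` {L..}" using far[of "nat (c - 1 - z)"] by (intro image_eqI) auto
    qed
  qed
  moreover have "UNIV = {..<L} \<union> {L..}" by auto
  ultimately show "range (maya lam c) = maya lam c ` {..<L} \<union> {..<c - int L}"
    by (metis image_Un)
qed

text \<open>Below \<open>c - int L\<close> the diagram and the vacuum are both completely filled.
  The signed sum over their difference is therefore the sum over the first \<open>L\<close>
  particles minus the sum over the vacuum positions from \<open>c - int L\<close> up; positions
  occupied in both cancel.\<close>

lemma sum_excitations:
  fixes \<phi> :: "int \<Rightarrow> real"
  assumes lam: "lam \<in> int_partitions" "\<forall>i\<ge>L. lam i = 0" and L: "c \<le> int L"
  shows "finite (excitations lam c)"
    "(\<Sum>z\<in>excitations lam c. sgn (real_of_int z + 1/2) * \<phi> z) =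
     (\<Sum>i<L. \<phi> (maya lam c i)) - (\<Sum>i<nat (int L - c). \<phi> (- 1 - int i))"
proof -
  define A where "A = maya lam c ` {..<L}"
  define N where "N = {c - int L..<0}"
  note r = range_maya[OF lam, of c]
  have ex: "excitations lam c = (A - N) \<union> (N - A)"
  proof -
    have "range (maya lam c) = A \<union> {..<c - int L}" "A \<subseteq> {c - int L..}" using r by (auto simp: A_def)
    then show ?thesis using L unfolding excitations_def N_def by (auto simp: subset_iff)
  qed
  have fin: "finite A" "finite N" by (simp_all add: A_def N_def)
  then show "finite (excitations lam c)" by (simp add: ex)
  have sA: "sgn (real_of_int z + 1/2) = 1" if "z \<in> A - N" for z
  proof -
    have "z \<ge> 0" using that r(2) by (auto simp: A_def N_def)
    then show ?thesis by simp
  qed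
  have sN: "sgn (real_of_int z + 1/2) = -1" if "z \<in> N - A" for z
  proof -
    have "z \<le> -1" using that by (auto simp: N_def)
    then have "real_of_int z \<le> -1" by linarith
    then show ?thesis by (simp add: sgn_if)
  qed
  have "(\<Sum>z\<in>excitations lam c. sgn (real_of_int z + 1/2) * \<phi> z) = (\<Sum>z\<in>A - N. \<phi> z) + (\<Sum>z\<in>N - A. - \<phi> z)"
    unfolding ex using fin sA sN by (subst sum.union_disjoint) (auto intro!: arg_cong2[where f="(+)"] sum.cong)
  also have "\<dots> = sum \<phi> A - sum \<phi> N"
    using fin sum.Int_Diff[of A \<phi> N] sum.Int_Diff[of N \<phi> A] by (simp add: sum_negf Int_commute)
  also have "sum \<phi> A = (\<Sum>i<L. \<phi> (maya lam c i))"
  proof -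
    have "inj_on (maya lam c) {..<L}"
    proof (rule inj_onI)
      fix i j assume "maya lam c i = maya lam c j"
      then show "i = j" using maya_decreasing[OF lam(1), of i j c] maya_decreasing[OF lam(1), of j i c] by (cases i j rule: linorder_cases) auto
    qed
    then show ?thesis by (simp add: A_def sum.reindex)
  qed
  also have "sum \<phi> N = (\<Sum>i<nat (int L - c). \<phi> (- 1 - int i))"
    by (rule sum.reindex_bij_witness[of _ "\<lambda>i. - 1 - int i" "\<lambda>z. nat (- 1 - z)"]) (auto simp: N_def)
  finally show "(\<Sum>z\<in>excitations lam c. sgn (real_of_int z + 1/2) * \<phi> z) =
     (\<Sum>i<L. \<phi> (maya lam c i)) - (\<Sum>i<nat (int L - c). \<phi> (- 1 - int i))" .
qed

text \<open>The occupied sites are read downwards from \<open>int N - 1\<close>, and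
  \<open>e i\<close> is the depth of the \<open>i\<close>-th particle. The excess \<open>v i\<close>
  of that particle is weakly decreasing and constant from \<open>2 * N\<close> on, where every site
  is occupied; its final value is the charge, and what exceeds it is the partition.\<close>

lemma excitations_surj:
  assumes "finite D"
  shows "\<exists>lam\<in>int_partitions. \<exists>c. excitations lam c = D"
proof -
  obtain N where N: "D \<subseteq> window N" using finite_subset_window[OF assms] by blast
  define S where "S = (D - {..<0}) \<union> ({..<0} - D)"
  have S1: "z \<in> S" if "z < - int N" for z using that N by (auto simp: S_def window_def)
  have S2: "z < int N" if "z \<in> S" for z using that N by (auto simp: S_def window_def)
  define T where "T = {n. int N - 1 - int n \<in> S}"
  have far: "n \<in> T" if "n \<ge> 2 * N" for n using that S1 by (auto simp: T_def)
  have inf: "infinite T"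
  proof
    assume "finite T"
    then obtain M where "\<And>n. n \<in> T \<Longrightarrow> n < M" unfolding finite_nat_set_iff_bounded by auto
    then show False using far[of "max M (2 * N)"] by fastforce
  qed
  define e where "e = enumerate T"
  have emono: "e i < e (Suc i)" for i unfolding e_def using enumerate_mono[OF _ inf] by simp
  have enext: "e (Suc i) = Suc (e i)" if "i \<ge> 2 * N" for i
    unfolding e_def enumerate_Suc''[OF inf]
  proof (rule Least_equality)
    have "i \<le> enumerate T i" by (rule le_enumerate[OF inf])
    then show "Suc (enumerate T i) \<in> T \<and> enumerate T i < Suc (enumerate T i)" using that far by simp
  qed auto
  define v where "v i = int N + int i - int (e i)" for i
  have vmono: "v (Suc i) \<le> v i" for i using emono[of i] by (simp add: v_def)
  then have vanti: "v j \<le> v i" if "i \<le> j" for i j using lift_Suc_antimono_le[of v i j] that by blast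
  have vconst: "v i = v (2 * N)" if "i \<ge> 2 * N" for i
    using that by (induction i rule: dec_induct) (auto simp: v_def enext)
  define c where "c = v (2 * N)"
  have vc: "c \<le> v i" for i
    using vanti[of i "2 * N"] vconst[of i] by (cases "i \<le> 2 * N") (auto simp: c_def)
  define lam where "lam i = nat (v i - c)" for i
  have "lam \<in> int_partitions"
  proof -
    have "antimono lam" using vanti by (auto simp: antimono_def lam_def intro!: nat_mono)
    moreover have "{i. lam i \<noteq> 0} \<subseteq> {..<2 * N}"
    proof
      fix i assume "i \<in> {i. lam i \<noteq> 0}"
      then show "i \<in> {..<2 * N}" using vconst[of i] by (cases "i < 2 * N") (auto simp: lam_def c_def)
    qed
    ultimately show ?thesis by (auto simp: int_partitions_def intro: finite_subset)
  qed
  moreover have "excitations lam c = D"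
  proof -
    have m: "maya lam c i = int N - 1 - int (e i)" for i using vc[of i] by (simp add: maya_def lam_def) (simp add: v_def)
    have "range (maya lam c) = S"
    proof
      show "range (maya lam c) \<subseteq> S"
      proof
        fix z assume "z \<in> range (maya lam c)"
        then obtain i where "z = int N - 1 - int (e i)" using m by auto
        moreover have "e i \<in> T" unfolding e_def by (rule enumerate_in_set[OF inf])
        ultimately show "z \<in> S" by (simp add: T_def)
      qed
      show "S \<subseteq> range (maya lam c)"
      proof
        fix z assume z: "z \<in> S"
        then have "nat (int N - 1 - z) \<in> T" "z = int N - 1 - int (nat (int N - 1 - z))" using S2[OF z] by (auto simp: T_def)
        moreover from this obtain i where "e i = nat (int N - 1 - z)" unfolding e_def using enumerate_Ex[OF inf] by blast
        ultimately have "z = maya lam c i" unfolding m by simp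
        then show "z \<in> range (maya lam c)" by blast
      qed
    qed
    then show ?thesis unfolding excitations_def S_def by auto
  qed
  ultimately show ?thesis by blast
qed

text \<open>Taking the symmetric difference with the vacuum once more recovers the occupied sites,
  hence the whole sequence; its tail, where both partitions vanish, reveals the charge.\<close>

lemma excitations_inj:
  assumes "lam \<in> int_partitions" "mu \<in> int_partitions" "excitations lam c = excitations mu d"
  shows "lam = mu \<and> c = d"
proof -
  have recover: "range (maya nu b) = (excitations nu b - {..<0}) \<union> ({..<0} - excitations nu b)" for nu b
    by (auto simp: excitations_def)
  have "range (maya lam c) = range (maya mu d)" unfolding recover assms(3) ..
  then have eq: "maya lam c = maya mu d"
    by (intro strict_decreasing_unique maya_decreasing assms)
  obtain L L' where L: "\<forall>i\<ge>L. lam i = 0" "\<forall>i\<ge>L'. mu i = 0"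
    using int_partitions_bounded assms by metis
  have "maya lam c (max L L') = maya mu d (max L L')" using eq by simp
  then have "c = d" using L by (simp add: maya_def)
  moreover have "lam = mu"
  proof
    fix i
    have "maya lam c i = maya mu d i" using eq by simp
    then show "lam i = mu i" using \<open>c = d\<close> by (simp add: maya_def)
  qed
  ultimately show ?thesis by simp
qed

lemma bij_betw_excitations:
  "bij_betw (\<lambda>(lam, c). excitations lam c) (int_partitions \<times> UNIV) {D. finite D}"
  unfolding bij_betw_def
proof
  show "inj_on (\<lambda>(lam, c). excitations lam c) (int_partitions \<times> UNIV)"
    using excitations_inj by (auto simp: inj_on_def)
  show "(\<lambda>(lam, c). excitations lam c) ` (int_partitions \<times> UNIV) = {D. finite D}"
  proof
    have "finite (excitations lam c)" if lam: "lam \<in> int_partitions" for lam c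
    proof -
      obtain L where L: "\<forall>i\<ge>L. lam i = 0" using int_partitions_bounded[OF lam] by blast
      then show ?thesis using sum_excitations(1)[OF lam, of "max L (nat c)" c] by simp
    qed
    then show "(\<lambda>(lam, c). excitations lam c) ` (int_partitions \<times> UNIV) \<subseteq> {D. finite D}" by auto
    show "{D. finite D} \<subseteq> (\<lambda>(lam, c). excitations lam c) ` (int_partitions \<times> UNIV)"
      using excitations_surj by fastforce
  qed
qed

text \<open>The difference of the monomial of degree \<open>Suc k\<close> is a multiple of
  \<open>x ^ k\<close> plus lower powers, which are removed by the antidifferences already
  constructed.\<close>

lemma power_antidifference:
  "\<exists>R :: real poly. degree R \<le> Suc k \<and> (\<forall>x. poly R (x + 1) - poly R x = x ^ k)"
proof (induction k rule: less_induct)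
  case (less k)
  have "\<forall>j\<in>{..<k}. \<exists>R :: real poly. degree R \<le> Suc j \<and> (\<forall>x. poly R (x + 1) - poly R x = x ^ j)"
    using less by simp
  then obtain R :: "nat \<Rightarrow> real poly" where R: "\<And>j. j < k \<Longrightarrow> degree (R j) \<le> Suc j"
    "\<And>j x. j < k \<Longrightarrow> poly (R j) (x + 1) - poly (R j) x = x ^ j"
    by (metis lessThan_iff)
  define Q where "Q = monom 1 (Suc k) - (\<Sum>j<k. smult (real (Suc k choose j)) (R j))"
  have "degree Q \<le> Suc k" unfolding Q_def
  proof (intro degree_diff_le degree_sum_le degree_monom_le)
    fix j assume "j \<in> {..<k}"
    then show "degree (smult (real (Suc k choose j)) (R j)) \<le> Suc k"
      using R(1)[of j] degree_smult_le[of "real (Suc k choose j)" "R j"] by simp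
  qed simp
  moreover have "poly Q (x + 1) - poly Q x = real (Suc k) * x ^ k" for x
  proof -
    have "(x + 1) ^ Suc k = (\<Sum>j\<le>Suc k. real (Suc k choose j) * x ^ j)"
      using binomial_ring[of x 1 "Suc k"] by simp
    also have "{..Suc k} = insert (Suc k) (insert k {..<k})" by auto
    finally have b: "(x + 1) ^ Suc k = x ^ Suc k + (real (Suc k) * x ^ k + (\<Sum>j<k. real (Suc k choose j) * x ^ j))"
      by (simp del: power_Suc)
    have "poly Q (x + 1) - poly Q x = (x + 1) ^ Suc k - x ^ Suc k -
        (\<Sum>j<k. real (Suc k choose j) * (poly (R j) (x + 1) - poly (R j) x))"
      unfolding Q_def by (simp add: poly_sum poly_monom sum_subtractf right_diff_distrib del: power_Suc)
    also have "(\<Sum>j<k. real (Suc k choose j) * (poly (R j) (x + 1) - poly (R j) x)) = (\<Sum>j<k. real (Suc k choose j) * x ^ j)"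
      using R(2) by (intro sum.cong) auto
    finally show ?thesis using b by simp
  qed
  moreover have "degree (smult (1 / real (Suc k)) Q) \<le> Suc k" using calculation(1) by simp
  ultimately show ?case
    by (intro exI[of _ "smult (1 / real (Suc k)) Q"]) (auto simp: right_diff_distrib[symmetric] diff_divide_distrib[symmetric])
qed

text \<open>With \<open>Q0\<close> an antidifference of \<open>(- x - 1/2) ^ k\<close>, both sums
  telescope. They end at the same point, because the second has \<open>L - c\<close> terms and
  starts at \<open>c\<close>; so the cutoff drops out and \<open>Q0\<close> at \<open>c\<close>
  minus \<open>Q0\<close> at 0 remains.\<close>

lemma vacuum_shift:
  "\<exists>Q :: real poly. degree Q \<le> Suc k \<and> poly Q 0 = 0 \<and>
    (\<forall>c L. c \<le> int L \<longrightarrow> (\<Sum>i<L. (- real i - 1/2) ^ k) -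
      (\<Sum>i<nat (int L - c). (- real i - 1/2 - real_of_int c) ^ k) = poly Q (real_of_int c))"
proof -
  obtain R :: "real poly" where R: "degree R \<le> Suc k" "\<And>x. poly R (x + 1) - poly R x = x ^ k"
    using power_antidifference by blast
  define Q0 where "Q0 = smult ((-1) ^ k) (pcompose R [:1/2, 1:])"
  define Q where "Q = Q0 - [:poly Q0 0:]"
  have Q0: "poly Q0 (x + 1) - poly Q0 x = (- x - 1/2) ^ k" for x
  proof -
    have "poly Q0 (x + 1) - poly Q0 x = (-1) ^ k * (poly R ((x + 1/2) + 1) - poly R (x + 1/2))"
      unfolding Q0_def by (simp add: poly_pcompose right_diff_distrib add_ac)
    also have "\<dots> = (- 1 * (x + 1/2)) ^ k" unfolding R(2) by (simp only: power_mult_distrib)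
    finally show ?thesis by simp
  qed
  have tel: "(\<Sum>i<N. (- real i - 1/2 - y) ^ k) = poly Q0 (real N + y) - poly Q0 y" for N y
  proof (induction N)
    case (Suc N)
    have "(- real N - 1/2 - y) ^ k = poly Q0 ((real N + y) + 1) - poly Q0 (real N + y)"
    proof -
      have "- real N - 1/2 - y = - (real N + y) - 1/2" by simp
      then show ?thesis unfolding Q0 by (simp only:)
    qed
    then show ?case using Suc by (simp add: algebra_simps)
  qed simp
  show ?thesis
  proof (intro exI[of _ Q] conjI allI impI)
    have "degree Q0 \<le> Suc k" unfolding Q0_def using R(1) degree_pcompose_le[of R "[:1/2, 1:]"] by simp
    then show "degree Q \<le> Suc k" unfolding Q_def by (intro degree_diff_le) auto
    show "poly Q 0 = 0" by (simp add: Q_def)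
    fix c L assume "c \<le> int L"
    then have "real (nat (int L - c)) + real_of_int c = real L" by simp
    then show "(\<Sum>i<L. (- real i - 1/2) ^ k) - (\<Sum>i<nat (int L - c). (- real i - 1/2 - real_of_int c) ^ k) = poly Q (real_of_int c)"
    proof -
      have "(\<Sum>i<L. (- real i - 1/2) ^ k) = poly Q0 (real L) - poly Q0 0" by (rule tel[where N = L and y = 0, unfolded diff_zero add_0_right])
      then show ?thesis unfolding tel using \<open>_ = real L\<close> by (simp add: Q_def)
    qed
  qed
qed

lemma suminf_partition:
  assumes "\<forall>i\<ge>L. lam i = (0::nat)" "\<And>i. g i 0 = (0::real)"
  shows "(\<Sum>i. g i (lam i)) = (\<Sum>i<L. g i (lam i))"
  using assms by (intro suminf_finite) (auto simp: not_less)

text \<open>The energy is the first signed moment. Beyond the size of the partition, the cut-off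
  sums leave L c - L^2/2 + (L - c)^2/2, which is c^2/2 for every cutoff L.\<close>

lemma energy_excitations:
  assumes lam: "lam \<in> int_partitions"
  shows "charge_moment 0 (excitations lam c) = real_of_int c"
    "energy (excitations lam c) = real (psize lam) + (real_of_int c)\<^sup>2 / 2"
proof -
  obtain L0 where L0: "\<forall>i\<ge>L0. lam i = 0" using int_partitions_bounded[OF lam] by blast
  define L where "L = max L0 (nat c)"
  have L: "\<forall>i\<ge>L. lam i = 0" "c \<le> int L" using L0 by (auto simp: L_def)
  have n: "real (nat (int L - c)) = real L - real_of_int c" using L by simp
  show "charge_moment 0 (excitations lam c) = real_of_int c"
    unfolding charge_moment_def using sum_excitations(2)[OF lam L, of "\<lambda>_. 1"] n by simp
  have tri: "(\<Sum>i<N. real i + 1/2) = (real N)\<^sup>2 / 2" for N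
    by (induction N) (auto simp: power2_eq_square field_simps)
  have "energy (excitations lam c) = (\<Sum>z\<in>excitations lam c. sgn (real_of_int z + 1/2) * (real_of_int z + 1/2))"
    unfolding energy_def by (intro sum.cong refl) (simp add: abs_sgn mult.commute)
  also have "\<dots> = (\<Sum>i<L. real_of_int (maya lam c i) + 1/2) - (\<Sum>i<nat (int L - c). real_of_int (- 1 - int i) + 1/2)"
    by (rule sum_excitations(2)[OF lam L])
  also have "(\<Sum>i<L. real_of_int (maya lam c i) + 1/2) = (\<Sum>i<L. real (lam i) + real_of_int c - (real i + 1/2))"
    by (intro sum.cong refl) (simp add: maya_def)
  also have "\<dots> = (\<Sum>i<L. real (lam i)) + real L * real_of_int c - (real L)\<^sup>2 / 2"
    by (simp add: sum.distrib sum_subtractf tri[symmetric])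
  also have "(\<Sum>i<nat (int L - c). real_of_int (- 1 - int i) + 1/2) = (\<Sum>i<nat (int L - c). - (real i + 1/2))"
    by (intro sum.cong refl) simp
  also have "\<dots> = - ((real L - real_of_int c)\<^sup>2 / 2)" unfolding sum_negf tri n ..
  also have "(\<Sum>i<L. real (lam i)) = real (psize lam)"
  proof -
    have "{i. lam i \<noteq> 0} \<subseteq> {..<L}" using L(1) by (auto simp: not_less[symmetric])
    then have "(\<Sum>i | lam i \<noteq> 0. lam i) = (\<Sum>i<L. lam i)" by (intro sum.mono_neutral_left) auto
    then show ?thesis by (simp add: psize_def)
  qed
  finally show "energy (excitations lam c) = real (psize lam) + (real_of_int c)\<^sup>2 / 2"
    by (simp add: power2_eq_square algebra_simps add_divide_distrib diff_divide_distrib)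
qed

text \<open>Subtracting \<open>c\<close> from every position, by the binomial theorem, removes the
  charge from the particles but moves the subtracted vacuum by \<open>c\<close>; \<open>Q\<close>
  corrects for the moved vacuum. Only the right-hand side involves \<open>c\<close>, which may be
  chosen freely.\<close>

lemma psum_excitations:
  "\<exists>Q :: real poly. degree Q \<le> Suc k \<and> poly Q 0 = 0 \<and> (\<forall>lam\<in>int_partitions. \<forall>c.
     psum k lam = (\<Sum>j\<le>k. real (k choose j) * (- real_of_int c) ^ (k - j) * charge_moment j (excitations lam c))
       - poly Q (real_of_int c) + (1 - 1 / 2 ^ k) * Re (riemann_zeta (- of_nat k)))"
proof -
  obtain Q :: "real poly" where Q: "degree Q \<le> Suc k" "poly Q 0 = 0"
    "\<And>c L. c \<le> int L \<Longrightarrow> (\<Sum>i<L. (- real i - 1/2) ^ k) -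
      (\<Sum>i<nat (int L - c). (- real i - 1/2 - real_of_int c) ^ k) = poly Q (real_of_int c)"
    using vacuum_shift[of k] by blast
  have "psum k lam = (\<Sum>j\<le>k. real (k choose j) * (- real_of_int c) ^ (k - j) * charge_moment j (excitations lam c))
       - poly Q (real_of_int c) + (1 - 1 / 2 ^ k) * Re (riemann_zeta (- of_nat k))"
    if lam: "lam \<in> int_partitions" for lam c
  proof -
    obtain L0 where L0: "\<forall>i\<ge>L0. lam i = 0" using int_partitions_bounded[OF lam] by blast
    define L where "L = max L0 (nat c)"
    have L: "\<forall>i\<ge>L. lam i = 0" "c \<le> int L" using L0 by (auto simp: L_def)
    let ?x = "\<lambda>z. real_of_int z + 1/2"
    have "(\<Sum>j\<le>k. real (k choose j) * (- real_of_int c) ^ (k - j) * charge_moment j (excitations lam c)) =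
        (\<Sum>z\<in>excitations lam c. sgn (?x z) * (?x z + - real_of_int c) ^ k)"
    proof -
      have b: "(?x z + - real_of_int c) ^ k = (\<Sum>j\<le>k. real (k choose j) * ?x z ^ j * (- real_of_int c) ^ (k - j))" for z
        by (rule binomial_ring)
      show ?thesis unfolding charge_moment_def b sum_distrib_left
        by (subst sum.swap) (simp only: mult_ac)
    qed
    also have "\<dots> = (\<Sum>i<L. (?x (maya lam c i) + - real_of_int c) ^ k) -
        (\<Sum>i<nat (int L - c). (?x (- 1 - int i) + - real_of_int c) ^ k)"
      by (rule sum_excitations(2)[OF lam L])
    also have "(\<Sum>i<L. (?x (maya lam c i) + - real_of_int c) ^ k) = (\<Sum>i<L. (real (lam i) - real (Suc i) + 1/2) ^ k)"
      by (intro sum.cong refl arg_cong[where f = "\<lambda>x. x ^ k"]) (simp add: maya_def)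
    also have "(\<Sum>i<nat (int L - c). (?x (- 1 - int i) + - real_of_int c) ^ k) =
        (\<Sum>i<nat (int L - c). (- real i - 1/2 - real_of_int c) ^ k)"
      by (intro sum.cong refl arg_cong[where f = "\<lambda>x. x ^ k"]) simp
    also have "\<dots> = (\<Sum>i<L. (- real i - 1/2) ^ k) - poly Q (real_of_int c)" using Q(3)[OF L(2)] by simp
    also have "(\<Sum>i<L. (- real i - 1/2) ^ k) = (\<Sum>i<L. (- real (Suc i) + 1/2) ^ k)"
      by (intro sum.cong refl arg_cong[where f = "\<lambda>x. x ^ k"]) simp
    finally have *: "(\<Sum>i<L. (real (lam i) - real (Suc i) + 1/2) ^ k - (- real (Suc i) + 1/2) ^ k) =
      (\<Sum>j\<le>k. real (k choose j) * (- real_of_int c) ^ (k - j) * charge_moment j (excitations lam c)) - poly Q (real_of_int c)"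
      by (simp add: sum_subtractf)
    have "(\<Sum>i. (real (lam i) - real (Suc i) + 1/2) ^ k - (- real (Suc i) + 1/2) ^ k) =
        (\<Sum>i<L. (real (lam i) - real (Suc i) + 1/2) ^ k - (- real (Suc i) + 1/2) ^ k)"
      by (rule suminf_partition[OF L(1), of "\<lambda>i l. (real l - real (Suc i) + 1/2) ^ k - (- real (Suc i) + 1/2) ^ k"]) simp
    then show ?thesis unfolding psum_def * by simp
  qed
  then show ?thesis using Q(1,2) by blast
qed

section \<open>The q-bracket as a grand canonical mean\<close>


definition shape :: "int set \<Rightarrow> (nat \<Rightarrow> nat)" where
  "shape D = fst (inv_into (int_partitions \<times> UNIV) (\<lambda>(lam, c). excitations lam c) D)"

lemma shape_excitations:
  assumes "lam \<in> int_partitions"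
  shows "shape (excitations lam c) = lam"
proof -
  have "inv_into (int_partitions \<times> UNIV) (\<lambda>(lam, c). excitations lam c) ((\<lambda>(lam, c). excitations lam c) (lam, c)) = (lam, c)"
    using bij_betw_excitations assms by (intro inv_into_f_f) (auto simp: bij_betw_def)
  then show ?thesis by (simp add: shape_def)
qed

text \<open>Under the grand canonical weight the shape and the charge are independent, because the
  energy is the size of the partition plus half the square of the charge.\<close>
lemma infsum_shape:
  assumes "tame (\<lambda>D. G (shape D))" "h > 0"
  shows "(\<Sum>\<^sub>\<infinity>D\<in>{D. finite D}. exp (- h * energy D) * G (shape D)) =
    (\<Sum>\<^sub>\<infinity>lam\<in>int_partitions. exp (- h) ^ psize lam * G lam) * (\<Sum>\<^sub>\<infinity>c\<in>UNIV. exp (- h * (real_of_int c)\<^sup>2 / 2))"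
    and "(\<lambda>lam. exp (- h) ^ psize lam * G lam) summable_on int_partitions"
proof -
  define f where "f D = exp (- h * energy D) * G (shape D)" for D
  define g where "g lam = exp (- h) ^ psize lam * G lam" for lam
  define t where "t c = exp (- h * (real_of_int c)\<^sup>2 / 2)" for c
  have sf: "f summable_on {D. finite D}" unfolding f_def by (rule summable_tame[OF assms])
  have fg: "f (excitations lam c) = g lam * t c" if "lam \<in> int_partitions" for lam c
  proof -
    have "exp (- h * energy (excitations lam c)) = exp (real (psize lam) * (- h) + - h * (real_of_int c)\<^sup>2 / 2)"
      unfolding energy_excitations(2)[OF that] by (simp add: algebra_simps)
    also have "\<dots> = exp (- h) ^ psize lam * t c" unfolding exp_add exp_of_nat_mult t_def ..
    finally show ?thesis by (simp add: f_def g_def shape_excitations[OF that])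
  qed
  have e1: "(\<lambda>p. f ((\<lambda>(lam, c). excitations lam c) p)) summable_on int_partitions \<times> UNIV"
    unfolding summable_on_reindex_bij_betw[OF bij_betw_excitations] by (rule sf)
  have cong: "f ((\<lambda>(lam, c). excitations lam c) p) = (\<lambda>(lam, c). g lam * t c) p" if "p \<in> int_partitions \<times> UNIV" for p
    using that fg by auto
  have e2: "(\<lambda>(lam, c). g lam * t c) summable_on int_partitions \<times> UNIV"
    using e1 cong by (subst summable_on_cong[of _ _ "\<lambda>p. f ((\<lambda>(lam, c). excitations lam c) p)"]) auto
  have "infsum f {D. finite D} = infsum (\<lambda>p. f ((\<lambda>(lam, c). excitations lam c) p)) (int_partitions \<times> UNIV)"
    by (rule infsum_reindex_bij_betw[OF bij_betw_excitations, symmetric])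
  also have "\<dots> = infsum (\<lambda>(lam, c). g lam * t c) (int_partitions \<times> UNIV)" by (rule infsum_cong[OF cong])
  also have "\<dots> = (\<Sum>\<^sub>\<infinity>lam\<in>int_partitions. \<Sum>\<^sub>\<infinity>c\<in>UNIV. g lam * t c)"
    using infsum_Sigma'_banach[of "\<lambda>lam c. g lam * t c" int_partitions "\<lambda>_. UNIV"] e2 by simp
  also have "\<dots> = (\<Sum>\<^sub>\<infinity>lam\<in>int_partitions. g lam) * infsum t UNIV"
    by (simp add: infsum_cmult_right' infsum_cmult_left')
  finally show "(\<Sum>\<^sub>\<infinity>D\<in>{D. finite D}. exp (- h * energy D) * G (shape D)) =
    (\<Sum>\<^sub>\<infinity>lam\<in>int_partitions. exp (- h) ^ psize lam * G lam) * (\<Sum>\<^sub>\<infinity>c\<in>UNIV. exp (- h * (real_of_int c)\<^sup>2 / 2))"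
    unfolding f_def g_def t_def .
  have "(\<lambda>p. (\<lambda>(lam, c). g lam * t c) p) summable_on (\<lambda>lam. (lam, 0)) ` int_partitions"
    by (rule summable_on_subset_banach[OF e2]) auto
  then have "(\<lambda>lam. g lam * t 0) summable_on int_partitions"
    by (subst (asm) summable_on_reindex) (auto simp: inj_on_def o_def)
  then show "(\<lambda>lam. exp (- h) ^ psize lam * G lam) summable_on int_partitions" by (simp add: t_def g_def)
qed

section \<open>Euler's product for the generating function of partitions\<close>

definition partitions_upto :: "nat \<Rightarrow> (nat \<Rightarrow> nat) set" where
  "partitions_upto N = {lam \<in> int_partitions. lam N = 0}"

lemma partitions_upto_zero:
  assumes "lam \<in> partitions_upto N" "i \<ge> N"
  shows "lam i = 0"
proof -
  have "antimono lam" using assms(1) by (simp add: partitions_upto_def int_partitions_def)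
  then have "lam i \<le> lam N" using assms(2) by (rule antimonoD)
  moreover have "lam N = 0" using assms(1) by (simp add: partitions_upto_def)
  ultimately show ?thesis by simp
qed

lemma psize_eq_sum:
  assumes "\<And>i. i \<ge> N \<Longrightarrow> lam i = 0"
  shows "psize lam = (\<Sum>i<N. lam i)"
proof -
  have "{i. lam i \<noteq> 0} \<subseteq> {..<N}"
  proof
    fix i assume "i \<in> {i. lam i \<noteq> 0}"
    then show "i \<in> {..<N}" using assms[of i] by (cases "i < N") auto
  qed
  then show ?thesis unfolding psize_def by (intro sum.mono_neutral_left) auto
qed

text \<open>The number \<open>r\<close> is the smallest of the \<open>Suc N\<close> parts, possibly
  0; removing it from all of them strips the columns of full height \<open>Suc N\<close> from the
  Young diagram.\<close>

lemma partitions_upto_Suc: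
  "bij_betw (\<lambda>(lam, r) i. lam i + (if i \<le> N then r else 0)) (partitions_upto N \<times> UNIV) (partitions_upto (Suc N))"
proof (rule bij_betw_byWitness[where f' = "\<lambda>mu. (\<lambda>i. mu i - (if i \<le> N then mu N else 0), mu N)"])
  show "\<forall>p\<in>partitions_upto N \<times> UNIV. (\<lambda>mu. (\<lambda>i. mu i - (if i \<le> N then mu N else 0), mu N)) ((\<lambda>(lam, r) i. lam i + (if i \<le> N then r else 0)) p) = p"
    by (auto simp: partitions_upto_def fun_eq_iff)
  have anti: "mu N \<le> mu i" if "mu \<in> partitions_upto (Suc N)" "i \<le> N" for mu i
    using that by (auto simp: partitions_upto_def int_partitions_def antimono_def)
  show "\<forall>mu\<in>partitions_upto (Suc N). (\<lambda>(lam, r) i. lam i + (if i \<le> N then r else 0)) ((\<lambda>mu. (\<lambda>i. mu i - (if i \<le> N then mu N else 0), mu N)) mu) = mu"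
    using anti by (auto simp: fun_eq_iff)
  show "(\<lambda>(lam, r) i. lam i + (if i \<le> N then r else 0)) ` (partitions_upto N \<times> UNIV) \<subseteq> partitions_upto (Suc N)"
  proof safe
    fix lam r assume lam: "lam \<in> partitions_upto N"
    let ?m = "\<lambda>i. lam i + (if i \<le> N then r else 0)"
    have "antimono lam" using lam by (simp add: partitions_upto_def int_partitions_def)
    then have "antimono ?m" using antimonoD[of lam] by (intro antimonoI add_mono) auto
    moreover have "{i. ?m i \<noteq> 0} \<subseteq> {..N}"
    proof
      fix i assume "i \<in> {i. ?m i \<noteq> 0}"
      then show "i \<in> {..N}" using partitions_upto_zero[OF lam, of i] by (cases "i \<le> N") auto
    qed
    moreover have "?m (Suc N) = 0" using partitions_upto_zero[OF lam, of "Suc N"] by simp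
    ultimately show "?m \<in> partitions_upto (Suc N)"
      unfolding partitions_upto_def int_partitions_def using finite_subset by blast
  qed
  show "(\<lambda>mu. (\<lambda>i. mu i - (if i \<le> N then mu N else 0), mu N)) ` partitions_upto (Suc N) \<subseteq> partitions_upto N \<times> UNIV"
  proof safe
    fix mu assume mu: "mu \<in> partitions_upto (Suc N)"
    let ?l = "\<lambda>i. mu i - (if i \<le> N then mu N else 0)"
    have z: "mu i = 0" if "i > N" for i using partitions_upto_zero[OF mu] that by simp
    have "antimono ?l"
    proof (rule antimonoI)
      fix i j :: nat assume "i \<le> j"
      then have "mu j \<le> mu i" using mu by (auto simp: partitions_upto_def int_partitions_def antimono_def)
      then show "?l j \<le> ?l i" using \<open>i \<le> j\<close> z[of j] by (cases "j \<le> N") auto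
    qed
    moreover have "finite {i. mu i \<noteq> 0}" using mu by (simp add: partitions_upto_def int_partitions_def)
    then have "finite {i. ?l i \<noteq> 0}" by (rule rev_finite_subset) auto
    moreover have "?l N = 0" by simp
    ultimately show "?l \<in> partitions_upto N"
      unfolding partitions_upto_def int_partitions_def by blast
  qed simp
qed

text \<open>The \<open>r\<close> full columns add \<open>r * Suc N\<close> to the size, so allowing
  one more part multiplies the sum by a geometric series in \<open>q ^ Suc N\<close>.\<close>

lemma has_sum_partitions_upto:
  assumes q: "0 < q" "q < (1::real)"
  shows "((\<lambda>lam. q ^ psize lam) has_sum (1 / (\<Prod>i<N. 1 - q ^ Suc i))) (partitions_upto N)"
proof (induction N)
  case 0
  have "partitions_upto 0 = {\<lambda>_. 0}"
    using partitions_upto_zero[of _ 0] by (auto simp: partitions_upto_def int_partitions_def antimono_def)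
  moreover have "psize (\<lambda>_. 0) = 0" by (simp add: psize_def)
  ultimately show ?case using has_sum_finite[of "{\<lambda>_. 0}" "\<lambda>lam. q ^ psize lam"] by simp
next
  case (Suc N)
  define Z where "Z = 1 / (\<Prod>i<N. 1 - q ^ Suc i)"
  have qN: "0 < q ^ Suc N" "q ^ Suc N < 1" using q by (simp_all add: power_Suc_less_one del: power_Suc)
  have geo: "((\<lambda>r. (q ^ Suc N) ^ r) has_sum (1 / (1 - q ^ Suc N))) UNIV"
    using qN geometric_sums[of "q ^ Suc N"] by (intro sums_nonneg_imp_has_sum) (auto simp del: power_Suc)
  have size: "psize (\<lambda>i. lam i + (if i \<le> N then r else 0)) = psize lam + r * Suc N" if "lam \<in> partitions_upto N" for lam r
  proof -
    have "psize (\<lambda>i. lam i + (if i \<le> N then r else 0)) = (\<Sum>i<Suc N. lam i + (if i \<le> N then r else 0))"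
      using partitions_upto_zero[OF that] by (intro psize_eq_sum) auto
    also have "\<dots> = (\<Sum>i<Suc N. lam i) + (\<Sum>i<Suc N. r)" unfolding sum.distrib[symmetric] by (intro sum.cong) auto
    also have "(\<Sum>i<Suc N. lam i) = psize lam" using partitions_upto_zero[OF that] by (intro psize_eq_sum[symmetric]) auto
    finally show ?thesis by (simp add: mult.commute)
  qed
  let ?f = "\<lambda>(lam, r). q ^ psize lam * (q ^ Suc N) ^ r"
  have "(?f has_sum (Z * (1 / (1 - q ^ Suc N)))) (partitions_upto N \<times> UNIV)"
  proof (rule has_sum_SigmaI)
    show "((\<lambda>r. ?f (lam, r)) has_sum (q ^ psize lam * (1 / (1 - q ^ Suc N)))) UNIV" for lam
      using has_sum_cmult_right[OF geo, of "q ^ psize lam"] by (simp del: power_Suc)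
    show "((\<lambda>lam. q ^ psize lam * (1 / (1 - q ^ Suc N))) has_sum (Z * (1 / (1 - q ^ Suc N)))) (partitions_upto N)"
      using Suc unfolding Z_def by (rule has_sum_cmult_left)
    show "?f summable_on partitions_upto N \<times> UNIV"
    proof (rule summable_on_SigmaI)
      show "((\<lambda>r. ?f (lam, r)) has_sum (q ^ psize lam * (1 / (1 - q ^ Suc N)))) UNIV" for lam
        using has_sum_cmult_right[OF geo, of "q ^ psize lam"] by (simp del: power_Suc)
      show "(\<lambda>lam. q ^ psize lam * (1 / (1 - q ^ Suc N))) summable_on partitions_upto N"
        using has_sum_cmult_left[OF Suc] by (rule has_sum_imp_summable)
    qed (use q in auto)
  qed
  also have "(?f has_sum (Z * (1 / (1 - q ^ Suc N)))) (partitions_upto N \<times> UNIV) \<longleftrightarrow>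
      ((\<lambda>p. q ^ psize ((\<lambda>(lam, r) i. lam i + (if i \<le> N then r else 0)) p)) has_sum (Z * (1 / (1 - q ^ Suc N)))) (partitions_upto N \<times> UNIV)"
    using size by (intro has_sum_cong) (auto simp: power_add power_mult[symmetric] mult.commute simp del: power_Suc mult_Suc mult_Suc_right)
  also have "\<dots> \<longleftrightarrow> ((\<lambda>lam. q ^ psize lam) has_sum (Z * (1 / (1 - q ^ Suc N)))) (partitions_upto (Suc N))"
    by (rule has_sum_reindex_bij_betw[OF partitions_upto_Suc])
  finally show ?case by (simp add: Z_def)
qed

text \<open>The partial products are the reciprocals of subsums of the full sum, which gives one
  inequality; every finite set of partitions has a common bound on the number of parts, which gives
  the other.\<close>

theorem euler_partition_product:
  assumes q: "0 < q" "q < (1::real)" and sm: "(\<lambda>lam. q ^ psize lam) summable_on int_partitions"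
  shows "(\<Prod>n. 1 - q ^ Suc n) * (\<Sum>\<^sub>\<infinity>lam\<in>int_partitions. q ^ psize lam) = 1"
proof -
  define S where "S = (\<Sum>\<^sub>\<infinity>lam\<in>int_partitions. q ^ psize lam)"
  have "summable (\<lambda>n. q * q ^ n)" using q by (intro summable_mult summable_geometric) auto
  then have cp: "convergent_prod (\<lambda>n. 1 - q ^ Suc n)"
    using q by (intro abs_convergent_prod_imp_convergent_prod summable_imp_abs_convergent_prod) simp
  have nz: "1 - q ^ Suc n \<noteq> 0" for n using q power_Suc_less_one[of q n] by simp
  have P: "(\<lambda>n. \<Prod>i\<le>n. 1 - q ^ Suc i) \<longlonglongrightarrow> (\<Prod>n. 1 - q ^ Suc n)" "(\<Prod>n. 1 - q ^ Suc n) \<noteq> 0"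
    by (rule convergent_prod_LIMSEQ[OF cp], rule prodinf_nonzero[OF cp nz])
  define b where "b N = 1 / (\<Prod>i<N. 1 - q ^ Suc i)" for N
  have "(\<lambda>N. b (Suc N)) \<longlonglongrightarrow> 1 / (\<Prod>n. 1 - q ^ Suc n)"
    unfolding b_def lessThan_Suc_atMost by (intro tendsto_divide tendsto_const P)
  then have b: "b \<longlonglongrightarrow> 1 / (\<Prod>n. 1 - q ^ Suc n)" by (rule LIMSEQ_imp_Suc)
  have bN: "(\<Sum>\<^sub>\<infinity>lam\<in>partitions_upto N. q ^ psize lam) = b N" "(\<lambda>lam. q ^ psize lam) summable_on partitions_upto N" for N
    using has_sum_partitions_upto[OF q, of N] unfolding b_def by (auto intro: infsumI has_sum_imp_summable)
  have sub: "partitions_upto N \<subseteq> int_partitions" for N by (auto simp: partitions_upto_def)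
  have le: "b N \<le> S" for N
    unfolding bN(1)[symmetric] S_def using q by (intro infsum_mono2 bN sm sub) auto
  then have "1 / (\<Prod>n. 1 - q ^ Suc n) \<le> S" by (intro LIMSEQ_le_const2[OF b]) auto
  moreover have "S \<le> 1 / (\<Prod>n. 1 - q ^ Suc n)"
    unfolding S_def
  proof (rule infsum_le_finite_sums[OF sm])
    fix F assume F: "finite F" "F \<subseteq> int_partitions"
    have "\<exists>N. \<forall>lam\<in>F. lam \<in> partitions_upto N"
      using F
    proof (induction F rule: finite_induct)
      case (insert lam F)
      then obtain N where N: "\<forall>mu\<in>F. mu \<in> partitions_upto N" by auto
      have lam: "lam \<in> int_partitions" using insert.prems by blast
      then obtain L where L: "\<forall>i\<ge>L. lam i = 0" using int_partitions_bounded by blast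
      have "mu \<in> partitions_upto (max N L)" if "mu \<in> insert lam F" for mu
        using that N L insert.prems partitions_upto_zero[of mu N "max N L"] by (auto simp: partitions_upto_def)
      then show ?case by blast
    qed simp
    then obtain N where N: "F \<subseteq> partitions_upto N" by blast
    have "(\<Sum>lam\<in>F. q ^ psize lam) \<le> b M" if "M \<ge> N" for M
    proof -
      have "partitions_upto N \<subseteq> partitions_upto M" using partitions_upto_zero[of _ N M] that by (auto simp: partitions_upto_def)
      then show ?thesis unfolding bN(1)[symmetric] using F N q by (intro finite_sum_le_infsum bN) auto
    qed
    then show "(\<Sum>lam\<in>F. q ^ psize lam) \<le> 1 / (\<Prod>n. 1 - q ^ Suc n)" by (intro LIMSEQ_le_const[OF b]) auto
  qed
  ultimately have "S = 1 / (\<Prod>n. 1 - q ^ Suc n)" by simp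
  then show ?thesis using P(2) unfolding S_def[symmetric] by simp
qed

text \<open>The theta series of the charge occurs in the numerator and in the partition function and
  cancels; Euler's product turns the normalisation of the bracket into the reciprocal of the sum
  over partitions.\<close>

theorem qbracket_eq_grand_mean:
  assumes "tame (\<lambda>D. G (shape D))" "h > 0"
  shows "qbracket G (exp (- h)) = grand_mean h (\<lambda>D. G (shape D))"
proof -
  let ?q = "exp (- h)"
  let ?\<theta> = "\<Sum>\<^sub>\<infinity>c\<in>UNIV. exp (- h * (real_of_int c)\<^sup>2 / 2)"
  let ?Z = "\<Sum>\<^sub>\<infinity>lam\<in>int_partitions. ?q ^ psize lam"
  have one: "partition_function h = ?Z * ?\<theta>" and sm: "(\<lambda>lam. ?q ^ psize lam) summable_on int_partitions"
    using infsum_shape[of "\<lambda>_. 1", OF tame_const assms(2)] by (simp_all add: partition_function_def)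
  have "(\<Prod>n. 1 - ?q ^ Suc n) * ?Z = 1"
    using assms(2) by (intro euler_partition_product sm) auto
  moreover from this have "?Z \<noteq> 0" by auto
  ultimately have "(\<Prod>n. 1 - ?q ^ Suc n) = 1 / ?Z" by (simp add: field_simps)
  moreover have "?\<theta> \<noteq> 0" using one partition_function_pos[OF assms(2)] by auto
  ultimately show ?thesis
    unfolding qbracket_def grand_mean_def infsum_shape(1)[OF assms] one by simp
qed

section \<open>Cumulants of the power sums\<close>


text \<open>The value at 0 is 0, so the generator of index 0 is the charge itself.\<close>

definition zeta_constant :: "nat \<Rightarrow> real" where
  "zeta_constant k = (if k = 0 then 0 else (1 - 1 / 2 ^ k) * Re (riemann_zeta (- of_nat k)))"

definition generator :: "nat \<Rightarrow> int set \<Rightarrow> real" where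
  "generator k D = zeta_constant k + charge_moment k D"

definition monomial :: "nat list \<Rightarrow> int set \<Rightarrow> real" where
  "monomial t D = (\<Prod>l<length t. generator (t ! l) D)"

text \<open>Linear combinations of products of generators, the generator of index k having weight k
  + 1. Every monomial has a factor, which forces \<open>d \<ge> 1\<close> and makes the truncated
  \<open>d i - 1\<close> in the degree bounds a true subtraction. The inductive form matches the
  later reduction to monomials by multilinearity.\<close>

inductive weight_le :: "nat \<Rightarrow> (int set \<Rightarrow> real) \<Rightarrow> bool" for d where
  monomial: "t \<noteq> [] \<Longrightarrow> (\<Sum>l<length t. Suc (t ! l)) \<le> d \<Longrightarrow> weight_le d (monomial t)"
| add: "weight_le d X \<Longrightarrow> weight_le d Y \<Longrightarrow> weight_le d (\<lambda>D. X D + Y D)"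
| cmult: "weight_le d X \<Longrightarrow> weight_le d (\<lambda>D. c * X D)"

lemma tame_generator: "tame (generator k)"
  unfolding generator_def[abs_def] by (intro tame_add tame_const tame_charge_moment)

lemma tame_weight_le: "weight_le d X \<Longrightarrow> tame X"
proof (induction rule: weight_le.induct)
  case (monomial t)
  show ?case unfolding monomial_def[abs_def] by (intro tame_prod tame_generator)
qed (auto intro: tame_add tame_mult tame_const)

lemma weight_le_sum:
  assumes "d \<ge> 1" "\<And>i. i \<in> I \<Longrightarrow> weight_le d (X i)"
  shows "weight_le d (\<lambda>D. \<Sum>i\<in>I. X i D)"
proof -
  have z: "weight_le d (\<lambda>D. 0)"
    using weight_le.cmult[OF weight_le.monomial[of "[0]" d], of 0] assms(1) by simp
  show ?thesis using assms(2)
    by (induction I rule: infinite_finite_induct) (auto intro: z weight_le.add)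
qed

lemma weight_le_charge_power:
  assumes "e \<ge> 1" "e \<le> d"
  shows "weight_le d (\<lambda>D. generator 0 D ^ e)"
proof -
  have "weight_le d (monomial (replicate e 0))" using assms by (intro weight_le.monomial) auto
  then show ?thesis by (simp add: monomial_def[abs_def])
qed

lemma weight_le_charge_power_mult:
  assumes "e + j + 1 \<le> d"
  shows "weight_le d (\<lambda>D. generator 0 D ^ e * generator j D)"
proof -
  have len: "{..<length (replicate e 0 @ [j])} = insert e {..<e}" by auto
  have "weight_le d (monomial (replicate e 0 @ [j]))"
  proof (rule weight_le.monomial)
    show "(\<Sum>l<length (replicate e 0 @ [j]). Suc ((replicate e 0 @ [j]) ! l)) \<le> d"
      unfolding len using assms by (simp add: nth_append)
  qed simp
  moreover have "monomial (replicate e 0 @ [j]) = (\<lambda>D. generator 0 D ^ e * generator j D)"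
    unfolding monomial_def[abs_def] len by (simp add: nth_append mult.commute)
  ultimately show ?thesis by simp
qed

text \<open>The zeta constant is absorbed by the generator of the same index, so no constant term
  occurs.\<close>
lemma weight_le_psum:
  assumes k: "k \<ge> 1"
  shows "\<exists>X. weight_le (Suc k) X \<and> (\<forall>D. finite D \<longrightarrow> psum k (shape D) = X D)"
proof -
  obtain Q :: "real poly" where Q: "degree Q \<le> Suc k" "poly Q 0 = 0"
    "\<And>lam c. lam \<in> int_partitions \<Longrightarrow> psum k lam =
      (\<Sum>j\<le>k. real (k choose j) * (- real_of_int c) ^ (k - j) * charge_moment j (excitations lam c))
       - poly Q (real_of_int c) + (1 - 1 / 2 ^ k) * Re (riemann_zeta (- of_nat k))"
    using psum_excitations[of k] by blast
  \<comment> \<open>Each \<open>charge_moment j\<close> is replaced by \<open>generator j\<close>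
    minus its constant. For \<open>j < k\<close> the constant is multiplied by a positive power of
    the charge, and for \<open>j = k\<close> it cancels the zeta term of \<open>psum\<close>; as
    \<open>Q\<close> vanishes at 0, no constant term remains.\<close>
  define X where "X D = (\<Sum>j<k. (real (k choose j) * (-1) ^ (k - j)) * (generator 0 D ^ (k - j) * generator j D))
      + ((\<Sum>j<k. (- (real (k choose j) * (-1) ^ (k - j) * zeta_constant j)) * generator 0 D ^ (k - j))
      + (generator 0 D ^ 0 * generator k D + (\<Sum>e\<in>{1..Suc k}. (- coeff Q e) * generator 0 D ^ e)))" for D
  have "weight_le (Suc k) X"
    unfolding X_def[abs_def]
    by (intro weight_le.add weight_le_sum weight_le.cmult weight_le_charge_power_mult weight_le_charge_power) auto
  moreover have "psum k (shape D) = X D" if D: "finite D" for D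
  proof -
    have "D \<in> (\<lambda>(lam, c). excitations lam c) ` (int_partitions \<times> UNIV)"
      using bij_betw_imp_surj_on[OF bij_betw_excitations] D by blast
    then obtain lam c where lam: "lam \<in> int_partitions" and Dlam: "D = excitations lam c" by auto
    have g0: "generator 0 D = real_of_int c"
      using energy_excitations(1)[OF lam, of c] by (simp add: generator_def zeta_constant_def Dlam)
    have cm: "charge_moment j D = generator j D - zeta_constant j" for j by (simp add: generator_def)
    have "poly Q x = (\<Sum>e\<in>{1..Suc k}. coeff Q e * x ^ e)" for x
    proof -
      have "poly Q x = (\<Sum>e\<le>Suc k. coeff Q e * x ^ e)"
        unfolding poly_altdef using Q(1) by (intro sum.mono_neutral_left) (auto simp: coeff_eq_0)
      also have "{..Suc k} = insert 0 {1..Suc k}" by auto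
      also have "coeff Q 0 = 0" using Q(2) by (simp add: poly_0_coeff_0)
      ultimately show ?thesis by simp
    qed
    note pQ = this
    have split: "{..k} = insert k {..<k}" by auto
    have neg: "(- real_of_int c) ^ e = (-1) ^ e * real_of_int c ^ e" for e by (rule power_minus)
    have "(\<Sum>j\<le>k. real (k choose j) * (- real_of_int c) ^ (k - j) * charge_moment j D) =
      (generator k D - zeta_constant k) + (\<Sum>j<k. real (k choose j) * (- real_of_int c) ^ (k - j) * (generator j D - zeta_constant j))"
      unfolding split cm by simp
    also have "(\<Sum>j<k. real (k choose j) * (- real_of_int c) ^ (k - j) * (generator j D - zeta_constant j)) =
      (\<Sum>j<k. (real (k choose j) * (-1) ^ (k - j)) * (generator 0 D ^ (k - j) * generator j D)) +
      (\<Sum>j<k. (- (real (k choose j) * (-1) ^ (k - j) * zeta_constant j)) * generator 0 D ^ (k - j))"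
      unfolding sum.distrib[symmetric] g0 neg by (intro sum.cong refl) (simp add: algebra_simps)
    finally have "psum k lam = (generator k D - zeta_constant k) +
      ((\<Sum>j<k. (real (k choose j) * (-1) ^ (k - j)) * (generator 0 D ^ (k - j) * generator j D)) +
      (\<Sum>j<k. (- (real (k choose j) * (-1) ^ (k - j) * zeta_constant j)) * generator 0 D ^ (k - j)))
      - poly Q (real_of_int c) + (1 - 1 / 2 ^ k) * Re (riemann_zeta (- of_nat k))"
      using Q(3)[OF lam, of c] unfolding Dlam by simp
    moreover have "(1 - 1 / 2 ^ k) * Re (riemann_zeta (- of_nat k)) = zeta_constant k"
      using k by (simp add: zeta_constant_def)
    moreover have "(\<Sum>e\<in>{1..Suc k}. (- coeff Q e) * generator 0 D ^ e) = - poly Q (real_of_int c)"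
      unfolding pQ g0 by (simp add: sum_negf)
    moreover have "shape D = lam" unfolding Dlam by (rule shape_excitations[OF lam])
    ultimately show ?thesis unfolding X_def by simp
  qed
  ultimately show ?thesis by blast
qed

section \<open>Multilinearity and the degree bound for joint cumulants\<close>

definition grand_joint_cumulant :: "real \<Rightarrow> 'i set \<Rightarrow> ('i \<Rightarrow> int set \<Rightarrow> real) \<Rightarrow> real" where
  "grand_joint_cumulant h I Z = cumulant (\<lambda>B. grand_mean h (\<lambda>D. \<Prod>i\<in>B. Z i D)) I"

lemma prod_through_block:
  assumes "finite I" "i \<in> I" "partition_on I P"
  obtains B where "B \<in> P" "i \<in> B" "\<And>C. C \<in> P - {B} \<Longrightarrow> i \<notin> C" "finite P"
proof -
  obtain B where B: "B \<in> P" "i \<in> B" using assms by (auto simp: partition_on_def)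
  moreover have "i \<notin> C" if "C \<in> P - {B}" for C
    using that B assms(3) by (auto simp: partition_on_def disjoint_def)
  ultimately show ?thesis using that finite_elements[OF assms(1,3)] by blast
qed

text \<open>In every partition exactly one block contains \<open>i\<close>, so each product of
  moments is linear in the entry at \<open>i\<close>.\<close>

lemma cumulant_linear:
  assumes "finite I" "i \<in> I"
    and "\<And>B. B \<subseteq> I \<Longrightarrow> i \<in> B \<Longrightarrow> M B = a * M1 B + b * M2 B"
    and "\<And>B. i \<notin> B \<Longrightarrow> M B = M1 B" "\<And>B. i \<notin> B \<Longrightarrow> M B = M2 B"
  shows "cumulant M I = a * cumulant M1 I + b * cumulant M2 I"
proof -
  have "(\<Prod>B\<in>P. M B) = a * (\<Prod>B\<in>P. M1 B) + b * (\<Prod>B\<in>P. M2 B)" if P: "partition_on I P" for P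
  proof -
    obtain B where B: "B \<in> P" "i \<in> B" "\<And>C. C \<in> P - {B} \<Longrightarrow> i \<notin> C" "finite P"
      using prod_through_block[OF assms(1,2) P] by blast
    have BI: "B \<subseteq> I" using B(1) P by (auto simp: partition_on_def)
    have "(\<Prod>C\<in>P - {B}. M1 C) = (\<Prod>C\<in>P - {B}. M C)" "(\<Prod>C\<in>P - {B}. M2 C) = (\<Prod>C\<in>P - {B}. M C)"
      using B(3) assms(4,5) by (auto intro!: prod.cong)
    then show ?thesis using B assms(3)[OF BI B(2)] by (simp add: prod.remove[OF B(4,1)] algebra_simps)
  qed
  then show ?thesis
    unfolding cumulant_def sum_distrib_left sum.distrib[symmetric]
    by (intro sum.cong refl) (simp add: algebra_simps)
qed

lemma grand_joint_cumulant_linear: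
  assumes "finite I" "i \<in> I" "\<And>j. tame (Z j)" "tame X" "tame Y" "h > 0"
  shows "grand_joint_cumulant h I (Z(i := \<lambda>D. a * X D + b * Y D)) =
    a * grand_joint_cumulant h I (Z(i := X)) + b * grand_joint_cumulant h I (Z(i := Y))"
  unfolding grand_joint_cumulant_def
proof (rule cumulant_linear[OF assms(1,2)])
  fix B
  let ?E = "\<lambda>V. grand_mean h (\<lambda>D. \<Prod>j\<in>B. (Z(i := V)) j D)"
  assume "B \<subseteq> I" and i: "i \<in> B"
  then have True: "finite B" using assms(1) finite_subset by blast
  show "?E (\<lambda>D. a * X D + b * Y D) = a * ?E X + b * ?E Y"
  proof -
    let ?R = "\<lambda>D. \<Prod>j\<in>B - {i}. Z j D"
    have R: "(\<Prod>j\<in>B. (Z(i := V)) j D) = V D * ?R D" for V D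
    proof -
      have "(\<Prod>j\<in>B - {i}. (Z(i := V)) j D) = ?R D" by (intro prod.cong) auto
      then show ?thesis using i True by (simp add: prod.remove[of B i])
    qed
    have t: "tame (\<lambda>D. a * (V D * ?R D))" if "tame V" for V a
      using that by (intro tame_mult tame_prod tame_const assms)
    have "grand_mean h (\<lambda>D. (a * X D + b * Y D) * ?R D) = grand_mean h (\<lambda>D. a * (X D * ?R D) + b * (Y D * ?R D))"
      by (simp add: algebra_simps)
    also have "\<dots> = a * grand_mean h (\<lambda>D. X D * ?R D) + b * grand_mean h (\<lambda>D. Y D * ?R D)"
      by (subst grand_mean_add[OF t[OF assms(4)] t[OF assms(5)] assms(6)]) (simp only: grand_mean_cmult)
    finally show ?thesis unfolding R .
  qed
next
  fix B assume "i \<notin> B"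
  then have "(\<Prod>j\<in>B. (Z(i := V)) j D) = (\<Prod>j\<in>B. Z j D)" for V D by (intro prod.cong) auto
  then show "grand_mean h (\<lambda>D. \<Prod>j\<in>B. (Z(i := \<lambda>D. a * X D + b * Y D)) j D) = grand_mean h (\<lambda>D. \<Prod>j\<in>B. (Z(i := X)) j D)"
    "grand_mean h (\<lambda>D. \<Prod>j\<in>B. (Z(i := \<lambda>D. a * X D + b * Y D)) j D) = grand_mean h (\<lambda>D. \<Prod>j\<in>B. (Z(i := Y)) j D)"
    by simp_all
qed

lemma grand_joint_cumulant_cong:
  assumes "\<And>i D. i \<in> I \<Longrightarrow> finite D \<Longrightarrow> Z i D = Z' i D"
  shows "grand_joint_cumulant h I Z = grand_joint_cumulant h I Z'"
  unfolding grand_joint_cumulant_def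
proof (rule cumulant_cong)
  fix B assume "B \<subseteq> I"
  then have "exp (- h * energy D) * (\<Prod>i\<in>B. Z i D) = exp (- h * energy D) * (\<Prod>i\<in>B. Z' i D)" if "finite D" for D
    using assms that by (intro arg_cong2[where f = "(*)"] prod.cong) auto
  then show "grand_mean h (\<lambda>D. \<Prod>i\<in>B. Z i D) = grand_mean h (\<lambda>D. \<Prod>i\<in>B. Z' i D)"
    unfolding grand_mean_def by (intro arg_cong2[where f = "(/)"] infsum_cong refl) simp
qed

text \<open>The joint cumulant becomes a sum over linked partitions \<open>P\<close> of all factors.
  A block contributes degree 1 plus the sum of its indices, hence \<open>P\<close> contributes
  \<open>card P\<close> plus the sum of all indices; with
  \<open>card P \<le> card U + 1 - card I\<close> this is at most 1 plus the sum of the weights,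
  each lowered by one.\<close>

lemma grand_joint_cumulant_monomials:
  fixes t :: "'i \<Rightarrow> nat list" and d :: "'i \<Rightarrow> nat"
  assumes I: "finite I" "I \<noteq> {}" and t: "\<And>i. i \<in> I \<Longrightarrow> t i \<noteq> []"
    and d: "\<And>i. i \<in> I \<Longrightarrow> (\<Sum>l<length (t i). Suc (t i ! l)) \<le> d i"
  shows "h_degree_le (\<lambda>h. grand_joint_cumulant h I (\<lambda>i. monomial (t i))) (Suc (\<Sum>i\<in>I. d i - 1))"
proof -
  \<comment> \<open>Factors are labelled by their position, so that a generator occurring
    repeatedly, as powers of the charge do, gives distinct elements.\<close>
  define U where "U = (SIGMA i:I. {..<length (t i)})"
  define k where "k = (\<lambda>(i, l). t i ! l)"
  define M where "M h B = grand_mean h (\<lambda>D. \<Prod>u\<in>B. zeta_constant (k u) + charge_moment (k u) D)" for h B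
  have finU: "finite U" using I by (simp add: U_def)
  have fU: "fst ` U \<subseteq> I" by (auto simp: U_def)
  have part: "{u\<in>U. fst u \<in> I} = U" by (auto simp: U_def)
  have one: "M h {} = 1" if "h > 0" for h using that by (simp add: M_def grand_mean_1)
  have fib: "M h {u\<in>U. fst u \<in> S} = grand_mean h (\<lambda>D. \<Prod>i\<in>S. monomial (t i) D)" if "S \<subseteq> I" for S h
  proof -
    have "{u\<in>U. fst u \<in> S} = (SIGMA i:S. {..<length (t i)})" using that by (auto simp: U_def)
    moreover have "finite S" using that I finite_subset by auto
    ultimately have "(\<Prod>u\<in>{u\<in>U. fst u \<in> S}. zeta_constant (k u) + charge_moment (k u) D) = (\<Prod>i\<in>S. monomial (t i) D)" for D
      by (simp add: monomial_def generator_def k_def prod.Sigma case_prod_beta)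
    then show ?thesis by (simp add: M_def)
  qed
  have eq: "grand_joint_cumulant h I (\<lambda>i. monomial (t i)) =
    (\<Sum>P | partition_on U P \<and> linked fst I P. \<Prod>B\<in>P. cumulant (M h) B)" if h: "h > 0" for h
  proof -
    have "grand_joint_cumulant h I (\<lambda>i. monomial (t i)) = cumulant (\<lambda>S. M h {u\<in>U. fst u \<in> S}) I"
      unfolding grand_joint_cumulant_def by (rule cumulant_cong) (simp add: fib)
    also have "\<dots> = (\<Sum>P | partition_on U P \<and> linked fst I P. \<Prod>B\<in>P. cumulant (M h) B)"
      unfolding cumulant_fibres[where M = "M h" and f = fst, OF finU I one[OF h]] part ..
    finally show ?thesis .
  qed
  have "h_degree_le (\<lambda>h. \<Sum>P | partition_on U P \<and> linked fst I P. \<Prod>B\<in>P. cumulant (M h) B) (Suc (\<Sum>i\<in>I. d i - 1))"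
  proof (rule h_degree_le_sum)
    fix P assume "P \<in> {P. partition_on U P \<and> linked fst I P}"
    then have P: "partition_on U P" "linked fst I P" by auto
    have "h_degree_le (\<lambda>h. cumulant (M h) B) (Suc (\<Sum>u\<in>B. k u))" if "B \<in> P" for B
    proof -
      have "B \<subseteq> U" "B \<noteq> {}" using that P by (auto simp: partition_on_def)
      then show ?thesis unfolding M_def using finU finite_subset by (intro grand_cumulant_degree) auto
    qed
    then have "h_degree_le (\<lambda>h. \<Prod>B\<in>P. cumulant (M h) B) (\<Sum>B\<in>P. Suc (\<Sum>u\<in>B. k u))"
      by (rule h_degree_le_prod)
    moreover have "(\<Sum>B\<in>P. Suc (\<Sum>u\<in>B. k u)) \<le> Suc (\<Sum>i\<in>I. d i - 1)"
    proof -
      have finP: "finite P" by (rule finite_elements[OF finU P(1)])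
      have "(\<Sum>B\<in>P. Suc (\<Sum>u\<in>B. k u)) = card P + (\<Sum>u\<in>U. k u)"
        unfolding sum_sum_partition[OF finU P(1), symmetric] by (simp add: sum_Suc)
      moreover have "card P + card I \<le> card U + 1" by (rule linked_card_le[OF finU P(1) fU P(2) I])
      moreover have "card U + (\<Sum>u\<in>U. k u) = (\<Sum>i\<in>I. \<Sum>l<length (t i). Suc (t i ! l))"
      proof -
        have "(\<Sum>i\<in>I. \<Sum>l<length (t i). t i ! l) = (\<Sum>u\<in>U. k u)"
          unfolding U_def k_def by (rule sum.Sigma) (use I in auto)
        then show ?thesis using I by (simp add: sum_Suc sum.distrib U_def)
      qed
      moreover have "\<dots> \<le> (\<Sum>i\<in>I. d i)" by (rule sum_mono) (rule d)
      moreover have "(\<Sum>i\<in>I. d i) = (\<Sum>i\<in>I. d i - 1) + card I"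
      proof -
        have "d i = (d i - 1) + 1" if "i \<in> I" for i
        proof -
          have "length (t i) \<ge> 1" using t[OF that] by (cases "t i") auto
          moreover have "length (t i) \<le> (\<Sum>l<length (t i). Suc (t i ! l))" by (simp add: sum_Suc)
          ultimately show ?thesis using d[OF that] by simp
        qed
        then have "(\<Sum>i\<in>I. d i) = (\<Sum>i\<in>I. (d i - 1) + 1)" by (rule sum.cong[OF refl])
        then show ?thesis by (simp only: sum.distrib sum_constant mult_1_right of_nat_id)
      qed
      ultimately show ?thesis by linarith
    qed
    ultimately show "h_degree_le (\<lambda>h. \<Prod>B\<in>P. cumulant (M h) B) (Suc (\<Sum>i\<in>I. d i - 1))"
      by (rule h_degree_le_mono)
  qed
  then show ?thesis by (rule h_degree_le_cong[rotated]) (simp add: eq)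
qed

lemma grand_joint_cumulant_degree:
  fixes d :: "'i \<Rightarrow> nat"
  assumes I: "finite I" "I \<noteq> {}" and Z: "\<And>i. i \<in> I \<Longrightarrow> weight_le (d i) (Z i)"
  shows "h_degree_le (\<lambda>h. grand_joint_cumulant h I Z) (Suc (\<Sum>i\<in>I. d i - 1))"
proof -
  let ?mon = "\<lambda>i X. \<exists>t. t \<noteq> [] \<and> (\<Sum>l<length t. Suc (t ! l)) \<le> d i \<and> X = monomial t"
  let ?bound = "\<lambda>Z. h_degree_le (\<lambda>h. grand_joint_cumulant h I Z) (Suc (\<Sum>i\<in>I. d i - 1))"
  \<comment> \<open>\<open>J\<close> holds the indices whose entries are still arbitrary; outside it
    all entries are monomials. One entry at a time is reduced to monomials by rule induction on
    \<open>weight_le\<close>, using linearity in that entry.\<close>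
  have "\<forall>Z. (\<forall>i\<in>J. weight_le (d i) (Z i)) \<longrightarrow> (\<forall>i\<in>I - J. ?mon i (Z i)) \<longrightarrow> (\<forall>i. tame (Z i)) \<longrightarrow> ?bound Z"
    if "finite J" "J \<subseteq> I" for J
    using that
  proof (induction J rule: finite_induct)
    case empty
    show ?case
    proof (intro allI impI)
      fix Z assume "\<forall>i\<in>I - {}. ?mon i (Z i)"
      then have "\<forall>i\<in>I. ?mon i (Z i)" by simp
      then obtain t where t: "\<And>i. i \<in> I \<Longrightarrow> t i \<noteq> [] \<and> (\<Sum>l<length (t i). Suc (t i ! l)) \<le> d i \<and> Z i = monomial (t i)"
        using bchoice[of I "\<lambda>i t. t \<noteq> [] \<and> (\<Sum>l<length t. Suc (t ! l)) \<le> d i \<and> Z i = monomial t"] by blast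
      have "?bound (\<lambda>i. monomial (t i))" using t by (intro grand_joint_cumulant_monomials I) auto
      then show "?bound Z"
      proof (rule h_degree_le_cong[rotated])
        fix h
        show "grand_joint_cumulant h I (\<lambda>i. monomial (t i)) = grand_joint_cumulant h I Z"
          using t by (intro grand_joint_cumulant_cong) simp
      qed
    qed
  next
    case (insert i J)
    show ?case
    proof (intro allI impI)
      fix Z assume Z: "\<forall>i\<in>insert i J. weight_le (d i) (Z i)" "\<forall>i\<in>I - insert i J. ?mon i (Z i)" "\<forall>i. tame (Z i)"
      have iI: "i \<in> I" using insert.prems by simp
      have "weight_le (d i) X \<Longrightarrow> ?bound (Z(i := X))" for X
      proof (induction X rule: weight_le.induct)
        case (monomial t)
        have "tame (monomial t)" using weight_le.monomial[OF monomial] by (rule tame_weight_le)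
        moreover have "J \<subseteq> I" using insert.prems by simp
        moreover have "weight_le (d j) ((Z(i := monomial t)) j)" if "j \<in> J" for j
          using Z(1) that insert.hyps by auto
        moreover have "?mon j ((Z(i := monomial t)) j)" if "j \<in> I - J" for j
        proof (cases "j = i")
          case True
          then show ?thesis using monomial by auto
        next
          case False
          then show ?thesis using Z(2) that by simp
        qed
        ultimately show ?case using Z(3) by (intro insert.IH[rule_format]) auto
      next
        case (add X Y)
        have "?bound (Z(i := \<lambda>D. 1 * X D + 1 * Y D))"
        proof (rule h_degree_le_cong)
          show "h_degree_le (\<lambda>h. 1 * grand_joint_cumulant h I (Z(i := X)) + 1 * grand_joint_cumulant h I (Z(i := Y))) (Suc (\<Sum>i\<in>I. d i - 1))"
            by (intro h_degree_le_add h_degree_le_cmult add.IH)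
        qed (use Z(3) tame_weight_le[OF add(1)] tame_weight_le[OF add(2)] in
            \<open>intro grand_joint_cumulant_linear[symmetric] I(1) iI; simp\<close>)
        then show ?case by (simp only: mult_1_left)
      next
        case (cmult X c)
        have "?bound (Z(i := \<lambda>D. c * X D + 0 * X D))"
        proof (rule h_degree_le_cong)
          show "h_degree_le (\<lambda>h. c * grand_joint_cumulant h I (Z(i := X)) + 0 * grand_joint_cumulant h I (Z(i := X))) (Suc (\<Sum>i\<in>I. d i - 1))"
            by (intro h_degree_le_add h_degree_le_cmult cmult.IH)
        qed (use Z(3) tame_weight_le[OF cmult(1)] in
            \<open>intro grand_joint_cumulant_linear[symmetric] I(1) iI; simp\<close>)
        then show ?case by (simp only: mult_zero_left add_0_right)
      qed
      from this[of "Z i"] show "?bound Z" using Z(1) by simp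
    qed
  qed
  note main = this[OF I(1) order_refl, rule_format]
  \<comment> \<open>The entries outside \<open>I\<close> do not affect the cumulant; the default 0
    makes all entries tame, as the statement just proved demands.\<close>
  let ?Z = "\<lambda>i. if i \<in> I then Z i else (\<lambda>_. 0)"
  have "?bound ?Z" using Z tame_weight_le[OF Z] by (intro main) (auto intro: tame_const)
  then show ?thesis
  proof (rule h_degree_le_cong[rotated])
    fix h
    show "grand_joint_cumulant h I ?Z = grand_joint_cumulant h I Z"
      by (rule grand_joint_cumulant_cong) simp
  qed
qed

section \<open>Expansions of the connected brackets of power sums\<close>

lemma tame_cong: "(\<And>D. finite D \<Longrightarrow> X D = Y D) \<Longrightarrow> tame X \<Longrightarrow> tame Y"
  unfolding tame_def by metis

lemma tame_psum:
  assumes "k \<ge> 1"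
  shows "tame (\<lambda>D. psum k (shape D))"
proof -
  obtain X where X: "weight_le (Suc k) X" "\<And>D. finite D \<Longrightarrow> psum k (shape D) = X D"
    using weight_le_psum[OF assms] by blast
  show ?thesis by (rule tame_cong[OF _ tame_weight_le[OF X(1)]]) (simp add: X(2))
qed

lemma connected_qbracket_eq_cumulant:
  "connected_qbracket I F q = cumulant (\<lambda>B. qbracket (\<lambda>lam. \<Prod>i\<in>B. F i lam) q) I"
  by (simp add: connected_qbracket_def cumulant_def)

theorem connected_qbracket_degree:
  assumes I: "finite I" "I \<noteq> {}" and m: "\<And>i. i \<in> I \<Longrightarrow> m i \<ge> 1"
  shows "h_degree_le (\<lambda>h. connected_qbracket I (\<lambda>i. psum (m i)) (exp (- h))) (Suc (\<Sum>i\<in>I. m i))"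
proof -
  have "\<forall>i\<in>I. \<exists>X. weight_le (Suc (m i)) X \<and> (\<forall>D. finite D \<longrightarrow> psum (m i) (shape D) = X D)"
    using weight_le_psum m by blast
  then obtain X where X: "\<And>i. i \<in> I \<Longrightarrow> weight_le (Suc (m i)) (X i)"
    "\<And>i D. i \<in> I \<Longrightarrow> finite D \<Longrightarrow> psum (m i) (shape D) = X i D"
    using bchoice[of I "\<lambda>i X. weight_le (Suc (m i)) X \<and> (\<forall>D. finite D \<longrightarrow> psum (m i) (shape D) = X D)"] by blast
  have "h_degree_le (\<lambda>h. grand_joint_cumulant h I X) (Suc (\<Sum>i\<in>I. Suc (m i) - 1))"
    by (rule grand_joint_cumulant_degree[OF I X(1)])
  then show ?thesis
  proof (rule h_degree_le_mono[OF h_degree_le_cong, rotated])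
    fix h :: real assume h: "h > 0"
    have "connected_qbracket I (\<lambda>i. psum (m i)) (exp (- h)) = grand_joint_cumulant h I (\<lambda>i D. psum (m i) (shape D))"
      unfolding connected_qbracket_eq_cumulant grand_joint_cumulant_def
    proof (rule cumulant_cong)
      fix B assume "B \<subseteq> I"
      then have "tame (\<lambda>D. \<Prod>i\<in>B. psum (m i) (shape D))" using m by (intro tame_prod tame_psum) auto
      then show "qbracket (\<lambda>lam. \<Prod>i\<in>B. psum (m i) lam) (exp (- h)) = grand_mean h (\<lambda>D. \<Prod>i\<in>B. psum (m i) (shape D))"
        using h by (rule qbracket_eq_grand_mean)
    qed
    also have "\<dots> = grand_joint_cumulant h I X" by (rule grand_joint_cumulant_cong) (simp add: X(2))
    finally show "grand_joint_cumulant h I X = connected_qbracket I (\<lambda>i. psum (m i)) (exp (- h))" ..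
  qed simp
qed

lemma connected_hbracket_eqI:
  assumes "is_h_expansion (\<lambda>h. connected_qbracket I F (exp (- h))) P"
  shows "connected_hbracket I F = P"
  unfolding connected_hbracket_def using assms is_h_expansion_unique by blast

lemma connected_hbracket_psum:
  assumes "finite I" "I \<noteq> {}" "\<And>i. i \<in> I \<Longrightarrow> m i \<ge> 1"
  shows "is_h_expansion (\<lambda>h. connected_qbracket I (\<lambda>i. psum (m i)) (exp (- h))) (connected_hbracket I (\<lambda>i. psum (m i)))"
    "degree (connected_hbracket I (\<lambda>i. psum (m i))) \<le> Suc (\<Sum>i\<in>I. m i)"
proof -
  have deg: "h_degree_le (\<lambda>h. connected_qbracket I (\<lambda>i. psum (m i)) (exp (- h))) (Suc (\<Sum>i\<in>I. m i))"
    by (rule connected_qbracket_degree) (use assms in auto)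
  obtain P where P: "is_h_expansion (\<lambda>h. connected_qbracket I (\<lambda>i. psum (m i)) (exp (- h))) P" "degree P \<le> Suc (\<Sum>i\<in>I. m i)"
    using deg unfolding h_degree_le_def by blast
  note eq = connected_hbracket_eqI[OF P(1)]
  show "is_h_expansion (\<lambda>h. connected_qbracket I (\<lambda>i. psum (m i)) (exp (- h))) (connected_hbracket I (\<lambda>i. psum (m i)))"
    "degree (connected_hbracket I (\<lambda>i. psum (m i))) \<le> Suc (\<Sum>i\<in>I. m i)"
    unfolding eq by (rule P)+
qed

section \<open>Complementary partitions and the leading coefficient\<close>


lemma union_of_blocks_iff:
  assumes "partition_on A P" "B \<subseteq> A"
  shows "(\<exists>S\<subseteq>P. B = \<Union>S) \<longleftrightarrow> (\<forall>C\<in>P. C \<inter> B \<noteq> {} \<longrightarrow> C \<subseteq> B)"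
proof
  assume "\<exists>S\<subseteq>P. B = \<Union>S"
  then obtain S where S: "S \<subseteq> P" "B = \<Union>S" by blast
  show "\<forall>C\<in>P. C \<inter> B \<noteq> {} \<longrightarrow> C \<subseteq> B"
  proof (intro ballI impI)
    fix C assume C: "C \<in> P" "C \<inter> B \<noteq> {}"
    then obtain C' where "C' \<in> S" "C \<inter> C' \<noteq> {}" using S(2) by blast
    moreover have "C = C'"
      using partition_onD2[OF assms(1)] C(1) S(1) calculation by (auto simp: disjoint_def)
    ultimately show "C \<subseteq> B" using S(2) by blast
  qed
next
  assume sat: "\<forall>C\<in>P. C \<inter> B \<noteq> {} \<longrightarrow> C \<subseteq> B"
  have "B = \<Union>{C\<in>P. C \<inter> B \<noteq> {}}"
  proof
    show "B \<subseteq> \<Union>{C\<in>P. C \<inter> B \<noteq> {}}"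
    proof
      fix b assume b: "b \<in> B"
      then have "b \<in> \<Union>P" using assms by (auto simp: partition_on_def)
      then show "b \<in> \<Union>{C\<in>P. C \<inter> B \<noteq> {}}" using b by blast
    qed
    show "\<Union>{C\<in>P. C \<inter> B \<noteq> {}} \<subseteq> B" using sat by blast
  qed
  then show "\<exists>S\<subseteq>P. B = \<Union>S" by (intro exI[of _ "{C\<in>P. C \<inter> B \<noteq> {}}"]) auto
qed

lemma common_coarsenings_iff:
  assumes "P \<in> set_partitions n" "\<rho> \<in> set_partitions n"
  shows "\<gamma> \<in> common_coarsenings n P \<rho> \<longleftrightarrow> partition_on {1..n} \<gamma> \<and>
    (\<forall>B\<in>\<gamma>. (\<forall>C\<in>P. C \<inter> B \<noteq> {} \<longrightarrow> C \<subseteq> B) \<and> (\<forall>C\<in>\<rho>. C \<inter> B \<noteq> {} \<longrightarrow> C \<subseteq> B))"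
proof -
  have P: "partition_on {1..n} P" "partition_on {1..n} \<rho>" using assms by (simp_all add: set_partitions_def)
  have "((\<exists>S\<subseteq>P. B = \<Union>S) \<and> (\<exists>S\<subseteq>\<rho>. B = \<Union>S)) \<longleftrightarrow>
      ((\<forall>C\<in>P. C \<inter> B \<noteq> {} \<longrightarrow> C \<subseteq> B) \<and> (\<forall>C\<in>\<rho>. C \<inter> B \<noteq> {} \<longrightarrow> C \<subseteq> B))"
    if "B \<in> \<gamma>" "partition_on {1..n} \<gamma>" for B
  proof -
    have "B \<subseteq> {1..n}" using that by (auto simp: partition_on_def)
    then show ?thesis using union_of_blocks_iff[OF P(1)] union_of_blocks_iff[OF P(2)] by simp
  qed
  note eq = this
  show ?thesis
    unfolding common_coarsenings_def set_partitions_def mem_Collect_eq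
    by (rule conj_cong[OF refl ball_cong[OF refl eq]])
qed

text \<open>Intersections of sets that cut no block cut no block either, so the common refinement of
  all common coarsenings is again a common coarsening. The family is nonempty because it contains
  the one-block partition, and antisymmetry of refinement makes the \<open>THE\<close> in
  \<open>wedge\<close> well defined.\<close>

lemma wedge_properties:
  assumes "P \<in> set_partitions n" "\<rho> \<in> set_partitions n" "n \<ge> 1"
  shows "wedge n P \<rho> \<in> common_coarsenings n P \<rho>"
    "\<delta> \<in> common_coarsenings n P \<rho> \<Longrightarrow> refines {1..n} (wedge n P \<rho>) \<delta>"
proof -
  let ?CC = "common_coarsenings n P \<rho>"
  note iff = common_coarsenings_iff[OF assms(1,2)]
  have Psub: "C \<subseteq> {1..n}" if "C \<in> P \<or> C \<in> \<rho>" for C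
    using that assms(1,2) partition_onD1[of "{1..n}" P] partition_onD1[of "{1..n}" \<rho>] by (auto simp: set_partitions_def)
  have top: "{{1..n}} \<in> ?CC"
    unfolding iff using Psub assms(3) by (auto intro!: partition_on_space)
  define \<gamma> where "\<gamma> = common_refinement ?CC"
  have part: "\<And>\<delta>. \<delta> \<in> ?CC \<Longrightarrow> partition_on {1..n} \<delta>" unfolding iff by blast
  have ref: "refines {1..n} \<gamma> \<delta>" if "\<delta> \<in> ?CC" for \<delta>
    unfolding \<gamma>_def by (rule refines_common_refinement[OF part that])
  have "\<gamma> \<in> ?CC"
    unfolding iff
  proof (intro conjI ballI impI)
    show "partition_on {1..n} \<gamma>" unfolding \<gamma>_def using part top by (intro partition_on_common_refinement) auto
    fix B assume "B \<in> \<gamma>"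
    then obtain f where f: "f \<in> (\<Pi> \<delta>\<in>?CC. \<delta>)" "B = \<Inter>(f ` ?CC)" unfolding \<gamma>_def common_refinement by auto
    have sat: "(\<forall>C\<in>P. C \<inter> f \<delta> \<noteq> {} \<longrightarrow> C \<subseteq> f \<delta>) \<and> (\<forall>C\<in>\<rho>. C \<inter> f \<delta> \<noteq> {} \<longrightarrow> C \<subseteq> f \<delta>)" if "\<delta> \<in> ?CC" for \<delta>
    proof -
      have "f \<delta> \<in> \<delta>" using f(1) that by auto
      then show ?thesis using that unfolding iff by blast
    qed
    show "C \<subseteq> B" if "C \<in> P" "C \<inter> B \<noteq> {}" for C
      unfolding f(2)
    proof (rule INF_greatest)
      fix \<delta> assume "\<delta> \<in> ?CC"
      moreover from this have "C \<inter> f \<delta> \<noteq> {}" using that(2) unfolding f(2) by blast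
      ultimately show "C \<subseteq> f \<delta>" using sat that(1) by blast
    qed
    show "C \<subseteq> B" if "C \<in> \<rho>" "C \<inter> B \<noteq> {}" for C
      unfolding f(2)
    proof (rule INF_greatest)
      fix \<delta> assume "\<delta> \<in> ?CC"
      moreover from this have "C \<inter> f \<delta> \<noteq> {}" using that(2) unfolding f(2) by blast
      ultimately show "C \<subseteq> f \<delta>" using sat that(1) by blast
    qed
  qed
  moreover have "\<gamma>' = \<gamma>" if "\<gamma>' \<in> ?CC \<and> (\<forall>\<delta>\<in>?CC. refines {1..n} \<gamma>' \<delta>)" for \<gamma>'
    using that ref \<open>\<gamma> \<in> ?CC\<close> by (intro refines_asym) auto
  ultimately have "wedge n P \<rho> = \<gamma>" unfolding wedge_def using ref by (intro the_equality) auto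
  then show "wedge n P \<rho> \<in> ?CC" "\<delta> \<in> ?CC \<Longrightarrow> refines {1..n} (wedge n P \<rho>) \<delta>"
    using \<open>\<gamma> \<in> ?CC\<close> ref by auto
qed

text \<open>With \<open>f\<close> sending a point to its block of \<open>\<rho>\<close>, a set
  \<open>J\<close> of blocks of \<open>\<rho>\<close> is uncut exactly when its union is a union of
  blocks of \<open>P\<close>. A proper uncut \<open>J\<close> gives a common coarsening into two
  blocks; conversely every block of the join is the union of an uncut \<open>J\<close>.\<close>

lemma wedge_top_iff_linked:
  assumes P: "P \<in> set_partitions n" and \<rho>: "\<rho> \<in> set_partitions n" and n: "n \<ge> 1"
    and f: "\<And>x. x \<in> {1..n} \<Longrightarrow> f x \<in> \<rho> \<and> x \<in> f x"
  shows "wedge n P \<rho> = {{1..n}} \<longleftrightarrow> linked f \<rho> P"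
proof -
  note iff = common_coarsenings_iff[OF P \<rho>]
  have UP: "\<Union>P = {1..n}" and U\<rho>: "\<Union>\<rho> = {1..n}" and dis: "disjoint \<rho>" "disjoint P" and ne: "{} \<notin> \<rho>"
    using P \<rho> by (auto simp: set_partitions_def partition_on_def)
  have fx: "f x = C" if "x \<in> C" "C \<in> \<rho>" for x C
  proof -
    have "x \<in> {1..n}" using that U\<rho> by blast
    from f[OF this] show ?thesis using that dis(1) by (auto simp: disjoint_def)
  qed
  have mem: "x \<in> \<Union>J \<longleftrightarrow> f x \<in> J" if "x \<in> {1..n}" "J \<subseteq> \<rho>" for x J
    using f[OF that(1)] fx that(2) by blast
  have sat: "saturated f P J \<longleftrightarrow> (\<forall>C\<in>P. C \<inter> \<Union>J \<noteq> {} \<longrightarrow> C \<subseteq> \<Union>J)" if J: "J \<subseteq> \<rho>" for J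
  proof -
    have "(f ` C \<inter> J \<noteq> {} \<longleftrightarrow> C \<inter> \<Union>J \<noteq> {}) \<and> (f ` C \<subseteq> J \<longleftrightarrow> C \<subseteq> \<Union>J)" if "C \<in> P" for C
    proof -
      have "x \<in> \<Union>J \<longleftrightarrow> f x \<in> J" if "x \<in> C" for x
        using mem[OF _ J, of x] that \<open>C \<in> P\<close> UP by blast
      then show ?thesis by blast
    qed
    note e = this
    show ?thesis by (rule ball_cong[OF refl]) (simp only: e)
  qed
  show ?thesis
  proof
    assume top: "wedge n P \<rho> = {{1..n}}"
    show "linked f \<rho> P"
      unfolding linked_iff
    proof (intro allI impI notI)
      fix J assume J: "J \<subseteq> \<rho>" "J \<noteq> {}" "J \<noteq> \<rho>" "saturated f P J"
      let ?B = "\<Union>J" and ?C = "{1..n} - \<Union>J"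
      obtain R where R: "R \<in> J" using J(2) by blast
      obtain R' where R': "R' \<in> \<rho>" "R' \<notin> J" using J by blast
      have R'C: "R' \<inter> ?B = {}" using R' J(1) dis(1) by (fastforce simp: disjoint_def)
      have "R \<in> \<rho>" using R J(1) by (rule rev_subsetD)
      then have "R \<noteq> {}" using ne by metis
      then have ne1: "?B \<noteq> {}" using R by auto
      have ne2: "?C \<noteq> {}"
      proof -
        have "R' \<noteq> {}" using R'(1) ne by metis
        then obtain x where x: "x \<in> R'" by (meson ex_in_conv)
        have "R' \<subseteq> {1..n}" using R'(1) unfolding U\<rho>[symmetric] by (rule Union_upper)
        then have "x \<in> {1..n}" using x by (rule subsetD)
        moreover have "x \<notin> ?B"
        proof
          assume "x \<in> ?B"
          then have "x \<in> R' \<inter> ?B" using x by (intro IntI)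
          then show False unfolding R'C by (rule emptyE)
        qed
        ultimately have "x \<in> ?C" by (rule DiffI)
        then show ?thesis by (metis empty_iff)
      qed
      have BI: "?B \<subseteq> {1..n}" unfolding U\<rho>[symmetric] by (rule Union_mono[OF J(1)])
      have satB: "\<forall>C\<in>P. C \<inter> ?B \<noteq> {} \<longrightarrow> C \<subseteq> ?B" using J(4) unfolding sat[OF J(1)] .
      have satB': "\<forall>C\<in>\<rho>. C \<inter> ?B \<noteq> {} \<longrightarrow> C \<subseteq> ?B"
      proof (intro ballI impI)
        fix C assume C: "C \<in> \<rho>" "C \<inter> ?B \<noteq> {}"
        then obtain x where "x \<in> C" "x \<in> ?B" by blast
        then have "C \<in> J" using mem[of x J] fx[of x C] C BI J(1) by auto
        then show "C \<subseteq> ?B" by blast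
      qed
      have "{?B, ?C} \<in> common_coarsenings n P \<rho>"
        unfolding iff
      proof (intro conjI)
        show "partition_on {1..n} {?B, ?C}" using ne1 ne2 BI by (auto simp: partition_on_def disjoint_def)
        have "\<forall>D\<in>P. D \<inter> ?C \<noteq> {} \<longrightarrow> D \<subseteq> ?C" using satB UP by blast
        moreover have "\<forall>D\<in>\<rho>. D \<inter> ?C \<noteq> {} \<longrightarrow> D \<subseteq> ?C" using satB' U\<rho> by blast
        ultimately show "\<forall>B\<in>{?B, ?C}. (\<forall>C\<in>P. C \<inter> B \<noteq> {} \<longrightarrow> C \<subseteq> B) \<and> (\<forall>C\<in>\<rho>. C \<inter> B \<noteq> {} \<longrightarrow> C \<subseteq> B)"
          using satB satB' by simp
      qed
      from wedge_properties(2)[OF P \<rho> n this]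
      have "{1..n} \<subseteq> ?B \<or> {1..n} \<subseteq> ?C" unfolding top by (simp add: refines_def)
      then show False using ne1 ne2 BI by blast
    qed
  next
    assume linked: "linked f \<rho> P"
    let ?W = "wedge n P \<rho>"
    have W: "partition_on {1..n} ?W" "\<And>B. B \<in> ?W \<Longrightarrow> (\<forall>C\<in>P. C \<inter> B \<noteq> {} \<longrightarrow> C \<subseteq> B) \<and> (\<forall>C\<in>\<rho>. C \<inter> B \<noteq> {} \<longrightarrow> C \<subseteq> B)"
      using wedge_properties(1)[OF P \<rho> n] unfolding iff by blast+
    have all: "B = {1..n}" if B: "B \<in> ?W" for B
    proof -
      have BI: "B \<subseteq> {1..n}" "B \<noteq> {}" using B W(1) by (auto simp: partition_on_def)
      obtain J where J: "J \<subseteq> \<rho>" "B = \<Union>J"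
        using union_of_blocks_iff[of "{1..n}" \<rho> B] W(2)[OF B] BI(1) \<rho> by (auto simp: set_partitions_def)
      have "saturated f P J" unfolding sat[OF J(1)] using W(2)[OF B] J(2) by simp
      moreover have "J \<noteq> {}" using J BI by blast
      ultimately have "J = \<rho>" using linked J(1) unfolding linked_iff by blast
      then show ?thesis using J(2) U\<rho> by simp
    qed
    moreover have "?W \<noteq> {}" using W(1) n by (auto simp: partition_on_def)
    ultimately show "?W = {{1..n}}" by blast
  qed
qed

section \<open>Extraction of the coefficient at the degree bound\<close>

lemma coeff_mult_at_bound:
  fixes p q :: "'a::comm_semiring_0 poly"
  assumes "degree p \<le> a" "degree q \<le> b"
  shows "coeff (p * q) (a + b) = coeff p a * coeff q b"
proof -
  have "coeff (p * q) (a + b) = (\<Sum>i\<le>a + b. coeff p i * coeff q (a + b - i))" by (rule coeff_mult)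
  also have "\<dots> = (\<Sum>i\<in>{a}. coeff p i * coeff q (a + b - i))"
  proof (rule sum.mono_neutral_right)
    show "\<forall>i\<in>{..a + b} - {a}. coeff p i * coeff q (a + b - i) = 0"
    proof
      fix i assume "i \<in> {..a + b} - {a}"
      then have "i > a \<or> a + b - i > b" by auto
      then show "coeff p i * coeff q (a + b - i) = 0" using assms by (auto simp: coeff_eq_0)
    qed
  qed auto
  finally show ?thesis by simp
qed

text \<open>Formulated with degree bounds instead of leading coefficients, since an elementary
  cumulant is a coefficient at such a bound and no claim is made that it is nonzero.\<close>

lemma coeff_prod_at_bound:
  fixes p :: "'i \<Rightarrow> 'a::comm_semiring_1 poly"
  assumes "finite I" "\<And>i. i \<in> I \<Longrightarrow> degree (p i) \<le> d i"
  shows "degree (\<Prod>i\<in>I. p i) \<le> (\<Sum>i\<in>I. d i) \<and> coeff (\<Prod>i\<in>I. p i) (\<Sum>i\<in>I. d i) = (\<Prod>i\<in>I. coeff (p i) (d i))"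
  using assms
proof (induction I rule: finite_induct)
  case (insert i I)
  then have IH: "degree (\<Prod>i\<in>I. p i) \<le> (\<Sum>i\<in>I. d i)" "coeff (\<Prod>i\<in>I. p i) (\<Sum>i\<in>I. d i) = (\<Prod>i\<in>I. coeff (p i) (d i))"
    by auto
  have di: "degree (p i) \<le> d i" using insert.prems by simp
  have "degree (p i * (\<Prod>i\<in>I. p i)) \<le> d i + (\<Sum>i\<in>I. d i)"
    by (rule order_trans[OF degree_mult_le add_mono[OF di IH(1)]])
  moreover have "coeff (p i * (\<Prod>i\<in>I. p i)) (d i + (\<Sum>i\<in>I. d i)) = coeff (p i) (d i) * (\<Prod>i\<in>I. coeff (p i) (d i))"
    unfolding coeff_mult_at_bound[OF di IH(1)] IH(2) ..
  ultimately show ?case using insert.hyps by simp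
qed simp

text \<open>The formula for cumulants of products, with the blocks of \<open>\<rho>\<close> as
  fibres, holds exactly for q-brackets at every positive \<open>h\<close>; uniqueness of expansions
  carries it over to the polynomials.\<close>

lemma block_hbracket_expansion:
  fixes f :: "nat \<Rightarrow> nat set"
  assumes n: "n \<ge> 1" and m: "\<And>i. i \<in> {1..n} \<Longrightarrow> m i \<ge> 1" and \<rho>: "\<rho> \<in> set_partitions n"
    and f: "\<And>x. x \<in> {1..n} \<Longrightarrow> f x \<in> \<rho> \<and> x \<in> f x"
  shows "block_hbracket \<rho> m =
    (\<Sum>P | partition_on {1..n} P \<and> linked f \<rho> P. \<Prod>B\<in>P. connected_hbracket B (\<lambda>i. psum (m i)))"
  unfolding block_hbracket_def
proof (rule connected_hbracket_eqI, rule is_h_expansion_cong)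
  have part: "partition_on {1..n} \<rho>" using \<rho> by (simp add: set_partitions_def)
  have U\<rho>: "\<Union>\<rho> = {1..n}" and dis: "disjoint \<rho>" and ne: "\<rho> \<noteq> {}"
    using part n by (auto simp: partition_on_def)
  have fin: "finite \<rho>" using finite_elements[OF _ part] by simp
  show "is_h_expansion (\<lambda>h. \<Sum>P | partition_on {1..n} P \<and> linked f \<rho> P.
      \<Prod>B\<in>P. connected_qbracket B (\<lambda>i. psum (m i)) (exp (- h)))
    (\<Sum>P | partition_on {1..n} P \<and> linked f \<rho> P. \<Prod>B\<in>P. connected_hbracket B (\<lambda>i. psum (m i)))"
  proof (intro is_h_expansion_sum is_h_expansion_prod connected_hbracket_psum(1))
    fix P B assume P: "P \<in> {P. partition_on {1..n} P \<and> linked f \<rho> P}" "B \<in> P"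
    then have B: "B \<subseteq> {1..n}" "B \<noteq> {}" by (auto simp: partition_on_def)
    then show "finite B" "B \<noteq> {}" using finite_subset by auto
    show "m i \<ge> 1" if "i \<in> B" for i using that B m by blast
  qed
  fix h :: real assume h: "h > 0"
  define M where "M B = qbracket (\<lambda>lam. \<Prod>i\<in>B. psum (m i) lam) (exp (- h))" for B
  have fib: "{u\<in>{1..n}. f u \<in> S} = \<Union>S" if "S \<subseteq> \<rho>" for S
  proof -
    have "u \<in> \<Union>S \<longleftrightarrow> f u \<in> S" if "u \<in> {1..n}" for u
    proof -
      have "f u = X" if "X \<in> S" "u \<in> X" for X
        using f[OF \<open>u \<in> {1..n}\<close>] that \<open>S \<subseteq> \<rho>\<close> dis unfolding disjoint_def by blast
      then show ?thesis using f[OF that] by blast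
    qed
    moreover have "\<Union>S \<subseteq> {1..n}" using that U\<rho> by blast
    ultimately show ?thesis by blast
  qed
  have "M {} = 1"
  proof -
    have "qbracket (\<lambda>lam. 1) (exp (- h)) = grand_mean h (\<lambda>D. 1)"
      by (rule qbracket_eq_grand_mean[of "\<lambda>_. 1", OF tame_const h])
    then show ?thesis using grand_mean_1[OF h] by (simp add: M_def)
  qed
  have "connected_qbracket \<rho> (\<lambda>B lam. \<Prod>i\<in>B. psum (m i) lam) (exp (- h)) = cumulant (\<lambda>S. M {u\<in>{1..n}. f u \<in> S}) \<rho>"
    unfolding connected_qbracket_eq_cumulant
  proof (rule cumulant_cong)
    fix S assume S: "S \<subseteq> \<rho>"
    have "(\<Prod>B\<in>S. \<Prod>i\<in>B. psum (m i) lam) = (\<Prod>i\<in>\<Union>S. psum (m i) lam)" for lam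
    proof (rule prod_prod_partition)
      show "finite (\<Union>S)" using S U\<rho> finite_subset[of "\<Union>S" "{1..n}"] by blast
      have "{} \<notin> S" using S part by (auto simp: partition_on_def)
      then show "partition_on (\<Union>S) S" using pairwise_subset[OF dis S] by (simp add: partition_on_def)
    qed
    then show "qbracket (\<lambda>lam. \<Prod>B\<in>S. \<Prod>i\<in>B. psum (m i) lam) (exp (- h)) = M {u\<in>{1..n}. f u \<in> S}"
      unfolding fib[OF S] M_def by simp
  qed
  also have "\<dots> = (\<Sum>P | partition_on {u\<in>{1..n}. f u \<in> \<rho>} P \<and> linked f \<rho> P. \<Prod>B\<in>P. cumulant M B)"
    by (rule cumulant_fibres) (use fin ne \<open>M {} = 1\<close> in auto)
  also have "{u\<in>{1..n}. f u \<in> \<rho>} = {1..n}" using f by auto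
  finally show "(\<Sum>P | partition_on {1..n} P \<and> linked f \<rho> P. \<Prod>B\<in>P. connected_qbracket B (\<lambda>i. psum (m i)) (exp (- h))) =
      connected_qbracket \<rho> (\<lambda>B lam. \<Prod>i\<in>B. psum (m i) lam) (exp (- h))"
    unfolding connected_qbracket_eq_cumulant M_def by simp
qed

theorem theorem6p3:
  fixes n :: nat and m :: "nat \<Rightarrow> nat" and \<rho> :: "nat set set"
  assumes "n \<ge> 1"
    and "\<And>i. i \<in> {1..n} \<Longrightarrow> m i \<ge> 1"
    and "\<rho> \<in> set_partitions n"
  shows "\<exists>R :: real poly.
    block_hbracket \<rho> m =
      monom (\<Sum>\<alpha> | \<alpha> \<in> set_partitions n \<and> complementary n \<alpha> \<rho>.
               \<Prod>B\<in>\<alpha>. elem_cumulant B m)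
            (wt n m + 1 - card \<rho>) + R
    \<and> degree R < wt n m + 1 - card \<rho>"
proof -
  have part: "partition_on {1..n} \<rho>" using assms(3) by (simp add: set_partitions_def)
  have "\<forall>x\<in>{1..n}. \<exists>B. B \<in> \<rho> \<and> x \<in> B" using part by (auto simp: partition_on_def)
  then obtain f where f: "\<And>x. x \<in> {1..n} \<Longrightarrow> f x \<in> \<rho> \<and> x \<in> f x" using bchoice[of "{1..n}" "\<lambda>x B. B \<in> \<rho> \<and> x \<in> B"] by blast
  have fin: "finite \<rho>" using finite_elements[OF _ part] by simp
  have ne: "\<rho> \<noteq> {}" using part assms(1) by (auto simp: partition_on_def)
  define L where "L = {P. partition_on {1..n} P \<and> linked f \<rho> P}"
  define N where "N = wt n m + 1 - card \<rho>"
  define H where "H B = connected_hbracket B (\<lambda>i. psum (m i))" for B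
  have finL: "finite L" unfolding L_def by (rule finite_subset[OF _ finite_partitions[of "{1..n}"]]) auto
  have card_le: "card P + card \<rho> \<le> n + 1" if "P \<in> L" for P
  proof -
    have "f ` {1..n} \<subseteq> \<rho>" using f by blast
    then show ?thesis using linked_card_le[of "{1..n}" P f \<rho>] that fin ne by (simp add: L_def)
  qed
  have card\<rho>: "card \<rho> \<le> n"
  proof -
    have "f ` {1..n} = \<rho>"
    proof
      show "\<rho> \<subseteq> f ` {1..n}"
      proof
        fix C assume C: "C \<in> \<rho>"
        then obtain x where x: "x \<in> C" using part by (metis ex_in_conv partition_onD3)
        then have "x \<in> {1..n}" using C part by (auto simp: partition_on_def)
        then have "f x = C" using f[of x] C x part by (auto simp: partition_on_def disjoint_def)
        then show "C \<in> f ` {1..n}" using \<open>x \<in> {1..n}\<close> by blast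
      qed
    qed (use f in auto)
    then show ?thesis using card_image_le[of "{1..n}" f] by simp
  qed
  have wt: "wt n m = (\<Sum>i\<in>{1..n}. m i) + n" by (simp add: wt_def sum_Suc)
  have degH: "degree (\<Prod>B\<in>P. H B) \<le> (\<Sum>i\<in>{1..n}. m i) + card P \<and>
      coeff (\<Prod>B\<in>P. H B) ((\<Sum>i\<in>{1..n}. m i) + card P) = (\<Prod>B\<in>P. elem_cumulant B m)" if P: "partition_on {1..n} P" for P
  proof -
    have "degree (H B) \<le> (\<Sum>i\<in>B. m i) + 1" if "B \<in> P" for B
    proof -
      have B: "B \<subseteq> {1..n}" "B \<noteq> {}" using that P by (auto simp: partition_on_def)
      have "degree (H B) \<le> Suc (\<Sum>i\<in>B. m i)"
        unfolding H_def
      proof (rule connected_hbracket_psum(2))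
        show "finite B" using B(1) finite_subset by auto
        show "m i \<ge> 1" if "i \<in> B" for i using that B assms(2) by blast
      qed (rule B)
      then show ?thesis by simp
    qed
    from coeff_prod_at_bound[of P H, OF finite_elements[OF _ P] this]
    show ?thesis
      unfolding sum.distrib sum_sum_partition[OF finite_atLeastAtMost P] elem_cumulant_def H_def by simp
  qed
  have expand: "block_hbracket \<rho> m = (\<Sum>P\<in>L. \<Prod>B\<in>P. H B)"
    unfolding L_def H_def by (rule block_hbracket_expansion[OF assms f])
  \<comment> \<open>Since \<open>card \<rho> \<le> n\<close>, the natural subtraction is exact, and
    \<open>n + 1 - card \<rho>\<close> is the largest number of blocks that a linked partition can
    have.\<close>
  have N: "N = (\<Sum>i\<in>{1..n}. m i) + (n + 1 - card \<rho>)" using card\<rho> by (simp add: N_def wt)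
  have deg: "degree (block_hbracket \<rho> m) \<le> N"
    unfolding expand
  proof (rule degree_sum_le[OF finL])
    fix P assume P: "P \<in> L"
    then have "degree (\<Prod>B\<in>P. H B) \<le> (\<Sum>i\<in>{1..n}. m i) + card P" using degH by (simp add: L_def)
    then show "degree (\<Prod>B\<in>P. H B) \<le> N" using card_le[OF P] unfolding N by linarith
  qed
  \<comment> \<open>Linkedness says that the join is the one-block partition, whose cardinality 1
    turns the numerical condition of complementarity into equality in the bound
    \<open>card_le\<close>.\<close>
  have compl: "P \<in> set_partitions n \<and> complementary n P \<rho> \<longleftrightarrow> P \<in> L \<and> card P + card \<rho> = n + 1" for P
  proof (cases "P \<in> set_partitions n")
    case True
    note w = wedge_top_iff_linked[OF True assms(3,1) f]
    have "complementary n P \<rho> \<longleftrightarrow> linked f \<rho> P \<and> card P + card \<rho> = n + 1"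
      unfolding complementary_def using w by (cases "linked f \<rho> P") auto
    then show ?thesis using True by (simp add: L_def set_partitions_def)
  qed (simp add: L_def set_partitions_def)
  have coeff: "coeff (block_hbracket \<rho> m) N = (\<Sum>\<alpha> | \<alpha> \<in> set_partitions n \<and> complementary n \<alpha> \<rho>. \<Prod>B\<in>\<alpha>. elem_cumulant B m)"
  proof -
    have "coeff (block_hbracket \<rho> m) N = (\<Sum>P\<in>L. coeff (\<Prod>B\<in>P. H B) N)" unfolding expand by (rule coeff_sum)
    also have "\<dots> = (\<Sum>P\<in>L. if card P + card \<rho> = n + 1 then \<Prod>B\<in>P. elem_cumulant B m else 0)"
    proof (intro sum.cong refl)
      fix P assume P: "P \<in> L"
      have d: "degree (\<Prod>B\<in>P. H B) \<le> (\<Sum>i\<in>{1..n}. m i) + card P"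
        "coeff (\<Prod>B\<in>P. H B) ((\<Sum>i\<in>{1..n}. m i) + card P) = (\<Prod>B\<in>P. elem_cumulant B m)"
        using degH P by (auto simp: L_def)
      show "coeff (\<Prod>B\<in>P. H B) N = (if card P + card \<rho> = n + 1 then \<Prod>B\<in>P. elem_cumulant B m else 0)"
      proof (cases "card P + card \<rho> = n + 1")
        case True
        then have "N = (\<Sum>i\<in>{1..n}. m i) + card P" unfolding N by linarith
        then show ?thesis using True d(2) by simp
      next
        case False
        then have "(\<Sum>i\<in>{1..n}. m i) + card P < N" using card_le[OF P] unfolding N by linarith
        then show ?thesis using False d(1) by (simp add: coeff_eq_0)
      qed
    qed
    also have "\<dots> = (\<Sum>P\<in>{P\<in>L. card P + card \<rho> = n + 1}. \<Prod>B\<in>P. elem_cumulant B m)"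
      by (rule sum.inter_filter[OF finL, symmetric])
    also have "{P\<in>L. card P + card \<rho> = n + 1} = {P. P \<in> set_partitions n \<and> complementary n P \<rho>}"
      using compl by auto
    finally show ?thesis .
  qed
  define R where "R = block_hbracket \<rho> m - monom (coeff (block_hbracket \<rho> m) N) N"
  have "degree R < N"
  proof -
    \<comment> \<open>Positivity of \<open>N\<close> covers the case \<open>R = 0\<close>, where the
      degree is 0 by convention and a vanishing coefficient alone would not give a strict
      inequality.\<close>
    have "N > 0" using card\<rho> by (simp add: N)
    have "degree R \<le> N" unfolding R_def by (intro degree_diff_le deg degree_monom_le)
    moreover have "coeff R N = 0" by (simp add: R_def)
    ultimately show ?thesis using \<open>N > 0\<close> by (metis degree_0 leading_coeff_0_iff order_le_less)
  qed
  then show ?thesis unfolding N_def[symmetric] coeff[symmetric] by (intro exI[of _ R]) (simp add: R_def)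
qed

end
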